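(* Let $M$ be a smooth $n$-dimensional manifold, $S\in\mathfrak{X}(TM)$ a semispray and $\sigma\in\Lambda^1(TM)$ a semi-basic $1$-form. The semispray $S$ is of Lagrangian type with covariant force field $\sigma$ if and only if there exists a non-trivial, semi-basic $1$-form $\theta\in\Lambda^1(TM)$ such that the following generalized Helmholtz conditions are satisfied: $(GH_1)$ $d_J\theta=0$; $(GH_2)$ $d_\Phi\theta=\frac12\nabla d_J\sigma-d_h\sigma$; $(GH_3)$ $\nabla d_v\theta=d_v\sigma-\frac12 i_{\mathbb{F}+J}d_J\sigma$.
   Context: $TM$ is the tangent bundle with projection $\pi:TM\to M$ and induced local coordinates $(x^i,y^i)$. The Liouville vector field is $\mathbb{C}=y^i\frac{\partial}{\partial y^i}$ and the tangent structure is $J=\frac{\partial}{\partial y^i}\otimes dx^i$. A semispray is a globally defined vector field $S$ on $TM$ with $JS=\mathbb{C}$; locally $S=y^i\frac{\partial}{\partial x^i}-2G^i(x,y)\frac{\partial}{\partial y^i}$. A form on $TM$ is semi-basic if it vanishes whenever one of its arguments is vertical (tangent to the fibres of $\pi$); a semi-basic $1$-form is locally $\theta=\theta_i(x,y)dx^i$. A semi-basic $1$-form $\theta$ is non-trivial if the matrix $g_{ij}=\partial\theta_i/\partial y^j$ is non-trivial (not identically zero). A Lagrangian is a smooth function $L$ whose Hessian $\frac{\partial^2L}{\partial y^i\partial y^j}$ is non-trivial (not identically zero). For a vector-valued $1$-form $K$ (a $(1,1)$-tensor), $i_K$ is the derivation of degree $0$ on forms, $(i_K\alpha)(X_1,\dots,X_k)=\sum_a\alpha(X_1,\dots,KX_a,\dots,X_k)$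 ($i_Kf=0$ on functions), and $d_K=i_K\circ d-d\circ i_K$. For a semispray $S$, let $[S,K]=\mathcal{L}_SK$. The horizontal and vertical projectors are $h=\frac12(\mathrm{Id}-[S,J])$, $v=\frac12(\mathrm{Id}+[S,J])$; locally $h=\frac{\delta}{\delta x^i}\otimes dx^i$, $v=\frac{\partial}{\partial y^i}\otimes\delta y^i$, with $\frac{\delta}{\delta x^i}=\frac{\partial}{\partial x^i}-N^j_i\frac{\partial}{\partial y^j}$, $\delta y^i=dy^i+N^i_jdx^j$, $N^i_j=\frac{\partial G^i}{\partial y^j}$. The almost complex structure is $\mathbb{F}=h\circ[S,h]-J$, locally $\mathbb{F}=\frac{\delta}{\delta x^i}\otimes\delta y^i-\frac{\partial}{\partial y^i}\otimes dx^i$. The Jacobi endomorphism is $\Phi=v\circ[S,h]$, locally $\Phi=R^i_j\frac{\partial}{\partial y^i}\otimes dx^j$ with $R^i_j=2\frac{\partial G^i}{\partial x^j}-S(N^i_j)-N^i_rN^r_j$. The dynamical covariant derivative is given by $\nabla f=S(f)$ on functions, $\nabla X=h[S,hX]+v[S,vX]$ on vector fields, and on forms $\nabla=\mathcal{L}_S-i_{\mathbb{F}+J-\Phi}$. The Lagrange differential of a function $L$ is $\delta_SL=\mathcal{L}_Sd_JL-dL=\left\{S\left(\frac{\partial L}{\partial y^i}\right)-\frac{\partial L}{\partial x^i}\right\}dx^i$. Definition: $S$ is of Lagrangian type with covariant force field $\sigma$ if there exists a (locally defined) Lagrangian $L$ such that $\delta_SL=\sigma$.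
   Formalization: The 1-form θ, like the Lagrangian, is taken to be locally defined: for each point of TM, a Lagrangian on some open neighbourhood exists iff such a θ on some open neighbourhood exists; with θ globally defined on TM the "only if" part fails, e.g. for the flat spray on a Hopf manifold with σ=0. *)

theory Defs
  imports "HOL-Analysis.Analysis"
begin

section \<open>Smooth manifolds given by an atlas\<close>

text \<open>On an open set this is the usual notion of a $C^k$ map (with values in a normed space)
  when the source is finite-dimensional; it is only used on open subsets of Euclidean spaces.\<close>

fun Ck_on :: "nat \<Rightarrow> 'a set \<Rightarrow> ('a::real_normed_vector \<Rightarrow> 'b::real_normed_vector) \<Rightarrow> bool" where
  "Ck_on 0 U f = continuous_on U f"
| "Ck_on (Suc k) U f =
     ((\<forall>x\<in>U. f differentiable (at x)) \<and> (\<forall>v. Ck_on k U (\<lambda>x. frechet_derivative f (at x) v)))"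

definition smooth_on :: "'a set \<Rightarrow> ('a::real_normed_vector \<Rightarrow> 'b::real_normed_vector) \<Rightarrow> bool" where
  "smooth_on U f \<longleftrightarrow> (\<forall>k. Ck_on k U f)"

text \<open>A chart is a pair of its domain and its coordinate map; the values of the map
  outside the domain are irrelevant.\<close>

type_synonym ('p, 'e) chart = "'p set \<times> ('p \<Rightarrow> 'e)"

definition chart_image :: "('p, 'e) chart \<Rightarrow> 'p set \<Rightarrow> 'e set" where
  "chart_image c W = snd c ` (W \<inter> fst c)"

definition chart_inv :: "('p, 'e) chart \<Rightarrow> 'e \<Rightarrow> 'p" where
  "chart_inv c = inv_into (fst c) (snd c)"

definition transition :: "('p, 'e) chart \<Rightarrow> ('p, 'e) chart \<Rightarrow> 'e \<Rightarrow> 'e" where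
  "transition c c' = snd c' \<circ> chart_inv c"

definition is_chart :: "'p topology \<Rightarrow> ('p, 'e::euclidean_space) chart \<Rightarrow> bool" where
  "is_chart X c \<longleftrightarrow> openin X (fst c) \<and> open (snd c ` fst c) \<and>
     homeomorphic_map (subtopology X (fst c)) (top_of_set (snd c ` fst c)) (snd c)"

definition smooth_manifold :: "'p topology \<Rightarrow> ('p, 'e::euclidean_space) chart set \<Rightarrow> bool" where
  "smooth_manifold X A \<longleftrightarrow>
     Hausdorff_space X \<and> second_countable X \<and>
     (\<forall>c\<in>A. is_chart X c) \<and> (\<Union>c\<in>A. fst c) = topspace X \<and>
     (\<forall>c\<in>A. \<forall>c'\<in>A. smooth_on (chart_image c (fst c')) (transition c c'))"

text \<open>A tangent vector at \<open>p\<close> is given by its components in all charts of the atlas around \<open>p\<close>,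
  subject to the transformation law. The components in all other charts are set to zero,
  so that distinct families are distinct vectors.\<close>

type_synonym ('p, 'e) tvec = "('p, 'e) chart \<Rightarrow> 'e"

definition charts_at :: "('p, 'e) chart set \<Rightarrow> 'p \<Rightarrow> ('p, 'e) chart set" where
  "charts_at A p = {c \<in> A. p \<in> fst c}"

definition tangent_space ::
  "('p, 'e::euclidean_space) chart set \<Rightarrow> 'p \<Rightarrow> ('p, 'e) tvec set" where
  "tangent_space A p = {v.
     (\<forall>c\<in>charts_at A p. \<forall>c'\<in>charts_at A p.
        v c' = frechet_derivative (transition c c') (at (snd c p)) (v c)) \<and>
     (\<forall>c. c \<notin> charts_at A p \<longrightarrow> v c = 0)}"

text \<open>The tangent vector at \<open>p\<close> whose component vector in the chart \<open>c\<close> is \<open>w\<close>.\<close>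

definition tvec_of ::
  "('p, 'e::euclidean_space) chart set \<Rightarrow> ('p, 'e) chart \<Rightarrow> 'p \<Rightarrow> 'e \<Rightarrow> ('p, 'e) tvec" where
  "tvec_of A c p w = (\<lambda>c'. if c' \<in> charts_at A p
     then frechet_derivative (transition c c') (at (snd c p)) w else 0)"

text \<open>Openness of a set of points, for the topology induced by an atlas.\<close>

definition atlas_open :: "('p, 'e::euclidean_space) chart set \<Rightarrow> 'p set \<Rightarrow> bool" where
  "atlas_open A W \<longleftrightarrow> W \<subseteq> (\<Union>c\<in>A. fst c) \<and> (\<forall>c\<in>A. open (chart_image c W))"

definition fun_rep :: "('p, 'e) chart \<Rightarrow> ('p \<Rightarrow> real) \<Rightarrow> 'e \<Rightarrow> real" where
  "fun_rep c f z = f (chart_inv c z)"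

definition smooth_function ::
  "('p, 'e::euclidean_space) chart set \<Rightarrow> 'p set \<Rightarrow> ('p \<Rightarrow> real) \<Rightarrow> bool" where
  "smooth_function A W f \<longleftrightarrow> (\<forall>c\<in>A. smooth_on (chart_image c W) (fun_rep c f))"

definition field_rep :: "('p, 'e) chart \<Rightarrow> ('p \<Rightarrow> ('p, 'e) tvec) \<Rightarrow> 'e \<Rightarrow> 'e" where
  "field_rep c X z = X (chart_inv c z) c"

definition vector_field ::
  "('p, 'e::euclidean_space) chart set \<Rightarrow> 'p set \<Rightarrow> ('p \<Rightarrow> ('p, 'e) tvec) \<Rightarrow> bool" where
  "vector_field A W X \<longleftrightarrow> (\<forall>p\<in>W. X p \<in> tangent_space A p) \<and>
     (\<forall>c\<in>A. smooth_on (chart_image c W) (field_rep c X))"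

definition covector_rep ::
  "('p, 'e::euclidean_space) chart set \<Rightarrow> ('p, 'e) chart \<Rightarrow> ('p \<Rightarrow> ('p, 'e) tvec \<Rightarrow> real)
     \<Rightarrow> 'e \<Rightarrow> 'e \<Rightarrow> real" where
  "covector_rep A c \<theta> z w = \<theta> (chart_inv c z) (tvec_of A c (chart_inv c z) w)"

definition one_form ::
  "('p, 'e::euclidean_space) chart set \<Rightarrow> 'p set \<Rightarrow> ('p \<Rightarrow> ('p, 'e) tvec \<Rightarrow> real) \<Rightarrow> bool" where
  "one_form A W \<theta> \<longleftrightarrow>
     (\<forall>p\<in>W. \<forall>v\<in>tangent_space A p. \<forall>w\<in>tangent_space A p. \<forall>a b.
        \<theta> p (\<lambda>c. a *\<^sub>R v c + b *\<^sub>R w c) = a * \<theta> p v + b * \<theta> p w) \<and>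
     (\<forall>c\<in>A. \<forall>w. smooth_on (chart_image c W) (\<lambda>z. covector_rep A c \<theta> z w))"


section \<open>The tangent bundle as a manifold\<close>

type_synonym ('p, 'e) tpoint = "'p \<times> ('p, 'e) tvec"

definition tangent_bundle :: "('p, 'e::euclidean_space) chart set \<Rightarrow> ('p, 'e) tpoint set" where
  "tangent_bundle A = (SIGMA p:(\<Union>c\<in>A. fst c). tangent_space A p)"

text \<open>The chart of the tangent bundle with the induced coordinates \<open>(x, y)\<close>.\<close>

definition induced_chart ::
  "('p, 'e::euclidean_space) chart set \<Rightarrow> ('p, 'e) chart \<Rightarrow> (('p, 'e) tpoint, 'e \<times> 'e) chart" where
  "induced_chart A c = (SIGMA p:fst c. tangent_space A p, \<lambda>(p, v). (snd c p, v c))"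

definition tangent_atlas ::
  "('p, 'e::euclidean_space) chart set \<Rightarrow> (('p, 'e) tpoint, 'e \<times> 'e) chart set" where
  "tangent_atlas A = induced_chart A ` A"

text \<open>Vertical vectors are those tangent to the fibres of the projection to the base,
  i.e. those without \<open>\<partial>/\<partial>x\<close> components.\<close>

definition vertical ::
  "('p, 'e::euclidean_space) chart set \<Rightarrow> ('p, 'e) tpoint
     \<Rightarrow> (('p, 'e) tpoint, 'e \<times> 'e) tvec \<Rightarrow> bool" where
  "vertical A u \<xi> \<longleftrightarrow> \<xi> \<in> tangent_space (tangent_atlas A) u \<and>
     (\<forall>c\<in>charts_at (tangent_atlas A) u. fst (\<xi> c) = 0)"

definition semi_basic_form ::
  "('p, 'e::euclidean_space) chart set \<Rightarrow> ('p, 'e) tpoint set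
     \<Rightarrow> (('p, 'e) tpoint \<Rightarrow> (('p, 'e) tpoint, 'e \<times> 'e) tvec \<Rightarrow> real) \<Rightarrow> bool" where
  "semi_basic_form A W \<theta> \<longleftrightarrow> one_form (tangent_atlas A) W \<theta> \<and>
     (\<forall>u\<in>W. \<forall>\<xi>. vertical A u \<xi> \<longrightarrow> \<theta> u \<xi> = 0)"


section \<open>Tensor calculus on open subsets of a Euclidean space\<close>

text \<open>The operators below act on the representatives of tensor fields in one chart of the
  tangent bundle. All of them are natural under changes of charts, so an identity between
  tensor fields on the manifold is the corresponding identity in every chart.

  A form of degree \<open>k\<close> is evaluated on lists of \<open>k\<close> vectors; its values on lists
  of any other length are never used. A (1,1)-tensor field maps a point and a vector
  to a vector.\<close>

type_synonym 'e form = "'e \<Rightarrow> 'e list \<Rightarrow> real"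
type_synonym 'e endo = "'e \<Rightarrow> 'e \<Rightarrow> 'e"

definition lie_bracket ::
  "('e::euclidean_space \<Rightarrow> 'e) \<Rightarrow> ('e \<Rightarrow> 'e) \<Rightarrow> 'e \<Rightarrow> 'e" where
  "lie_bracket X Y z =
     frechet_derivative Y (at z) (X z) - frechet_derivative X (at z) (Y z)"

text \<open>\<open>[X, K] Y = [X, K Y] - K [X, Y]\<close>, evaluated on constant vector fields \<open>Y\<close>.\<close>

definition lie_endo :: "('e::euclidean_space \<Rightarrow> 'e) \<Rightarrow> 'e endo \<Rightarrow> 'e endo" where
  "lie_endo X K z w = lie_bracket X (\<lambda>z'. K z' w) z - K z (lie_bracket X (\<lambda>_. w) z)"

text \<open>The Koszul formula for constant vector fields, whose brackets vanish.\<close>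

definition ext_d :: "'e::euclidean_space form \<Rightarrow> 'e form" where
  "ext_d \<alpha> z Xs = (\<Sum>a<length Xs. (-1) ^ a *
     frechet_derivative (\<lambda>z'. \<alpha> z' (take a Xs @ drop (Suc a) Xs)) (at z) (Xs ! a))"

definition ins :: "'e::euclidean_space endo \<Rightarrow> 'e form \<Rightarrow> 'e form" where
  "ins K \<alpha> z Xs = (\<Sum>a<length Xs. \<alpha> z (Xs[a := K z (Xs ! a)]))"

definition d_endo :: "'e::euclidean_space endo \<Rightarrow> 'e form \<Rightarrow> 'e form" where
  "d_endo K \<alpha> z Xs = ins K (ext_d \<alpha>) z Xs - ext_d (ins K \<alpha>) z Xs"

definition lie_form :: "('e::euclidean_space \<Rightarrow> 'e) \<Rightarrow> 'e form \<Rightarrow> 'e form" where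
  "lie_form X \<alpha> z Xs = frechet_derivative (\<lambda>z'. \<alpha> z' Xs) (at z) (X z) -
     (\<Sum>a<length Xs. \<alpha> z (Xs[a := lie_bracket X (\<lambda>_. Xs ! a) z]))"


section \<open>The geometry of a semispray in induced coordinates\<close>

definition Liouville :: "'e::euclidean_space \<times> 'e \<Rightarrow> 'e \<times> 'e" where
  "Liouville z = (0, snd z)"

definition tangent_structure :: "('e::euclidean_space \<times> 'e) endo" where
  "tangent_structure z w = (0, fst w)"

definition hor_proj :: "('e::euclidean_space \<times> 'e \<Rightarrow> 'e \<times> 'e) \<Rightarrow> ('e \<times> 'e) endo" where
  "hor_proj S z w = (1/2) *\<^sub>R (w - lie_endo S tangent_structure z w)"

definition ver_proj :: "('e::euclidean_space \<times> 'e \<Rightarrow> 'e \<times> 'e) \<Rightarrow> ('e \<times> 'e) endo" where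
  "ver_proj S z w = (1/2) *\<^sub>R (w + lie_endo S tangent_structure z w)"

definition complex_structure :: "('e::euclidean_space \<times> 'e \<Rightarrow> 'e \<times> 'e) \<Rightarrow> ('e \<times> 'e) endo" where
  "complex_structure S z w =
     hor_proj S z (lie_endo S (hor_proj S) z w) - tangent_structure z w"

definition Jacobi_endo :: "('e::euclidean_space \<times> 'e \<Rightarrow> 'e \<times> 'e) \<Rightarrow> ('e \<times> 'e) endo" where
  "Jacobi_endo S z w = ver_proj S z (lie_endo S (hor_proj S) z w)"

definition dyn_deriv ::
  "('e::euclidean_space \<times> 'e \<Rightarrow> 'e \<times> 'e) \<Rightarrow> ('e \<times> 'e) form \<Rightarrow> ('e \<times> 'e) form" where
  "dyn_deriv S \<alpha> z Xs = lie_form S \<alpha> z Xs -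
     ins (\<lambda>z w. complex_structure S z w + tangent_structure z w - Jacobi_endo S z w) \<alpha> z Xs"

definition Lagrange_diff ::
  "('e::euclidean_space \<times> 'e \<Rightarrow> 'e \<times> 'e) \<Rightarrow> ('e \<times> 'e \<Rightarrow> real) \<Rightarrow> ('e \<times> 'e) form" where
  "Lagrange_diff S L z Xs =
     lie_form S (d_endo tangent_structure (\<lambda>z' _. L z')) z Xs - ext_d (\<lambda>z' _. L z') z Xs"


section \<open>Semisprays, Lagrangians and the generalized Helmholtz conditions\<close>

definition form_rep ::
  "('p, 'e::euclidean_space) chart set \<Rightarrow> ('p, 'e) chart \<Rightarrow> ('p \<Rightarrow> ('p, 'e) tvec \<Rightarrow> real)
     \<Rightarrow> 'e form" where
  "form_rep A c \<theta> z Xs = covector_rep A c \<theta> z (Xs ! 0)"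

definition semispray ::
  "('p, 'e::euclidean_space) chart set
     \<Rightarrow> (('p, 'e) tpoint \<Rightarrow> (('p, 'e) tpoint, 'e \<times> 'e) tvec) \<Rightarrow> bool" where
  "semispray A S \<longleftrightarrow> vector_field (tangent_atlas A) (tangent_bundle A) S \<and>
     (\<forall>c\<in>tangent_atlas A. \<forall>z\<in>chart_image c (tangent_bundle A).
        tangent_structure z (field_rep c S z) = Liouville z)"

definition nontrivial_form ::
  "('p, real^'n) chart set \<Rightarrow> ('p, real^'n) tpoint set
     \<Rightarrow> (('p, real^'n) tpoint \<Rightarrow> (('p, real^'n) tpoint, (real^'n) \<times> (real^'n)) tvec \<Rightarrow> real)
     \<Rightarrow> bool" where
  "nontrivial_form A W \<theta> \<longleftrightarrow>
     (\<exists>c\<in>tangent_atlas A. \<exists>z\<in>chart_image c W. \<exists>i j.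
        frechet_derivative (\<lambda>z'. covector_rep (tangent_atlas A) c \<theta> z' (axis i 1, 0)) (at z)
          (0, axis j 1) \<noteq> 0)"

definition Lagrangian ::
  "('p, real^'n) chart set \<Rightarrow> ('p, real^'n) tpoint set
     \<Rightarrow> (('p, real^'n) tpoint \<Rightarrow> real) \<Rightarrow> bool" where
  "Lagrangian A W L \<longleftrightarrow> smooth_function (tangent_atlas A) W L \<and>
     (\<exists>c\<in>tangent_atlas A. \<exists>z\<in>chart_image c W. \<exists>i j.
        frechet_derivative
          (\<lambda>z'. frechet_derivative (fun_rep c L) (at z') (0, axis i 1)) (at z)
          (0, axis j 1) \<noteq> 0)"

text \<open>Being of Lagrangian type is a local notion: the Lagrangian is defined on some
  open neighbourhood, in the tangent bundle, of the given point.\<close>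

definition Lagrangian_type_near ::
  "('p, real^'n) chart set
     \<Rightarrow> (('p, real^'n) tpoint \<Rightarrow> (('p, real^'n) tpoint, (real^'n) \<times> (real^'n)) tvec)
     \<Rightarrow> (('p, real^'n) tpoint \<Rightarrow> (('p, real^'n) tpoint, (real^'n) \<times> (real^'n)) tvec \<Rightarrow> real)
     \<Rightarrow> ('p, real^'n) tpoint \<Rightarrow> bool" where
  "Lagrangian_type_near A S \<sigma> u \<longleftrightarrow>
     (\<exists>W L. atlas_open (tangent_atlas A) W \<and> u \<in> W \<and> Lagrangian A W L \<and>
        (\<forall>c\<in>tangent_atlas A. \<forall>z\<in>chart_image c W. \<forall>X.
           Lagrange_diff (field_rep c S) (fun_rep c L) z [X] =
             form_rep (tangent_atlas A) c \<sigma> z [X]))"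

definition GH1 ::
  "('p, 'e::euclidean_space) chart set \<Rightarrow> ('p, 'e) tpoint set
     \<Rightarrow> (('p, 'e) tpoint \<Rightarrow> (('p, 'e) tpoint, 'e \<times> 'e) tvec \<Rightarrow> real) \<Rightarrow> bool" where
  "GH1 A W \<theta> \<longleftrightarrow> (\<forall>c\<in>tangent_atlas A. \<forall>z\<in>chart_image c W. \<forall>X Y.
     d_endo tangent_structure (form_rep (tangent_atlas A) c \<theta>) z [X, Y] = 0)"

definition GH2 ::
  "('p, 'e::euclidean_space) chart set
     \<Rightarrow> (('p, 'e) tpoint \<Rightarrow> (('p, 'e) tpoint, 'e \<times> 'e) tvec)
     \<Rightarrow> (('p, 'e) tpoint \<Rightarrow> (('p, 'e) tpoint, 'e \<times> 'e) tvec \<Rightarrow> real)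
     \<Rightarrow> ('p, 'e) tpoint set
     \<Rightarrow> (('p, 'e) tpoint \<Rightarrow> (('p, 'e) tpoint, 'e \<times> 'e) tvec \<Rightarrow> real) \<Rightarrow> bool" where
  "GH2 A S \<sigma> W \<theta> \<longleftrightarrow> (\<forall>c\<in>tangent_atlas A. \<forall>z\<in>chart_image c W. \<forall>X Y.
     (let S\<^sub>c = field_rep c S; \<sigma>\<^sub>c = form_rep (tangent_atlas A) c \<sigma>;
          \<theta>\<^sub>c = form_rep (tangent_atlas A) c \<theta>
      in d_endo (Jacobi_endo S\<^sub>c) \<theta>\<^sub>c z [X, Y] =
         1/2 * dyn_deriv S\<^sub>c (d_endo tangent_structure \<sigma>\<^sub>c) z [X, Y]
           - d_endo (hor_proj S\<^sub>c) \<sigma>\<^sub>c z [X, Y]))"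

definition GH3 ::
  "('p, 'e::euclidean_space) chart set
     \<Rightarrow> (('p, 'e) tpoint \<Rightarrow> (('p, 'e) tpoint, 'e \<times> 'e) tvec)
     \<Rightarrow> (('p, 'e) tpoint \<Rightarrow> (('p, 'e) tpoint, 'e \<times> 'e) tvec \<Rightarrow> real)
     \<Rightarrow> ('p, 'e) tpoint set
     \<Rightarrow> (('p, 'e) tpoint \<Rightarrow> (('p, 'e) tpoint, 'e \<times> 'e) tvec \<Rightarrow> real) \<Rightarrow> bool" where
  "GH3 A S \<sigma> W \<theta> \<longleftrightarrow> (\<forall>c\<in>tangent_atlas A. \<forall>z\<in>chart_image c W. \<forall>X Y.
     (let S\<^sub>c = field_rep c S; \<sigma>\<^sub>c = form_rep (tangent_atlas A) c \<sigma>;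
          \<theta>\<^sub>c = form_rep (tangent_atlas A) c \<theta>
      in dyn_deriv S\<^sub>c (d_endo (ver_proj S\<^sub>c) \<theta>\<^sub>c) z [X, Y] =
         d_endo (ver_proj S\<^sub>c) \<sigma>\<^sub>c z [X, Y]
           - 1/2 * ins (\<lambda>z w. complex_structure S\<^sub>c z w + tangent_structure z w)
               (d_endo tangent_structure \<sigma>\<^sub>c) z [X, Y]))"

end

theory Submission
  imports Defs
begin

text \<open>In induced coordinates, \<open>dL = L\<^sub>S\<theta> - \<sigma>\<close> holds exactly when \<open>d\<^sub>J L = \<theta>\<close> and \<open>\<delta>\<^sub>S L = \<sigma>\<close>.
  With \<open>B = d\<^sub>h\<theta> - \<onehalf> d\<^sub>J\<sigma>\<close>, the conditions \<open>(GH\<^sub>1)\<close>--\<open>(GH\<^sub>3)\<close> imply \<open>d(L\<^sub>S\<theta> - \<sigma>) = L\<^sub>S B\<close>.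
  Hence \<open>L\<^sub>S dB = 0\<close>, which for the semi-basic form \<open>B\<close> forces \<open>B\<close> to be independent of \<open>y\<close> and closed.
  By the Poincare lemma \<open>B = d\<beta>\<close> locally with \<open>\<beta>\<close> basic; the form \<open>\<theta> - \<beta>\<close> has the same fibre derivative as
  \<open>\<theta>\<close>, and now \<open>L\<^sub>S(\<theta> - \<beta>) - \<sigma>\<close> is closed, so that it has a local primitive \<open>L\<close>.
  Conversely, for \<open>\<theta> = d\<^sub>J L\<close> the form \<open>L\<^sub>S\<theta> - \<sigma>\<close> is closed, and the antisymmetric part of its mixed
  components gives \<open>B = 0\<close>.

  The domain of \<open>\<theta>\<close> need not be connected, so \<open>\<partial>\<theta>/\<partial>y\<close> may vanish near the given point and be nonzero only
  elsewhere; the Lagrangian is therefore built separately around both points.\<close>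

section \<open>Smooth maps on open sets\<close>

text \<open>The three conditions see \<open>\<theta>\<close> only through its fibre derivatives and
  the derivatives of these along \<open>S\<close>, so adding a 1-form pulled back from the base
  changes none of them. They therefore cannot single out \<open>d_J L\<close>, and
  \<open>\<beta>\<close> is the ambiguity to be removed: the final Lagrangian shares with
  \<open>\<theta>\<close> only the matrix of fibre derivatives, which is enough for non-triviality.
  The homotopy operator of the Poincare lemma is written out as an integral because the bare
  existence of \<open>\<beta>\<close> does not suffice: it must be semi-basic when \<open>B\<close>
  is. A primitive lives in one chart, while \<open>\<delta>_S L = \<sigma>\<close> is required in
  all charts, hence the naturality argument; conversely, \<open>d_J L\<close> has to be produced as
  a form on abstract tangent vectors.\<close>

abbreviation D :: "('a::real_normed_vector \<Rightarrow> 'b::real_normed_vector) \<Rightarrow> 'a \<Rightarrow> 'a \<Rightarrow> 'b" where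
  "D f z \<equiv> frechet_derivative f (at z)"

lemma D_eqI: "(f has_derivative f') (at z) \<Longrightarrow> D f z = f'"
  by (metis frechet_derivative_at)

lemma has_derivative_cong_open:
  assumes "open U" "z \<in> U" "\<And>x. x \<in> U \<Longrightarrow> f x = g x"
  shows "(f has_derivative f') (at z) \<longleftrightarrow> (g has_derivative f') (at z)"
  using assms by (metis has_derivative_transform_within_open)

lemma D_cong_open:
  assumes "open U" "z \<in> U" "\<And>x. x \<in> U \<Longrightarrow> f x = g x"
  shows "D f z = D g z"
  unfolding frechet_derivative_def using has_derivative_cong_open[OF assms] by simp

lemma differentiable_cong_open:
  assumes "open U" "z \<in> U" "\<And>x. x \<in> U \<Longrightarrow> f x = g x"
  shows "f differentiable at z \<longleftrightarrow> g differentiable at z"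
  unfolding differentiable_def using has_derivative_cong_open[OF assms] by simp

lemma D_has_derivative: "f differentiable at z \<Longrightarrow> (f has_derivative D f z) (at z)"
  by (simp add: frechet_derivative_works)

text \<open>\<open>Ck_on\<close> differentiates in the whole space and not within \<open>U\<close>,
  so values outside \<open>U\<close> could matter; openness of \<open>U\<close> rules this
  out.\<close>

lemma Ck_on_cong:
  assumes "open U" "\<And>x. x \<in> U \<Longrightarrow> f x = g x" "Ck_on k U f"
  shows "Ck_on k U g"
  using assms(2,3)
proof (induction k arbitrary: f g)
  case 0
  then show ?case by (metis Ck_on.simps(1) continuous_on_cong)
next
  case (Suc k)
  have "g differentiable at x" if "x \<in> U" for x
    using Suc.prems(2) that differentiable_cong_open[OF assms(1) that Suc.prems(1), of "\<lambda>x. x"] by simp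
  moreover have "Ck_on k U (\<lambda>x. D g x v)" for v
  proof (rule Suc.IH)
    show "D f x v = D g x v" if "x \<in> U" for x
      by (simp add: D_cong_open[OF assms(1) that Suc.prems(1)])
  qed (use Suc.prems in simp)
  ultimately show ?case by simp
qed

lemma Ck_on_subset: "V \<subseteq> U \<Longrightarrow> Ck_on k U f \<Longrightarrow> Ck_on k V f"
  by (induction k arbitrary: f) (auto intro: continuous_on_subset)

lemma continuous_on_of_differentiable: "\<forall>x\<in>U. f differentiable at x \<Longrightarrow> continuous_on U f"
  by (simp add: continuous_at_imp_continuous_on differentiable_imp_continuous_within)

lemma Ck_on_SucD: "Ck_on (Suc k) U f \<Longrightarrow> Ck_on k U f"
proof (induction k arbitrary: f)
  case 0
  then show ?case by (simp add: continuous_on_of_differentiable)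
next
  case (Suc k)
  then show ?case by auto
qed

lemma Ck_on_const: "Ck_on k U (\<lambda>_. c)"
  by (induction k arbitrary: c) auto

lemma Ck_on_linear:
  assumes h: "bounded_linear h" and U: "open U" and "Ck_on k U f"
  shows "Ck_on k U (\<lambda>x. h (f x))"
  using assms(3)
proof (induction k arbitrary: f)
  case 0
  then show ?case by (simp add: bounded_linear.continuous_on[OF h])
next
  case (Suc k)
  have d: "((\<lambda>x. h (f x)) has_derivative (\<lambda>v. h (D f x v))) (at x)" if "x \<in> U" for x
    using Suc.prems that by (intro bounded_linear.has_derivative[OF h] D_has_derivative) auto
  have "Ck_on k U (\<lambda>x. D (\<lambda>x. h (f x)) x v)" for v
    by (rule Ck_on_cong[OF U _ Suc.IH[of "\<lambda>x. D f x v"]]) (use Suc.prems in \<open>auto simp: D_eqI[OF d]\<close>)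
  then show ?case using d by (auto simp: differentiable_def)
qed

lemma Ck_on_add:
  assumes U: "open U" and "Ck_on k U f" "Ck_on k U g"
  shows "Ck_on k U (\<lambda>x. f x + g x)"
  using assms(2,3)
proof (induction k arbitrary: f g)
  case 0
  then show ?case by (simp add: continuous_on_add)
next
  case (Suc k)
  have d: "((\<lambda>x. f x + g x) has_derivative (\<lambda>v. D f x v + D g x v)) (at x)" if "x \<in> U" for x
    using Suc.prems that by (intro has_derivative_add D_has_derivative) auto
  have "Ck_on k U (\<lambda>x. D (\<lambda>x. f x + g x) x v)" for v
    by (rule Ck_on_cong[OF U _ Suc.IH[of "\<lambda>x. D f x v" "\<lambda>x. D g x v"]])
      (use Suc.prems in \<open>auto simp: D_eqI[OF d]\<close>)
  then show ?case using d by (auto simp: differentiable_def)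
qed

lemma Ck_on_bilinear:
  assumes h: "bounded_bilinear h" and U: "open U" and "Ck_on k U f" "Ck_on k U g"
  shows "Ck_on k U (\<lambda>x. h (f x) (g x))"
  using assms(3,4)
proof (induction k arbitrary: f g)
  case 0
  then show ?case by (simp add: bounded_bilinear.continuous_on[OF h])
next
  case (Suc k)
  have d: "((\<lambda>x. h (f x) (g x)) has_derivative (\<lambda>v. h (f x) (D g x v) + h (D f x v) (g x))) (at x)"
    if "x \<in> U" for x
    using Suc.prems that by (intro bounded_bilinear.FDERIV[OF h] D_has_derivative) auto
  \<comment> \<open>The product rule leaves one factor undifferentiated in each term. The induction
    hypothesis needs it at level \<open>k\<close> although it is given at level
    \<open>Suc k\<close>; \<open>Ck_on_SucD\<close> bridges this.\<close>
  have "Ck_on k U (\<lambda>x. D (\<lambda>x. h (f x) (g x)) x v)" for v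
    by (rule Ck_on_cong[OF U _ Ck_on_add[OF U Suc.IH[of f "\<lambda>x. D g x v"]
            Suc.IH[of "\<lambda>x. D f x v" g]]])
      (use Suc.prems Ck_on_SucD[of k U f] Ck_on_SucD[of k U g] in \<open>auto simp: D_eqI[OF d]\<close>)
  then show ?case using d by (auto simp: differentiable_def)
qed

lemma Ck_on_sum:
  assumes "open U" "finite I" "\<And>i. i \<in> I \<Longrightarrow> Ck_on k U (f i)"
  shows "Ck_on k U (\<lambda>x. \<Sum>i\<in>I. f i x)"
  using assms(2,3)
  by (induction I rule: finite_induct) (auto intro: Ck_on_const Ck_on_add[OF assms(1)])

text \<open>\<open>Ck_on\<close> speaks of derivatives in fixed directions only. This expansion is
  the means by which directions that vary with the point are handled throughout.\<close>

lemma D_basis_expansion: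
  fixes g :: "'a::euclidean_space \<Rightarrow> 'b::real_normed_vector"
  assumes "g differentiable at z"
  shows "D g z w = (\<Sum>b\<in>Basis. (w \<bullet> b) *\<^sub>R D g z b)"
proof -
  have "linear (D g z)" by (rule linear_frechet_derivative[OF assms])
  then have "D g z (\<Sum>b\<in>Basis. (w \<bullet> b) *\<^sub>R b) = (\<Sum>b\<in>Basis. (w \<bullet> b) *\<^sub>R D g z b)"
    by (simp add: linear_sum linear_cmul)
  then show ?thesis by (simp add: euclidean_representation)
qed

lemma Ck_on_id: "Ck_on k U (\<lambda>x. x)"
  by (cases k) (auto intro: Ck_on_const)

text \<open>The chain rule yields \<open>D g\<close> at \<open>f x\<close> in the moving direction
  \<open>D f x v\<close>. Expanded in a basis this is a sum of products, in which each derivative of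
  \<open>g\<close> along a basis vector is covered by the induction hypothesis.\<close>

lemma Ck_on_compose:
  fixes g :: "'b::euclidean_space \<Rightarrow> 'c::real_normed_vector"
  assumes U: "open U" and fg: "\<And>x. x \<in> U \<Longrightarrow> f x \<in> V" and "Ck_on k V g" "Ck_on k U f"
  shows "Ck_on k U (\<lambda>x. g (f x))"
  using assms(3,4)
proof (induction k arbitrary: g)
  case 0
  then show ?case using fg by (auto intro: continuous_on_compose2)
next
  case (Suc k)
  have d: "((\<lambda>x. g (f x)) has_derivative (\<lambda>v. D g (f x) (D f x v))) (at x)" if "x \<in> U" for x
    using Suc.prems that fg
    by (intro has_derivative_compose[of f "D f x" _ _ g] D_has_derivative) auto
  have "Ck_on k U (\<lambda>x. D (\<lambda>x. g (f x)) x v)" for v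
  proof (rule Ck_on_cong[OF U])
    show "Ck_on k U (\<lambda>x. \<Sum>b\<in>Basis. (D f x v \<bullet> b) *\<^sub>R D g (f x) b)"
      using Suc.prems Ck_on_SucD[of k U f]
      by (intro Ck_on_sum[OF U] Ck_on_bilinear[OF bounded_bilinear_scaleR U]
          Ck_on_linear[OF bounded_linear_inner_left U] Suc.IH[of "\<lambda>z. D g z b" for b]) auto
    show "(\<Sum>b\<in>Basis. (D f x v \<bullet> b) *\<^sub>R D g (f x) b) = D (\<lambda>x. g (f x)) x v"
      if "x \<in> U" for x
      using Suc.prems fg that
      by (subst D_eqI[OF d[OF that]], subst D_basis_expansion) auto
  qed
  then show ?case using d by (auto simp: differentiable_def)
qed

lemma smooth_on_differentiable: "smooth_on U f \<Longrightarrow> z \<in> U \<Longrightarrow> f differentiable at z"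
  unfolding smooth_on_def by (metis Ck_on.simps(2))

lemma smooth_on_has_derivative: "smooth_on U f \<Longrightarrow> z \<in> U \<Longrightarrow> (f has_derivative D f z) (at z)"
  by (simp add: smooth_on_differentiable D_has_derivative)

lemma smooth_on_D: "smooth_on U f \<Longrightarrow> smooth_on U (\<lambda>z. D f z v)"
  unfolding smooth_on_def by (metis Ck_on.simps(2))

lemma smooth_on_continuous: "smooth_on U f \<Longrightarrow> continuous_on U f"
  unfolding smooth_on_def by (metis Ck_on.simps(1))

lemma smooth_on_cong: "open U \<Longrightarrow> (\<And>x. x \<in> U \<Longrightarrow> f x = g x) \<Longrightarrow> smooth_on U f \<Longrightarrow> smooth_on U g"
  unfolding smooth_on_def by (metis Ck_on_cong)

lemma smooth_on_subset: "V \<subseteq> U \<Longrightarrow> smooth_on U f \<Longrightarrow> smooth_on V f"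
  unfolding smooth_on_def by (metis Ck_on_subset)

lemma Ck_on_locally:
  assumes "\<And>z. z \<in> U \<Longrightarrow> \<exists>V. open V \<and> z \<in> V \<and> Ck_on k V f"
  shows "Ck_on k U f"
  using assms
proof (induction k arbitrary: f)
  case 0
  then have "isCont f x" if "x \<in> U" for x
    using that by (metis Ck_on.simps(1) continuous_on_eq_continuous_at)
  then show ?case by (simp add: continuous_at_imp_continuous_on)
next
  case (Suc k)
  then show ?case by (simp; meson)
qed

lemma smooth_on_locally:
  assumes "\<And>z. z \<in> U \<Longrightarrow> \<exists>V. open V \<and> z \<in> V \<and> smooth_on V f"
  shows "smooth_on U f"
  unfolding smooth_on_def using assms by (meson Ck_on_locally smooth_on_def)

lemma smooth_on_const: "smooth_on U (\<lambda>_. c)"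
  by (simp add: smooth_on_def Ck_on_const)

lemma smooth_on_id: "smooth_on U (\<lambda>x. x)"
  by (simp add: smooth_on_def Ck_on_id)

lemma smooth_on_linear: "bounded_linear h \<Longrightarrow> open U \<Longrightarrow> smooth_on U f \<Longrightarrow> smooth_on U (\<lambda>x. h (f x))"
  by (simp add: smooth_on_def Ck_on_linear)

lemma smooth_on_add: "open U \<Longrightarrow> smooth_on U f \<Longrightarrow> smooth_on U g \<Longrightarrow> smooth_on U (\<lambda>x. f x + g x)"
  by (simp add: smooth_on_def Ck_on_add)

lemma smooth_on_bilinear:
  "bounded_bilinear h \<Longrightarrow> open U \<Longrightarrow> smooth_on U f \<Longrightarrow> smooth_on U g \<Longrightarrow> smooth_on U (\<lambda>x. h (f x) (g x))"
  by (simp add: smooth_on_def Ck_on_bilinear)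

lemma smooth_on_minus: "open U \<Longrightarrow> smooth_on U f \<Longrightarrow> smooth_on U (\<lambda>x. - f x)"
  by (rule smooth_on_linear[OF bounded_linear_minus[OF bounded_linear_ident]])

lemma smooth_on_diff: "open U \<Longrightarrow> smooth_on U f \<Longrightarrow> smooth_on U g \<Longrightarrow> smooth_on U (\<lambda>x. f x - g x)"
  using smooth_on_add[OF _ _ smooth_on_minus, of U f g] by simp

lemma smooth_on_sum:
  assumes "open U" "finite I" "\<And>i. i \<in> I \<Longrightarrow> smooth_on U (f i)"
  shows "smooth_on U (\<lambda>x. \<Sum>i\<in>I. f i x)"
  using assms by (simp add: smooth_on_def Ck_on_sum)

lemma smooth_on_compose:
  fixes g :: "'b::euclidean_space \<Rightarrow> 'c::real_normed_vector"
  assumes "open U" "\<And>x. x \<in> U \<Longrightarrow> f x \<in> V" "smooth_on V g" "smooth_on U f"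
  shows "smooth_on U (\<lambda>x. g (f x))"
  unfolding smooth_on_def
proof
  show "Ck_on k U (\<lambda>x. g (f x))" for k
    by (rule Ck_on_compose[where V = V]) (use assms in \<open>auto simp: smooth_on_def\<close>)
qed

lemmas smooth_on_inner = smooth_on_bilinear[OF bounded_bilinear_inner]
  and smooth_on_scaleR = smooth_on_bilinear[OF bounded_bilinear_scaleR]
  and smooth_on_mult = smooth_on_bilinear[OF bounded_bilinear_mult]
  and smooth_on_fst = smooth_on_linear[OF bounded_linear_fst]
  and smooth_on_snd = smooth_on_linear[OF bounded_linear_snd]

lemma smooth_on_Pair:
  fixes f :: "'a::real_normed_vector \<Rightarrow> 'b::real_normed_vector" and g :: "'a \<Rightarrow> 'c::real_normed_vector"
  assumes "open U" "smooth_on U f" "smooth_on U g"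
  shows "smooth_on U (\<lambda>x. (f x, g x))"
proof -
  have "bounded_linear (\<lambda>x::'b. (x, 0::'c))" "bounded_linear (\<lambda>x::'c. (0::'b, x))"
    by (simp_all add: bounded_linear_Pair bounded_linear_ident bounded_linear_zero)
  from smooth_on_add[OF assms(1) smooth_on_linear[OF this(1) assms(1,2)]
      smooth_on_linear[OF this(2) assms(1,3)]]
  show ?thesis by simp
qed

lemma smooth_on_D_field:
  fixes f :: "'a::euclidean_space \<Rightarrow> 'b::real_normed_vector"
  assumes "open U" "smooth_on U f" "smooth_on U w"
  shows "smooth_on U (\<lambda>z. D f z (w z))"
proof (rule smooth_on_cong[OF assms(1)])
  show "smooth_on U (\<lambda>z. \<Sum>b\<in>Basis. (w z \<bullet> b) *\<^sub>R D f z b)"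
    by (intro smooth_on_sum smooth_on_scaleR smooth_on_inner smooth_on_const smooth_on_D assms finite_Basis)
  show "(\<Sum>b\<in>Basis. (w z \<bullet> b) *\<^sub>R D f z b) = D f z (w z)" if "z \<in> U" for z
    using D_basis_expansion[OF smooth_on_differentiable[OF assms(2) that], of "w z"] by simp
qed

lemma smooth_on_D_linear:
  assumes "smooth_on U f" "z \<in> U"
  shows "linear (D f z)"
  using assms by (simp add: linear_frechet_derivative smooth_on_differentiable)

text \<open>Base point and direction both move. Treating the direction by its coordinates avoids
  derivatives with values in a space of operators; the second summand is the effect of the moving
  direction alone. It serves for derivatives along \<open>S\<close> as well as for chart
  changes.\<close>

lemma D_field_compose_has_derivative:
  fixes f :: "'a::euclidean_space \<Rightarrow> 'b::real_normed_vector" and \<phi> :: "'c::real_normed_vector \<Rightarrow> 'a"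
  assumes U: "open U" and f: "smooth_on U f" and V: "open V" "z \<in> V" "\<And>x. x \<in> V \<Longrightarrow> \<phi> x \<in> U"
    and \<phi>: "(\<phi> has_derivative \<phi>') (at z)" and w: "(w has_derivative w') (at z)"
  shows "((\<lambda>x. D f (\<phi> x) (w x)) has_derivative
    (\<lambda>v. D (\<lambda>x. D f x (w z)) (\<phi> z) (\<phi>' v) + D f (\<phi> z) (w' v))) (at z)"
proof -
  note z = V(3)[OF V(2)]
  have *: "((\<lambda>x. \<Sum>b\<in>Basis. (w x \<bullet> b) *\<^sub>R D f (\<phi> x) b) has_derivative
      (\<lambda>v. \<Sum>b\<in>Basis. (w z \<bullet> b) *\<^sub>R D (\<lambda>x. D f x b) (\<phi> z) (\<phi>' v) + (w' v \<bullet> b) *\<^sub>R D f (\<phi> z) b)) (at z)"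
    by (intro has_derivative_sum has_derivative_scaleR has_derivative_inner_left w
        has_derivative_compose[OF \<phi> smooth_on_has_derivative[OF smooth_on_D[OF f] z]])
  have e: "D (\<lambda>x. D f x c) (\<phi> z) v = (\<Sum>b\<in>Basis. (c \<bullet> b) *\<^sub>R D (\<lambda>x. D f x b) (\<phi> z) v)" for c v
  proof -
    have "((\<lambda>x. \<Sum>b\<in>Basis. (c \<bullet> b) *\<^sub>R D f x b) has_derivative
      (\<lambda>v. \<Sum>b\<in>Basis. (c \<bullet> b) *\<^sub>R D (\<lambda>x. D f x b) (\<phi> z) v)) (at (\<phi> z))"
      by (intro has_derivative_sum has_derivative_scaleR_right
        smooth_on_has_derivative[OF smooth_on_D[OF f] z])
    note e' = D_eqI[OF this]
    show ?thesis
      by (subst D_cong_open[OF U z D_basis_expansion[OF smooth_on_differentiable[OF f]]], assumption)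
        (subst e', rule refl)
  qed
  have "(\<Sum>b\<in>Basis. (w z \<bullet> b) *\<^sub>R D (\<lambda>x. D f x b) (\<phi> z) (\<phi>' v) + (w' v \<bullet> b) *\<^sub>R D f (\<phi> z) b) =
      D (\<lambda>x. D f x (w z)) (\<phi> z) (\<phi>' v) + D f (\<phi> z) (w' v)" for v
    by (simp only: sum.distrib e[of "w z" "\<phi>' v"]
        D_basis_expansion[OF smooth_on_differentiable[OF f z], of "w' v"])
  with * have d: "((\<lambda>x. \<Sum>b\<in>Basis. (w x \<bullet> b) *\<^sub>R D f (\<phi> x) b) has_derivative
      (\<lambda>v. D (\<lambda>x. D f x (w z)) (\<phi> z) (\<phi>' v) + D f (\<phi> z) (w' v))) (at z)"
    by simp
  have "(\<Sum>b\<in>Basis. (w x \<bullet> b) *\<^sub>R D f (\<phi> x) b) = D f (\<phi> x) (w x)" if "x \<in> V" for x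
    by (rule D_basis_expansion[OF smooth_on_differentiable[OF f V(3)[OF that]], symmetric])
  from iffD1[OF has_derivative_cong_open[OF V(1,2) this] d] show ?thesis .
qed

lemma D_field_has_derivative:
  fixes f :: "'a::euclidean_space \<Rightarrow> 'b::real_normed_vector"
  assumes "open U" "smooth_on U f" "(w has_derivative w') (at z)" "z \<in> U"
  shows "((\<lambda>z. D f z (w z)) has_derivative (\<lambda>v. D (\<lambda>x. D f x (w z)) z v + D f z (w' v))) (at z)"
  by (rule D_field_compose_has_derivative[where \<phi> = "\<lambda>x. x" and V = U])
    (use assms in \<open>auto intro: has_derivative_ident\<close>)

lemma D_D_linear_dir:
  fixes f :: "'a::euclidean_space \<Rightarrow> 'b::real_normed_vector"
  assumes U: "open U" and f: "smooth_on U f" and z: "z \<in> U"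
  shows "linear (\<lambda>w. D (\<lambda>x. D f x w) z v)"
proof
  fix a b :: 'a and r :: real
  have d: "((\<lambda>x. D f x w) has_derivative D (\<lambda>x. D f x w) z) (at z)" for w
    by (rule smooth_on_has_derivative[OF smooth_on_D[OF f] z])
  note lin = smooth_on_D_linear[OF f]
  show "D (\<lambda>x. D f x (a + b)) z v = D (\<lambda>x. D f x a) z v + D (\<lambda>x. D f x b) z v"
    using D_cong_open[OF U z, of "\<lambda>x. D f x (a + b)" "\<lambda>x. D f x a + D f x b"]
      D_eqI[OF has_derivative_add[OF d[of a] d[of b]]] lin by (simp add: linear_add)
  show "D (\<lambda>x. D f x (r *\<^sub>R a)) z v = r *\<^sub>R D (\<lambda>x. D f x a) z v"
    using D_cong_open[OF U z, of "\<lambda>x. D f x (r *\<^sub>R a)" "\<lambda>x. r *\<^sub>R D f x a"]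
      D_eqI[OF has_derivative_scaleR_right[OF d[of a], of r]] lin by (simp add: linear_cmul)
qed

section \<open>Symmetry of second derivatives and the Poincare lemma\<close>

lemma line_has_real_derivative:
  fixes f :: "'a::real_normed_vector \<Rightarrow> real"
  assumes "f differentiable at (p + s *\<^sub>R v)"
  shows "((\<lambda>s. f (p + s *\<^sub>R v)) has_real_derivative D f (p + s *\<^sub>R v) v) (at s)"
proof -
  have "((\<lambda>s. p + s *\<^sub>R v) has_derivative (\<lambda>t. t *\<^sub>R v)) (at s)"
    by (auto intro!: derivative_eq_intros)
  from has_derivative_compose[OF this D_has_derivative[OF assms]]
  have "((\<lambda>s. f (p + s *\<^sub>R v)) has_derivative (\<lambda>t. D f (p + s *\<^sub>R v) (t *\<^sub>R v))) (at s)" .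
  moreover have "D f (p + s *\<^sub>R v) (t *\<^sub>R v) = D f (p + s *\<^sub>R v) v * t" for t
    using linear_cmul[OF linear_frechet_derivative[OF assms]] by simp
  ultimately show ?thesis by (simp add: has_field_derivative_def)
qed

text \<open>The mean value theorem twice: in direction \<open>v\<close> for the increment of
  \<open>f\<close> over the step \<open>h *\<^sub>R w\<close>, then in direction \<open>w\<close>
  for the resulting derivative.\<close>

lemma second_difference:
  fixes f :: "'a::real_normed_vector \<Rightarrow> real"
  assumes f: "smooth_on U f" and h: "h > 0"
    and U: "\<And>s r. 0 \<le> s \<Longrightarrow> s \<le> h \<Longrightarrow> 0 \<le> r \<Longrightarrow> r \<le> h \<Longrightarrow> z + s *\<^sub>R v + r *\<^sub>R w \<in> U"
  obtains s r where "0 \<le> s" "s \<le> h" "0 \<le> r" "r \<le> h"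
    "f (z + h *\<^sub>R v + h *\<^sub>R w) - f (z + h *\<^sub>R v) - f (z + h *\<^sub>R w) + f z =
      h * h * D (\<lambda>x. D f x v) (z + s *\<^sub>R v + r *\<^sub>R w) w"
proof -
  define \<phi> where "\<phi> s = f ((z + h *\<^sub>R w) + s *\<^sub>R v) - f (z + s *\<^sub>R v)" for s
  have U1: "z + h *\<^sub>R w + s *\<^sub>R v \<in> U" "z + s *\<^sub>R v \<in> U" if "0 \<le> s" "s \<le> h" for s
    using U[of s h] U[of s 0] that h by (simp_all add: algebra_simps)
  have "(\<phi> has_real_derivative (D f (z + h *\<^sub>R w + s *\<^sub>R v) v - D f (z + s *\<^sub>R v) v)) (at s)"
    if "0 \<le> s" "s \<le> h" for s
    unfolding \<phi>_def
    by (intro DERIV_diff line_has_real_derivative smooth_on_differentiable[OF f] U1 that)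
  from MVT2[OF h this] obtain s where s: "0 < s" "s < h"
    and 1: "\<phi> h - \<phi> 0 = h * (D f (z + h *\<^sub>R w + s *\<^sub>R v) v - D f (z + s *\<^sub>R v) v)"
    by auto
  have "((\<lambda>r. D f (z + s *\<^sub>R v + r *\<^sub>R w) v) has_real_derivative
      D (\<lambda>x. D f x v) (z + s *\<^sub>R v + r *\<^sub>R w) w) (at r)" if "0 \<le> r" "r \<le> h" for r
    using s that
    by (intro line_has_real_derivative smooth_on_differentiable[OF smooth_on_D[OF f]] U) auto
  from MVT2[OF h this] obtain r where r: "0 < r" "r < h"
    and 2: "D f (z + s *\<^sub>R v + h *\<^sub>R w) v - D f (z + s *\<^sub>R v + 0 *\<^sub>R w) v =
      h * D (\<lambda>x. D f x v) (z + s *\<^sub>R v + r *\<^sub>R w) w"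
    by auto
  have "f (z + h *\<^sub>R v + h *\<^sub>R w) - f (z + h *\<^sub>R v) - f (z + h *\<^sub>R w) + f z = \<phi> h - \<phi> 0"
    by (simp add: \<phi>_def algebra_simps)
  also have "\<dots> = h * h * D (\<lambda>x. D f x v) (z + s *\<^sub>R v + r *\<^sub>R w) w"
    using 1 2 by (simp add: add.assoc add.commute[of "h *\<^sub>R w"])
  finally show thesis using s r by (intro that) auto
qed

text \<open>The second difference over a small parallelogram is symmetric in \<open>v\<close> and
  \<open>w\<close>, and \<open>second_difference\<close> writes it as either mixed derivative at a
  nearby point; continuity of both does the rest.\<close>

lemma symmetric_second_derivative_real:
  fixes f :: "'a::real_normed_vector \<Rightarrow> real"
  assumes U: "open U" "z \<in> U" and f: "smooth_on U f"
  shows "D (\<lambda>x. D f x v) z w = D (\<lambda>x. D f x w) z v"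
proof -
  define G where "G x = D (\<lambda>x. D f x v) x w" for x
  define H where "H x = D (\<lambda>x. D f x w) x v" for x
  have "isCont G z" "isCont H z"
    unfolding G_def H_def
    using smooth_on_continuous[OF smooth_on_D[OF smooth_on_D[OF f]]] U
    by (simp_all add: continuous_on_eq_continuous_at)
  have "\<bar>G z - H z\<bar> < e" if "e > 0" for e
  proof -
    have e: "e / 2 > 0" using that by simp
    from \<open>isCont G z\<close> e obtain d1 where d1: "d1 > 0" "\<And>x. dist x z < d1 \<Longrightarrow> dist (G x) (G z) < e / 2"
      unfolding continuous_at_eps_delta by blast
    from \<open>isCont H z\<close> e obtain d2 where d2: "d2 > 0" "\<And>x. dist x z < d2 \<Longrightarrow> dist (H x) (H z) < e / 2"
      unfolding continuous_at_eps_delta by blast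
    from U obtain d3 where d3: "d3 > 0" "\<And>x. dist x z < d3 \<Longrightarrow> x \<in> U"
      unfolding open_dist by blast
    define d where "d = min d1 (min d2 d3)"
    \<comment> \<open>Small enough to keep the whole parallelogram in the ball of radius
      \<open>d\<close>; the summand 1 covers the case that \<open>v\<close> and \<open>w\<close> are
      both zero.\<close>
    define h where "h = d / (norm v + norm w + 1)"
    have d: "d > 0" using d1 d2 d3 by (simp add: d_def)
    have n: "norm v + norm w + 1 > 0" by (simp add: add_nonneg_pos)
    have h: "h > 0" using d n by (simp add: h_def)
    have near: "dist (z + s *\<^sub>R v + r *\<^sub>R w) z < d" if "0 \<le> s" "s \<le> h" "0 \<le> r" "r \<le> h" for s r
    proof -
      have "dist (z + s *\<^sub>R v + r *\<^sub>R w) z = norm (s *\<^sub>R v + r *\<^sub>R w)"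
        by (simp add: dist_norm add.assoc)
      also have "\<dots> \<le> s * norm v + r * norm w"
        using norm_triangle_ineq[of "s *\<^sub>R v" "r *\<^sub>R w"] that by simp
      also have "\<dots> \<le> h * norm v + h * norm w"
        using that by (intro add_mono mult_right_mono) auto
      also have "\<dots> < h * (norm v + norm w + 1)" using h by (simp add: algebra_simps)
      also have "\<dots> = d" using n by (simp add: h_def)
      finally show ?thesis .
    qed
    have inU: "z + s *\<^sub>R v + r *\<^sub>R w \<in> U" if "0 \<le> s" "s \<le> h" "0 \<le> r" "r \<le> h" for s r
      using d3(2) near[OF that] by (simp add: d_def)
    have inU': "z + s *\<^sub>R w + r *\<^sub>R v \<in> U" if "0 \<le> s" "s \<le> h" "0 \<le> r" "r \<le> h" for s r
      using inU[OF that(3,4,1,2)] by (simp add: algebra_simps)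
    obtain s r where sr: "0 \<le> s" "s \<le> h" "0 \<le> r" "r \<le> h"
      and 1: "f (z + h *\<^sub>R v + h *\<^sub>R w) - f (z + h *\<^sub>R v) - f (z + h *\<^sub>R w) + f z =
        h * h * G (z + s *\<^sub>R v + r *\<^sub>R w)"
      using second_difference[OF f h, of z v w] inU unfolding G_def by blast
    obtain s' r' where sr': "0 \<le> s'" "s' \<le> h" "0 \<le> r'" "r' \<le> h"
      and 2: "f (z + h *\<^sub>R w + h *\<^sub>R v) - f (z + h *\<^sub>R w) - f (z + h *\<^sub>R v) + f z =
        h * h * H (z + s' *\<^sub>R w + r' *\<^sub>R v)"
      using second_difference[OF f h, of z w v] inU' unfolding H_def by blast
    have "h * h * G (z + s *\<^sub>R v + r *\<^sub>R w) = h * h * H (z + s' *\<^sub>R w + r' *\<^sub>R v)"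
      using 1 2 by (simp add: algebra_simps)
    then have eq: "G (z + s *\<^sub>R v + r *\<^sub>R w) = H (z + s' *\<^sub>R w + r' *\<^sub>R v)"
      using h by simp
    have "dist (G (z + s *\<^sub>R v + r *\<^sub>R w)) (G z) < e / 2"
      using near[OF sr] by (intro d1(2)) (simp add: d_def)
    moreover have "dist (H (z + s' *\<^sub>R w + r' *\<^sub>R v)) (H z) < e / 2"
      using near[OF sr'(3,4,1,2)] by (intro d2(2)) (simp add: d_def algebra_simps)
    ultimately show ?thesis using eq by (simp add: dist_real_def abs_if split: if_splits)
  qed
  \<comment> \<open>With \<open>e\<close> the distance itself, a nonzero distance would be smaller
    than itself.\<close>
  from this[of "\<bar>G z - H z\<bar>"] have "G z = H z" by force
  then show ?thesis by (simp add: G_def H_def)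
qed

lemma D_inner:
  assumes "f differentiable at z"
  shows "D (\<lambda>x. f x \<bullet> c) z v = D f z v \<bullet> c"
  by (subst D_eqI[OF has_derivative_inner_left[OF D_has_derivative[OF assms]]]) simp

lemma symmetric_second_derivative:
  fixes f :: "'a::real_normed_vector \<Rightarrow> 'b::euclidean_space"
  assumes U: "open U" "z \<in> U" and f: "smooth_on U f"
  shows "D (\<lambda>x. D f x v) z w = D (\<lambda>x. D f x w) z v"
proof (rule euclidean_eqI)
  fix b :: 'b
  have "D (\<lambda>x. D f x v) z w \<bullet> b = D (\<lambda>x. D (\<lambda>x. f x \<bullet> b) x v) z w" for v w
  proof -
    have "D (\<lambda>x. D (\<lambda>x. f x \<bullet> b) x v) z = D (\<lambda>x. D f x v \<bullet> b) z"
      by (rule D_cong_open[OF U D_inner[OF smooth_on_differentiable[OF f]]])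
    then show ?thesis by (simp add: D_inner[OF smooth_on_differentiable[OF smooth_on_D[OF f] U(2)]])
  qed
  moreover have "D (\<lambda>x. D (\<lambda>x. f x \<bullet> b) x v) z w = D (\<lambda>x. D (\<lambda>x. f x \<bullet> b) x w) z v"
    by (rule symmetric_second_derivative_real[OF U smooth_on_inner[OF U(1) f smooth_on_const]])
  ultimately show "D (\<lambda>x. D f x v) z w \<bullet> b = D (\<lambda>x. D f x w) z v \<bullet> b" by simp
qed

section \<open>Radial integrals and the Poincare lemma for one-forms and two-forms\<close>

lemma linear_functional_expansion:
  fixes f :: "'a::euclidean_space \<Rightarrow> real"
  assumes "linear f"
  shows "f v = (\<Sum>b\<in>Basis. (v \<bullet> b) * f b)"
proof -
  have "f (\<Sum>b\<in>Basis. (v \<bullet> b) *\<^sub>R b) = (\<Sum>b\<in>Basis. (v \<bullet> b) * f b)"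
    by (simp add: linear_sum[OF assms] linear_cmul[OF assms])
  then show ?thesis by (simp add: euclidean_representation)
qed

text \<open>The Poincare homotopy operator on \<open>k\<close>-forms carries the weight
  \<open>t ^ (k - 1)\<close>. The exponent \<open>m\<close> is kept free because every derivative in
  \<open>x\<close> brings out another factor \<open>t\<close>.\<close>

definition radial_integral :: "nat \<Rightarrow> 'a::euclidean_space \<Rightarrow> ('a \<Rightarrow> real) \<Rightarrow> 'a \<Rightarrow> real" where
  "radial_integral m x0 f x = integral {0..1} (\<lambda>t. t ^ m * f (x0 + t *\<^sub>R (x - x0)))"

text \<open>Convexity is what differentiation under the integral sign asks of the parameter set; it
  holds for the balls used later.\<close>

locale star_center =
  fixes U :: "'a::euclidean_space set" and x0 :: 'a
  assumes open_U: "open U" and convex_U: "convex U" and x0: "x0 \<in> U"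
begin

lemma segment_in: "x \<in> U \<Longrightarrow> 0 \<le> t \<Longrightarrow> t \<le> 1 \<Longrightarrow> x0 + t *\<^sub>R (x - x0) \<in> U"
  using convexD_alt[OF convex_U x0, of x t] by (simp add: algebra_simps)

lemma continuous_on_radial:
  fixes f :: "'a \<Rightarrow> 'b::topological_space"
  assumes "continuous_on U f"
  shows "continuous_on (U \<times> {0..1}) (\<lambda>(x, t). f (x0 + t *\<^sub>R (x - x0)))"
  unfolding split_beta
  by (rule continuous_on_compose2[OF assms]) (auto intro!: continuous_intros segment_in)

lemma radial_integrable:
  assumes "continuous_on U f" "x \<in> U"
  shows "(\<lambda>t. t ^ m * f (x0 + t *\<^sub>R (x - x0))) integrable_on {0..1}"
proof (rule integrable_continuous_interval, rule continuous_on_mult)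
  show "continuous_on {0..1} (\<lambda>t. f (x0 + t *\<^sub>R (x - x0)))"
    using assms by (intro continuous_on_compose2[OF assms(1)]) (auto intro!: continuous_intros segment_in)
qed (auto intro!: continuous_intros)

lemma radial_integral_has_derivative:
  assumes f: "smooth_on U f" and x: "x \<in> U"
  shows "(radial_integral m x0 f has_derivative
    (\<lambda>v. radial_integral (Suc m) x0 (\<lambda>y. D f y v) x)) (at x)"
proof -
  \<comment> \<open>The derivative of the integrand as a bounded linear functional, the form that
    \<open>leibniz_rule\<close> requires. The basis expansion reduces its joint continuity to that
    of directional derivatives.\<close>
  define F where "F x t = (\<Sum>b\<in>Basis. (t ^ Suc m * D f (x0 + t *\<^sub>R (x - x0)) b) *\<^sub>R blinfun_inner_left b)"
    for x t
  have F: "blinfun_apply (F x t) v = t ^ Suc m * D f (x0 + t *\<^sub>R (x - x0)) v"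
    if "x \<in> U" "t \<in> {0..1}" for x t v
    using D_basis_expansion[OF smooth_on_differentiable[OF f segment_in], of x t v] that
    by (simp add: F_def blinfun.sum_left blinfun.scaleR_left sum_distrib_left ac_simps inner_commute)
  have contF: "continuous_on (U \<times> {0..1}) (\<lambda>(x, t). F x t)"
  proof -
    have "continuous_on (U \<times> {0..1}) (\<lambda>p. D f (x0 + snd p *\<^sub>R (fst p - x0)) b)" for b
      using continuous_on_radial[OF smooth_on_continuous[OF smooth_on_D[OF f]], of b]
      by (simp add: split_beta)
    then show ?thesis unfolding F_def split_beta by (intro continuous_intros)
  qed
  have "((\<lambda>x. integral (cbox 0 1) (\<lambda>t. t ^ m * f (x0 + t *\<^sub>R (x - x0)))) has_derivative
      blinfun_apply (integral (cbox 0 1) (F x))) (at x within U)"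
  proof (rule leibniz_rule[OF _ _ _ x convex_U])
    fix y t assume yt: "y \<in> U" "t \<in> cbox (0::real) 1"
    then have mem: "x0 + t *\<^sub>R (y - x0) \<in> U" by (auto intro: segment_in)
    have "((\<lambda>y. x0 + t *\<^sub>R (y - x0)) has_derivative (\<lambda>v. t *\<^sub>R v)) (at y)"
      by (auto intro!: derivative_eq_intros)
    from has_derivative_mult_right[OF has_derivative_compose[OF this smooth_on_has_derivative[OF f mem]],
        of "t ^ m"]
    have "((\<lambda>y. t ^ m * f (x0 + t *\<^sub>R (y - x0))) has_derivative
      (\<lambda>v. t ^ m * D f (x0 + t *\<^sub>R (y - x0)) (t *\<^sub>R v))) (at y)" .
    moreover have "(\<lambda>v. t ^ m * D f (x0 + t *\<^sub>R (y - x0)) (t *\<^sub>R v)) = blinfun_apply (F y t)"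
      using F[of y t] yt linear_cmul[OF smooth_on_D_linear[OF f mem]] by auto
    ultimately show "((\<lambda>y. t ^ m * f (x0 + t *\<^sub>R (y - x0))) has_derivative blinfun_apply (F y t))
        (at y within U)"
      by (simp add: has_derivative_at_withinI)
  next
    show "(\<lambda>t. t ^ m * f (x0 + t *\<^sub>R (y - x0))) integrable_on cbox 0 1" if "y \<in> U" for y
      using radial_integrable[OF smooth_on_continuous[OF f] that] by simp
  qed (use contF in simp)
  moreover have "blinfun_apply (integral (cbox 0 1) (F x)) v =
      radial_integral (Suc m) x0 (\<lambda>y. D f y v) x" for v
  proof -
    have "continuous_on {0..1} (F x)"
      by (rule continuous_on_compose2[OF contF, where f = "\<lambda>t. (x, t)", unfolded split_beta fst_conv
          snd_conv])
        (use x in \<open>auto intro!: continuous_intros\<close>)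
    then have "blinfun_apply (integral {0..1} (F x)) v = integral {0..1} (\<lambda>t. blinfun_apply (F x t) v)"
      by (intro blinfun_apply_integral integrable_continuous_interval)
    also have "\<dots> = radial_integral (Suc m) x0 (\<lambda>y. D f y v) x"
      unfolding radial_integral_def by (rule integral_cong) (simp add: F[OF x])
    finally show ?thesis by simp
  qed
  ultimately have "((\<lambda>x. integral (cbox 0 1) (\<lambda>t. t ^ m * f (x0 + t *\<^sub>R (x - x0)))) has_derivative
      (\<lambda>v. radial_integral (Suc m) x0 (\<lambda>y. D f y v) x)) (at x)"
    using at_within_open[OF x open_U] by (metis (no_types, lifting) ext)
  then show ?thesis by (simp add: radial_integral_def[abs_def])
qed

text \<open>Differentiation maps radial integrals to radial integrals, with \<open>m\<close> raised
  by one and \<open>f\<close> replaced by a directional derivative; hence the induction for all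
  \<open>m\<close> and \<open>f\<close> at once.\<close>

lemma smooth_radial_integral: 
  assumes "smooth_on U f"
  shows "smooth_on U (radial_integral m x0 f)"
proof -
  have "Ck_on k U (radial_integral m x0 f)" for k
    using assms
  proof (induction k arbitrary: m f)
    case 0
    then show ?case
      using differentiableI[OF radial_integral_has_derivative[OF 0]]
      by (simp add: continuous_on_of_differentiable)
  next
    case (Suc k)
    have "radial_integral m x0 f differentiable at x" if "x \<in> U" for x
      by (rule differentiableI[OF radial_integral_has_derivative[OF Suc.prems that]])
    moreover have "Ck_on k U (\<lambda>x. D (radial_integral m x0 f) x v)" for v
      by (rule Ck_on_cong[OF open_U _ Suc.IH[OF smooth_on_D[OF Suc.prems]]])
        (simp add: D_eqI[OF radial_integral_has_derivative[OF Suc.prems]])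
    ultimately show ?case by simp
  qed
  then show ?thesis by (simp add: smooth_on_def)
qed

lemma radial_integral_cong:
  assumes "x \<in> U" "\<And>y. y \<in> U \<Longrightarrow> f y = g y"
  shows "radial_integral m x0 f x = radial_integral m x0 g x"
  unfolding radial_integral_def by (rule integral_cong) (use assms segment_in in auto)

lemma radial_integral_add:
  assumes "x \<in> U" "continuous_on U f" "continuous_on U g"
  shows "radial_integral m x0 (\<lambda>y. f y + g y) x = radial_integral m x0 f x + radial_integral m x0 g x"
proof -
  have "integral {0..1} (\<lambda>t. t ^ m * f (x0 + t *\<^sub>R (x - x0)) + t ^ m * g (x0 + t *\<^sub>R (x - x0))) =
    radial_integral m x0 f x + radial_integral m x0 g x"
    unfolding radial_integral_def using assms by (intro integral_add radial_integrable)
  then show ?thesis by (simp add: radial_integral_def distrib_left)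
qed

lemma radial_integral_cmult: "radial_integral m x0 (\<lambda>y. c * f y) x = c * radial_integral m x0 f x"
  by (simp add: radial_integral_def mult.left_commute)

lemma radial_integral_sum:
  assumes "x \<in> U" "finite I" "\<And>i. i \<in> I \<Longrightarrow> continuous_on U (f i)"
  shows "radial_integral m x0 (\<lambda>y. \<Sum>i\<in>I. c i * f i y) x = (\<Sum>i\<in>I. c i * radial_integral m x0 (f i) x)"
proof -
  have "integral {0..1} (\<lambda>t. \<Sum>i\<in>I. c i * (t ^ m * f i (x0 + t *\<^sub>R (x - x0)))) =
      (\<Sum>i\<in>I. integral {0..1} (\<lambda>t. c i * (t ^ m * f i (x0 + t *\<^sub>R (x - x0)))))"
    using assms by (intro integral_sum integrable_on_mult_right radial_integrable) auto
  then show ?thesis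
    by (simp add: radial_integral_def sum_distrib_left mult.left_commute)
qed

text \<open>Integrate the \<open>t\<close>-derivative of
  \<open>t ^ Suc m * f (x0 + t *\<^sub>R (x - x0))\<close> over the unit interval; the positive
  power of \<open>t\<close> removes the boundary term at 0. This is the homotopy formula in
  coordinates.\<close>

lemma radial_integral_identity:
  assumes f: "smooth_on U f" and x: "x \<in> U"
  shows "real (Suc m) * radial_integral m x0 f x +
    (\<Sum>b\<in>Basis. ((x - x0) \<bullet> b) * radial_integral (Suc m) x0 (\<lambda>y. D f y b) x) = f x"
proof -
  let ?p = "\<lambda>t. x0 + t *\<^sub>R (x - x0)"
  have c: "continuous_on U f" "\<And>v. continuous_on U (\<lambda>y. D f y v)"
    by (rule smooth_on_continuous[OF f], rule smooth_on_continuous[OF smooth_on_D[OF f]])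
  have "((\<lambda>t. real (Suc m) * (t ^ m * f (?p t)) + t ^ Suc m * D f (?p t) (x - x0))
      has_integral 1 ^ Suc m * f (?p 1) - 0 ^ Suc m * f (?p 0)) {0..1}"
  proof (rule fundamental_theorem_of_calculus)
    fix t :: real assume t: "t \<in> {0..1}"
    have "((\<lambda>t. t ^ Suc m * f (?p t)) has_real_derivative
        real (Suc m) * (t ^ m * f (?p t)) + t ^ Suc m * D f (?p t) (x - x0)) (at t)"
      using line_has_real_derivative[OF smooth_on_differentiable[OF f segment_in[OF x]], of t] t
      by (auto intro!: derivative_eq_intros simp: algebra_simps simp del: power_Suc)
    then show "((\<lambda>t. t ^ Suc m * f (?p t)) has_vector_derivative
        real (Suc m) * (t ^ m * f (?p t)) + t ^ Suc m * D f (?p t) (x - x0)) (at t within {0..1})"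
      using has_real_derivative_iff_has_vector_derivative has_vector_derivative_at_within by blast
  qed simp
  then have "integral {0..1} (\<lambda>t. real (Suc m) * (t ^ m * f (?p t)) + t ^ Suc m * D f (?p t) (x -
      x0)) = f x"
    by (simp add: integral_unique)
  moreover have "integral {0..1} (\<lambda>t. real (Suc m) * (t ^ m * f (?p t)) + t ^ Suc m * D f (?p t) (x - x0)) =
     integral {0..1} (\<lambda>t. real (Suc m) * (t ^ m * f (?p t))) + integral {0..1} (\<lambda>t. t ^ Suc m * D f
         (?p t) (x - x0))"
    by (intro integral_add integrable_on_mult_right radial_integrable c x)
  moreover have "integral {0..1} (\<lambda>t. t ^ Suc m * D f (?p t) (x - x0)) =
      (\<Sum>b\<in>Basis. ((x - x0) \<bullet> b) * radial_integral (Suc m) x0 (\<lambda>y. D f y b) x)"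
  proof -
    have "radial_integral (Suc m) x0 (\<lambda>y. D f y (x - x0)) x =
       radial_integral (Suc m) x0 (\<lambda>y. \<Sum>b\<in>Basis. ((x - x0) \<bullet> b) * D f y b) x"
      using D_basis_expansion[OF smooth_on_differentiable[OF f], of _ "x - x0"]
      by (intro radial_integral_cong[OF x]) simp
    also have "\<dots> = (\<Sum>b\<in>Basis. ((x - x0) \<bullet> b) * radial_integral (Suc m) x0 (\<lambda>y. D f y b) x)"
      by (rule radial_integral_sum[OF x finite_Basis c(2)])
    finally show ?thesis by (simp only: radial_integral_def)
  qed
  ultimately show ?thesis by (simp add: radial_integral_def)
qed

lemma radial_contraction_has_derivative:
  assumes a: "\<And>b. smooth_on U (a b)" and x: "x \<in> U"
  shows "((\<lambda>x. \<Sum>b\<in>Basis. ((x - x0) \<bullet> b) * radial_integral m x0 (a b) x) has_derivative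
    (\<lambda>v. (\<Sum>b\<in>Basis. (v \<bullet> b) * radial_integral m x0 (a b) x) +
      (\<Sum>b\<in>Basis. ((x - x0) \<bullet> b) * radial_integral (Suc m) x0 (\<lambda>y. D (a b) y v) x))) (at x)"
proof -
  have "((\<lambda>x. ((x - x0) \<bullet> b) * radial_integral m x0 (a b) x) has_derivative
    (\<lambda>v. ((x - x0) \<bullet> b) * radial_integral (Suc m) x0 (\<lambda>y. D (a b) y v) x
      + (v \<bullet> b) * radial_integral m x0 (a b) x)) (at x)" for b
    by (rule has_derivative_mult[OF has_derivative_inner_left
          radial_integral_has_derivative[OF a x]]) (auto intro!: derivative_eq_intros)
  from has_derivative_sum[OF this] show ?thesis by (simp add: sum.distrib add.commute)
qed

lemma smooth_radial_contraction:
  assumes a: "\<And>b. smooth_on U (a b)"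
  shows "smooth_on U (\<lambda>x. \<Sum>b\<in>Basis. ((x - x0) \<bullet> b) * radial_integral m x0 (a b) x)"
  by (intro smooth_on_sum smooth_on_mult smooth_on_inner smooth_on_diff smooth_on_id smooth_on_const
      smooth_radial_integral a open_U finite_Basis)

text \<open>The primitive integrates \<open>\<alpha>\<close> along the segment from
  \<open>x0\<close>. Closedness exchanges the direction of differentiation with the argument of
  \<open>\<alpha>\<close>, and \<open>radial_integral_identity\<close> with \<open>m = 0\<close>
  then gives the claim.\<close>

lemma Poincare_1:
  fixes \<alpha> :: "'a \<Rightarrow> 'a \<Rightarrow> real"
  assumes lin: "\<And>z. z \<in> U \<Longrightarrow> linear (\<alpha> z)" and sm: "\<And>v. smooth_on U (\<lambda>z. \<alpha> z v)"
    and closed: "\<And>z v w. z \<in> U \<Longrightarrow> D (\<lambda>z. \<alpha> z v) z w = D (\<lambda>z. \<alpha> z w) z v"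
  obtains L where "smooth_on U L" "\<And>z v. z \<in> U \<Longrightarrow> D L z v = \<alpha> z v"
proof
  let ?L = "\<lambda>x. \<Sum>b\<in>Basis. ((x - x0) \<bullet> b) * radial_integral 0 x0 (\<lambda>z. \<alpha> z b) x"
  show "smooth_on U ?L" by (rule smooth_radial_contraction[OF sm])
  fix z v assume z: "z \<in> U"
  have "\<alpha> y v = (\<Sum>b\<in>Basis. (v \<bullet> b) * \<alpha> y b)" if "y \<in> U" for y
    by (rule linear_functional_expansion[OF lin[OF that]])
  then have "radial_integral 0 x0 (\<lambda>z. \<alpha> z v) z =
      (\<Sum>b\<in>Basis. (v \<bullet> b) * radial_integral 0 x0 (\<lambda>z. \<alpha> z b) z)"
    by (subst radial_integral_sum[symmetric, OF z finite_Basis smooth_on_continuous[OF sm]])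
      (rule radial_integral_cong[OF z])
  moreover have "radial_integral (Suc 0) x0 (\<lambda>y. D (\<lambda>z. \<alpha> z b) y v) z =
      radial_integral (Suc 0) x0 (\<lambda>y. D (\<lambda>z. \<alpha> z v) y b) z" for b
    by (rule radial_integral_cong[OF z closed])
  ultimately show "D ?L z v = \<alpha> z v"
    using radial_integral_identity[OF sm z, of 0 v]
    by (simp add: D_eqI[OF radial_contraction_has_derivative[OF sm z]])
qed

text \<open>\<open>\<beta>\<close> inserts \<open>z - x0\<close> into the first slot of
  \<open>B\<close> and integrates with weight \<open>t\<close>. The last conclusion is special to
  this primitive: a direction annihilated by \<open>B\<close> throughout \<open>U\<close> is
  annihilated by \<open>\<beta>\<close>, which keeps \<open>\<beta>\<close> semi-basic in the
  application.\<close>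

lemma Poincare_2:
  fixes B :: "'a \<Rightarrow> 'a \<Rightarrow> 'a \<Rightarrow> real"
  assumes lin: "\<And>z v. z \<in> U \<Longrightarrow> linear (B z v)"
    and alt: "\<And>z v w. z \<in> U \<Longrightarrow> B z v w = - B z w v"
    and sm: "\<And>v w. smooth_on U (\<lambda>z. B z v w)"
    and closed: "\<And>z u v w. z \<in> U \<Longrightarrow>
      D (\<lambda>z. B z v w) z u + D (\<lambda>z. B z w u) z v + D (\<lambda>z. B z u v) z w = 0"
  obtains \<beta> where "\<And>v. smooth_on U (\<lambda>z. \<beta> z v)" "\<And>z. z \<in> U \<Longrightarrow> linear (\<beta> z)"
    "\<And>z v w. z \<in> U \<Longrightarrow> D (\<lambda>z. \<beta> z w) z v - D (\<lambda>z. \<beta> z v) z w = B z v w"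
    "\<And>z w. z \<in> U \<Longrightarrow> (\<And>z v. z \<in> U \<Longrightarrow> B z v w = 0) \<Longrightarrow> \<beta> z w = 0"
proof
  define \<beta> where "\<beta> z w = (\<Sum>b\<in>Basis. ((z - x0) \<bullet> b) * radial_integral 1 x0 (\<lambda>z. B z b w) z)" for z w
  note c = smooth_on_continuous[OF sm]
  show "smooth_on U (\<lambda>z. \<beta> z v)" for v
    unfolding \<beta>_def by (rule smooth_radial_contraction[OF sm])
  show "linear (\<beta> z)" if z: "z \<in> U" for z
  proof
    fix v w :: 'a and r :: real
    have "radial_integral 1 x0 (\<lambda>z. B z b (v + w)) z =
        radial_integral 1 x0 (\<lambda>z. B z b v) z + radial_integral 1 x0 (\<lambda>z. B z b w) z" for b
      by (subst radial_integral_add[OF z c c, symmetric], rule radial_integral_cong[OF z])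
        (simp add: linear_add[OF lin])
    then show "\<beta> z (v + w) = \<beta> z v + \<beta> z w" by (simp add: \<beta>_def distrib_left sum.distrib)
    have "radial_integral 1 x0 (\<lambda>z. B z b (r *\<^sub>R v)) z = r * radial_integral 1 x0 (\<lambda>z. B z b v) z" for b
      by (subst radial_integral_cmult[symmetric], rule radial_integral_cong[OF z])
        (simp add: linear_cmul[OF lin])
    then show "\<beta> z (r *\<^sub>R v) = r *\<^sub>R \<beta> z v"
      by (simp add: \<beta>_def sum_distrib_left mult.left_commute)
  qed
  show "\<beta> z w = 0" if "z \<in> U" "\<And>z v. z \<in> U \<Longrightarrow> B z v w = 0" for z w
  proof -
    have "radial_integral 1 x0 (\<lambda>z. B z b w) z = radial_integral 1 x0 (\<lambda>z. 0) z" for b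
      by (rule radial_integral_cong[OF that(1)]) (rule that(2))
    then show ?thesis by (simp add: \<beta>_def radial_integral_def)
  qed
  fix z v w assume z: "z \<in> U"
  have contract: "(\<Sum>b\<in>Basis. (v \<bullet> b) * radial_integral 1 x0 (\<lambda>z. B z b w) z) =
      radial_integral 1 x0 (\<lambda>z. B z v w) z" for v w
  proof (subst radial_integral_sum[symmetric, OF z finite_Basis c], rule radial_integral_cong[OF z])
    fix y assume y: "y \<in> U"
    show "(\<Sum>b\<in>Basis. (v \<bullet> b) * B y b w) = B y v w"
      using linear_functional_expansion[OF lin[OF y], of w v] alt[OF y, of v w]
      by (simp add: sum_negf alt[OF y, of _ w])
  qed
  have D\<beta>: "D (\<lambda>z. \<beta> z w) z v = radial_integral 1 x0 (\<lambda>z. B z v w) z +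
      (\<Sum>b\<in>Basis. ((z - x0) \<bullet> b) * radial_integral 2 x0 (\<lambda>z. D (\<lambda>z. B z b w) z v) z)" for v w
    unfolding \<beta>_def
    by (subst D_eqI[OF radial_contraction_has_derivative[OF sm z]]) (simp add: contract[simplified]
        numeral_2_eq_2)
  have neg: "radial_integral 1 x0 (\<lambda>z. B z w v) z = - radial_integral 1 x0 (\<lambda>z. B z v w) z"
    using radial_integral_cmult[of 1 "-1" "\<lambda>z. B z v w" z]
    by (subst radial_integral_cong[OF z alt]) simp_all
  have Dneg: "D (\<lambda>z. B z v w) y u = - D (\<lambda>z. B z w v) y u" if y: "y \<in> U" for y u v w
  proof -
    have "D (\<lambda>z. B z v w) y = D (\<lambda>z. - B z w v) y" by (rule D_cong_open[OF open_U y alt])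
    then show ?thesis
      by (simp add: D_eqI[OF has_derivative_minus[OF smooth_on_has_derivative[OF sm y]]])
  qed
  \<comment> \<open>Closedness splits off a derivative along \<open>b\<close>. Summed against
    \<open>z - x0\<close> it is the sum in \<open>radial_integral_identity\<close> for
    \<open>m = 1\<close>, whose coefficient 2 matches the two copies of the integral of
    \<open>B z v w\<close> that arise from antisymmetrising \<open>D\<beta>\<close>.\<close>
  have "radial_integral 2 x0 (\<lambda>z. D (\<lambda>z. B z b w) z v) z =
    radial_integral 2 x0 (\<lambda>z. D (\<lambda>z. B z b v) z w) z + radial_integral 2 x0 (\<lambda>z. D (\<lambda>z. B z v w) z
        b) z" for b
  proof (subst radial_integral_add[symmetric, OF z], (rule smooth_on_continuous[OF smooth_on_D[OF sm]])+,
      rule radial_integral_cong[OF z])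
    fix y assume "y \<in> U"
    with closed[OF this, of b w v] Dneg[OF this, of w v b] Dneg[OF this, of v b w]
    show "D (\<lambda>z. B z b w) y v = D (\<lambda>z. B z b v) y w + D (\<lambda>z. B z v w) y b" by simp
  qed
  with radial_integral_identity[OF sm z, of 1 v w]
  show "D (\<lambda>z. \<beta> z w) z v - D (\<lambda>z. \<beta> z v) z w = B z v w"
    by (simp add: D\<beta> neg[simplified] numeral_2_eq_2 distrib_left sum.distrib)
qed

end

section \<open>The geometry of a semispray in one chart\<close>

lemma sum_lessThan_2: "(\<Sum>a<Suc (Suc 0). f a) = f 0 + f (Suc 0)"
  by simp

locale spray_chart =
  fixes U :: "('e::euclidean_space \<times> 'e) set" and S :: "'e \<times> 'e \<Rightarrow> 'e \<times> 'e" and s :: "'e \<times> 'e \<Rightarrow> 'e"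
  assumes open_U: "open U" and S_eq: "\<And>z. z \<in> U \<Longrightarrow> S z = (snd z, s z)" and smooth_s: "smooth_on U s"
begin

text \<open>With \<open>s = - 2 G\<close>, these are the matrices \<open>N\<^sup>i\<^sub>j\<close>, \<open>S(N\<^sup>i\<^sub>j)\<close> and \<open>R\<^sup>i\<^sub>j\<close>.\<close>

definition N :: "'e \<times> 'e \<Rightarrow> 'e \<Rightarrow> 'e" where
  "N z e = - (1/2) *\<^sub>R D s z (0, e)"

definition S_N :: "'e \<times> 'e \<Rightarrow> 'e \<Rightarrow> 'e" where
  "S_N z e = D (\<lambda>x. N x e) z (S z)"

definition R :: "'e \<times> 'e \<Rightarrow> 'e \<Rightarrow> 'e" where
  "R z e = - S_N z e - D s z (e, 0) - N z (N z e)"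

lemma smooth_S: "smooth_on U S"
proof (rule smooth_on_cong[OF open_U S_eq[symmetric]])
  show "smooth_on U (\<lambda>z. (snd z, s z))"
    by (intro smooth_on_Pair smooth_on_snd smooth_on_id smooth_s open_U)
qed

lemma D_S: assumes "z \<in> U" shows "D S z w = (snd w, D s z w)"
proof -
  have "D S z = D (\<lambda>z. (snd z, s z)) z" by (rule D_cong_open[OF open_U assms S_eq])
  also have "\<dots> = (\<lambda>w. (snd w, D s z w))"
    by (rule D_eqI, intro has_derivative_Pair has_derivative_snd has_derivative_ident
        smooth_on_has_derivative[OF smooth_s assms])
  finally show ?thesis by simp
qed

lemma linear_Ds: "z \<in> U \<Longrightarrow> linear (D s z)"
  by (rule smooth_on_D_linear[OF smooth_s])

lemma linear_N: "z \<in> U \<Longrightarrow> linear (N z)"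
  using linear_add[OF linear_Ds, of z "(0, x)" "(0, y)" for x y]
    linear_cmul[OF linear_Ds, of z r "(0, x)" for r x]
  by (intro linearI) (simp_all add: N_def scaleR_add_right)

lemma smooth_N: "smooth_on U (\<lambda>z. N z e)"
  unfolding N_def by (intro smooth_on_scaleR smooth_on_const smooth_on_D smooth_s open_U)

lemma lie_bracket_const: "z \<in> U \<Longrightarrow> lie_bracket S (\<lambda>_. w) z = - (snd w, D s z w)"
  by (simp add: lie_bracket_def D_S)

lemma Ds_vert: "D s z (0, e) = - 2 *\<^sub>R N z e"
  by (simp add: N_def)

lemma lie_endo_J: "z \<in> U \<Longrightarrow> lie_endo S tangent_structure z w = (- fst w, snd w + 2 *\<^sub>R N z (fst w))"
  by (simp add: lie_endo_def lie_bracket_const tangent_structure_def Ds_vert)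

lemma hor_proj_eq: "z \<in> U \<Longrightarrow> hor_proj S z w = (fst w, - N z (fst w))"
  by (cases w) (simp add: hor_proj_def lie_endo_J scaleR_2[symmetric] del: scaleR_half_double)

lemma ver_proj_eq: "z \<in> U \<Longrightarrow> ver_proj S z w = (0, snd w + N z (fst w))"
proof -
  assume z: "z \<in> U"
  have "snd w + (snd w + 2 *\<^sub>R N z (fst w)) = (snd w + N z (fst w)) + (snd w + N z (fst w))"
    by (simp add: scaleR_2)
  then have "(1/2) *\<^sub>R (snd w + (snd w + 2 *\<^sub>R N z (fst w))) = snd w + N z (fst w)"
    by (simp only: scaleR_half_double)
  with z show ?thesis
    by (cases w) (simp add: ver_proj_def lie_endo_J)
qed

text \<open>\<open>[S, h]\<close> is computed once: its horizontal projection gives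
  \<open>F + J\<close> and its vertical projection gives \<open>\<Phi>\<close>.\<close>

lemma lie_endo_hor:
  assumes z: "z \<in> U"
  shows "lie_endo S (hor_proj S) z w =
    (snd w + N z (fst w), R z (fst w) - N z (snd w + N z (fst w)))"
proof -
  have "D (\<lambda>x. hor_proj S x w) z = D (\<lambda>x. (fst w, - N x (fst w))) z"
    by (rule D_cong_open[OF open_U z hor_proj_eq])
  also have "\<dots> = (\<lambda>v. (0, - D (\<lambda>x. N x (fst w)) z v))"
    by (rule D_eqI, intro has_derivative_Pair has_derivative_const has_derivative_minus
        smooth_on_has_derivative[OF smooth_N z])
  finally have 1: "D (\<lambda>x. hor_proj S x w) z (S z) = (0, - S_N z (fst w))" by (simp add: S_N_def)
  have 2: "D s z (fst w, - N z (fst w)) = D s z (fst w, 0) + 2 *\<^sub>R N z (N z (fst w))"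
    using linear_add[OF linear_Ds[OF z], of "(fst w, 0)" "(0, - N z (fst w))"]
    by (simp add: Ds_vert linear_neg[OF linear_N[OF z]])
  show ?thesis
    by (simp add: lie_endo_def lie_bracket_const[OF z] hor_proj_eq[OF z] lie_bracket_def 1 D_S[OF z] 2 R_def
        linear_neg[OF linear_N[OF z]] linear_add[OF linear_N[OF z]] scaleR_2)
qed

lemma complex_plus_J_eq:
  "z \<in> U \<Longrightarrow> complex_structure S z w + tangent_structure z w =
     (snd w + N z (fst w), - N z (snd w + N z (fst w)))"
  by (simp add: complex_structure_def lie_endo_hor hor_proj_eq)

lemma Jacobi_eq: "z \<in> U \<Longrightarrow> Jacobi_endo S z w = (0, R z (fst w))"
  by (simp add: Jacobi_endo_def lie_endo_hor ver_proj_eq)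

text \<open>In each slot the bracket with \<open>S\<close> and \<open>F + J - \<Phi>\<close>
  combine: the derivatives of \<open>s\<close> along \<open>x\<close> in the bracket cancel those in
  \<open>R\<close>, and only \<open>N\<close> and \<open>S_N\<close> survive. The function
  \<open>b\<close> stands in for the form on lists of length two, so that bilinearity can be
  used.\<close>

lemma dyn_deriv_2:
  assumes z: "z \<in> U" and \<alpha>: "\<And>z X Y. z \<in> U \<Longrightarrow> \<alpha> z [X, Y] = b z X Y"
    and b1: "\<And>Y. linear (\<lambda>X. b z X Y)" and b2: "\<And>X. linear (\<lambda>Y. b z X Y)"
  shows "dyn_deriv S \<alpha> z [X, Y] = D (\<lambda>z. b z X Y) z (S z) +
    b z (- N z (fst X), - N z (snd X) - S_N z (fst X)) Y +
    b z X (- N z (fst Y), - N z (snd Y) - S_N z (fst Y))"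
proof -
  have 0: "- lie_bracket S (\<lambda>_. w) z -
      (complex_structure S z w + tangent_structure z w - Jacobi_endo S z w) =
      (- N z (fst w), - N z (snd w) - S_N z (fst w))" for w
  proof -
    have "D s z w = D s z (fst w, 0) - 2 *\<^sub>R N z (snd w)"
      using linear_add[OF linear_Ds[OF z], of "(fst w, 0)" "(0, snd w)"] by (simp add: Ds_vert)
    then show ?thesis
      by (simp add: lie_bracket_const[OF z] complex_plus_J_eq[OF z] Jacobi_eq[OF z] R_def
          linear_add[OF linear_N[OF z]] scaleR_2)
  qed
  have 1: "- b z (lie_bracket S (\<lambda>_. X) z) Y -
      b z (complex_structure S z X + tangent_structure z X - Jacobi_endo S z X) Y =
      b z (- N z (fst X), - N z (snd X) - S_N z (fst X)) Y"
    unfolding 0[symmetric] by (simp only: linear_diff[OF b1] linear_neg[OF b1])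
  have 2: "- b z X (lie_bracket S (\<lambda>_. Y) z) -
      b z X (complex_structure S z Y + tangent_structure z Y - Jacobi_endo S z Y) =
      b z X (- N z (fst Y), - N z (snd Y) - S_N z (fst Y))"
    unfolding 0[symmetric] by (simp only: linear_diff[OF b2] linear_neg[OF b2])
  have "D (\<lambda>z. \<alpha> z [X, Y]) z = D (\<lambda>z. b z X Y) z"
    by (rule D_cong_open[OF open_U z \<alpha>])
  then show ?thesis
    unfolding 1[symmetric] 2[symmetric]
    by (simp add: dyn_deriv_def lie_form_def ins_def \<alpha>[OF z] sum_lessThan_2 del: sum.lessThan_Suc)
qed

end

section \<open>Semi-basic one-forms in a chart and the derivations \<open>d_K\<close> on
  them\<close>

locale semibasic_in_chart =
  fixes U :: "('e::euclidean_space \<times> 'e) set" and t :: "'e \<times> 'e \<Rightarrow> 'e" and \<theta> :: "('e \<times> 'e) form"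
  assumes open_U: "open U" and smooth_t: "smooth_on U t"
    and form_eq: "\<And>z w. z \<in> U \<Longrightarrow> \<theta> z [w] = t z \<bullet> fst w"
begin

lemma D_form:
  assumes "z \<in> U"
  shows "D (\<lambda>z. \<theta> z [w]) z v = D t z v \<bullet> fst w"
proof -
  have "D (\<lambda>z. \<theta> z [w]) z = D (\<lambda>z. t z \<bullet> fst w) z" by (rule D_cong_open[OF open_U assms form_eq])
  then show ?thesis by (simp add: D_inner[OF smooth_on_differentiable[OF smooth_t assms]])
qed

lemma ext_d_form: "z \<in> U \<Longrightarrow> ext_d \<theta> z [X, Y] = D t z X \<bullet> fst Y - D t z Y \<bullet> fst X"
  by (simp add: ext_d_def sum_lessThan_2 D_form del: sum.lessThan_Suc)

lemma linear_Dt: "z \<in> U \<Longrightarrow> linear (D t z)"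
  by (rule smooth_on_D_linear[OF smooth_t])

text \<open>For \<open>K\<close> with vertical values (the tangent structure, the vertical
  projector, the Jacobi endomorphism) \<open>i_K \<theta> = 0\<close>, so
  \<open>d_K \<theta>\<close> reduces to \<open>i_K d \<theta>\<close>.\<close>

lemma d_endo_vertical:
  assumes z: "z \<in> U" and K: "\<And>z w. z \<in> U \<Longrightarrow> fst (K z w) = 0"
  shows "d_endo K \<theta> z [X, Y] = D t z (K z X) \<bullet> fst Y - D t z (K z Y) \<bullet> fst X"
proof -
  have "ins K \<theta> x [w] = 0" if "x \<in> U" for x w using form_eq[OF that] K[OF that] by (simp add: ins_def)
  then have "D (\<lambda>z. ins K \<theta> z [w]) z = D (\<lambda>z. 0) z" for w by (rule D_cong_open[OF open_U z])
  then have "ext_d (ins K \<theta>) z [X, Y] = 0"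
    by (simp add: ext_d_def sum_lessThan_2 del: sum.lessThan_Suc)
  then show ?thesis
    by (simp add: d_endo_def ins_def sum_lessThan_2 ext_d_form[OF z] K[OF z] del: sum.lessThan_Suc)
qed

text \<open>Here \<open>i_K \<theta> = \<theta>\<close>, so one copy of \<open>d \<theta>\<close> is
  subtracted from \<open>i_K d \<theta>\<close>; this removes the terms differentiated along
  \<open>X\<close> or \<open>Y\<close> itself. Used for the horizontal projector.\<close>

lemma d_endo_horizontal:
  assumes z: "z \<in> U" and K: "\<And>z w. z \<in> U \<Longrightarrow> fst (K z w) = fst w"
  shows "d_endo K \<theta> z [X, Y] = D t z (K z X) \<bullet> fst Y - D t z (K z Y) \<bullet> fst X"
proof -
  have "ins K \<theta> x [w] = \<theta> x [w]" if "x \<in> U" for x w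
    using form_eq[OF that] K[OF that] by (simp add: ins_def)
  then have "D (\<lambda>z. ins K \<theta> z [w]) z = D (\<lambda>z. \<theta> z [w]) z" for w by (rule D_cong_open[OF open_U z])
  then have "ext_d (ins K \<theta>) z [X, Y] = ext_d \<theta> z [X, Y]"
    by (simp add: ext_d_def sum_lessThan_2 del: sum.lessThan_Suc)
  then show ?thesis
    by (simp add: d_endo_def ins_def sum_lessThan_2 ext_d_form[OF z] K[OF z] del: sum.lessThan_Suc)
qed

lemma d_J: "z \<in> U \<Longrightarrow> d_endo tangent_structure \<theta> z [X, Y] =
    D t z (0, fst X) \<bullet> fst Y - D t z (0, fst Y) \<bullet> fst X"
  by (subst d_endo_vertical) (simp_all add: tangent_structure_def)

end

section \<open>The generalized Helmholtz conditions in coordinates\<close>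

text \<open>The identity behind the theorem at a single point: \<open>Tx, Ty, T2x, T2y\<close> stand for the
  derivatives of the components of \<open>\<theta>\<close> along \<open>x\<close>, along \<open>y\<close>, and the derivatives of these along
  \<open>S\<close>; \<open>Qx, \<dots>\<close> are the same for \<open>\<sigma>\<close>, and \<open>n\<close>, \<open>m\<close> for \<open>N\<close> and its derivative along \<open>S\<close>.\<close>

lemma Helmholtz_pointwise:
  fixes Tx Ty T2x T2y Qx Qy Q2y n m sx :: "'e::real_inner \<Rightarrow> 'e"
  assumes lin: "linear Tx" "linear Ty" "linear T2x" "linear T2y" "linear Qx" "linear Qy" "linear n"
    and Helmholtz_1: "\<And>e f. Ty e \<bullet> f = Ty f \<bullet> e"
    and Helmholtz_3: "\<And>e f. T2y e \<bullet> f - Ty (n e) \<bullet> f - Ty e \<bullet> n f = (1/2) * (Qy e \<bullet> f + Qy f \<bullet> e)"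
  defines "R \<equiv> \<lambda>e. - m e - sx e - n (n e)"
    and "b \<equiv> \<lambda>e f. (Tx e - Ty (n e)) \<bullet> f - (Tx f - Ty (n f)) \<bullet> e - (1/2) * (Qy e \<bullet> f - Qy f \<bullet> e)"
    and "Sb \<equiv> \<lambda>e f. (T2x e - T2y (n e) - Ty (m e)) \<bullet> f - (T2x f - T2y (n f) - Ty (m f)) \<bullet> e
      - (1/2) * (Q2y e \<bullet> f - Q2y f \<bullet> e)"
    and "\<Xi> \<equiv> \<lambda>X1 X2 Y1 Y2. (T2x X1 + T2y X2) \<bullet> Y1 + (Tx X2 + Ty (sx X1 - 2 *\<^sub>R n X2)) \<bullet> Y1
      + (Tx X1 + Ty X2) \<bullet> Y2 - (Qx X1 + Qy X2) \<bullet> Y1"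
    and "C \<equiv> \<lambda>e f. Q2y e \<bullet> f - Qy (n e) \<bullet> f - Qy e \<bullet> n f"
  shows "\<Xi> X1 X2 Y1 Y2 - \<Xi> Y1 Y2 X1 X2 - (Sb X1 Y1 + b X2 Y1 + b X1 Y2) =
    (1/2) * (C X1 Y1 - C Y1 X1) - ((Qx X1 - Qy (n X1)) \<bullet> Y1 - (Qx Y1 - Qy (n Y1)) \<bullet> X1)
    - (Ty (R X1) \<bullet> Y1 - Ty (R Y1) \<bullet> X1)"
proof -
  note l = linear_add[OF lin(2)] linear_diff[OF lin(2)] linear_neg[OF lin(2)] linear_cmul[OF lin(2)]
  have "Ty (n X1) \<bullet> n Y1 = Ty (n Y1) \<bullet> n X1" "Ty X2 \<bullet> Y2 = Ty Y2 \<bullet> X2"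
    "Ty (n Y2) \<bullet> X1 = Ty X1 \<bullet> n Y2" "Ty (n X2) \<bullet> Y1 = Ty Y1 \<bullet> n X2"
    "Ty Y2 \<bullet> n X1 = Ty (n X1) \<bullet> Y2" "Ty X2 \<bullet> n Y1 = Ty (n Y1) \<bullet> X2"
    by (rule Helmholtz_1)+
  then show ?thesis
    using Helmholtz_3[of X2 Y1] Helmholtz_3[of Y2 X1] Helmholtz_3[of "n X1" Y1] Helmholtz_3[of "n Y1" X1]
    unfolding R_def b_def Sb_def \<Xi>_def C_def
    by (simp add: l inner_add_left inner_diff_left inner_add_right inner_diff_right distrib_left
        right_diff_distrib)
qed

lemma linear_vertical_part: "linear f \<Longrightarrow> linear (\<lambda>e. f (0, e))"
  using linear_add[of f "(0, x)" "(0, y)" for x y] linear_cmul[of f r "(0, x)" for r x]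
  by (intro linearI) simp_all

lemma linear_horizontal_part: "linear f \<Longrightarrow> linear (\<lambda>e. f (e, 0))"
  using linear_add[of f "(x, 0)" "(y, 0)" for x y] linear_cmul[of f r "(x, 0)" for r x]
  by (intro linearI) simp_all

lemma linear_split: "linear f \<Longrightarrow> f (x, y) = f (x, 0) + f (0, y)"
  using linear_add[of f "(x, 0)" "(0, y)"] by simp

context spray_chart
begin

text \<open>The direction \<open>v\<close> stays fixed while the derivative is taken along
  \<open>S\<close>; second derivatives of \<open>t\<close> enter the conditions only in this
  form.\<close>

definition S_D :: "('e \<times> 'e \<Rightarrow> 'e) \<Rightarrow> 'e \<times> 'e \<Rightarrow> 'e \<times> 'e \<Rightarrow> 'e" where
  "S_D t z v = D (\<lambda>x. D t x v) z (S z)"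

lemma linear_S_D: "smooth_on U t \<Longrightarrow> z \<in> U \<Longrightarrow> linear (S_D t z)"
  using D_D_linear_dir[OF open_U] by (simp add: S_D_def[abs_def])

text \<open>For \<open>t\<close> the fibre gradient of a Lagrangian this is the symmetry of its
  Hessian.\<close>

definition Helmholtz_1 :: "('e \<times> 'e \<Rightarrow> 'e) \<Rightarrow> 'e \<times> 'e \<Rightarrow> bool" where
  "Helmholtz_1 t z \<longleftrightarrow> (\<forall>e f. D t z (0, e) \<bullet> f = D t z (0, f) \<bullet> e)"

text \<open>The components of \<open>\<nabla>(\<partial>t/\<partial>y)\<close>.\<close>

definition cov_deriv :: "('e \<times> 'e \<Rightarrow> 'e) \<Rightarrow> 'e \<times> 'e \<Rightarrow> 'e \<Rightarrow> 'e \<Rightarrow> real" where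
  "cov_deriv t z e f = S_D t z (0, e) \<bullet> f - D t z (0, N z e) \<bullet> f - D t z (0, e) \<bullet> N z f"

definition Helmholtz_2 :: "('e \<times> 'e \<Rightarrow> 'e) \<Rightarrow> ('e \<times> 'e \<Rightarrow> 'e) \<Rightarrow> 'e \<times> 'e \<Rightarrow> bool" where
  "Helmholtz_2 t q z \<longleftrightarrow> (\<forall>e f. D t z (0, R z e) \<bullet> f - D t z (0, R z f) \<bullet> e =
     (1/2) * (cov_deriv q z e f - cov_deriv q z f e)
     - (D q z (e, - N z e) \<bullet> f - D q z (f, - N z f) \<bullet> e))"

definition Helmholtz_3 :: "('e \<times> 'e \<Rightarrow> 'e) \<Rightarrow> ('e \<times> 'e \<Rightarrow> 'e) \<Rightarrow> 'e \<times> 'e \<Rightarrow> bool" where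
  "Helmholtz_3 t q z \<longleftrightarrow> (\<forall>e f. cov_deriv t z e f = (1/2) * (D q z (0, e) \<bullet> f + D q z (0, f) \<bullet> e))"

context
  fixes t :: "'e \<times> 'e \<Rightarrow> 'e" and \<theta> :: "('e \<times> 'e) form"
  assumes \<theta>: "semibasic_in_chart U t \<theta>"
begin

interpretation t: semibasic_in_chart U t \<theta> by (rule \<theta>)

lemma d_ver: "z \<in> U \<Longrightarrow> d_endo (ver_proj S) \<theta> z [X, Y] =
    D t z (0, snd X + N z (fst X)) \<bullet> fst Y - D t z (0, snd Y + N z (fst Y)) \<bullet> fst X"
  by (subst t.d_endo_vertical) (simp_all add: ver_proj_eq)

lemma d_Jacobi: "z \<in> U \<Longrightarrow> d_endo (Jacobi_endo S) \<theta> z [X, Y] =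
    D t z (0, R z (fst X)) \<bullet> fst Y - D t z (0, R z (fst Y)) \<bullet> fst X"
  by (subst t.d_endo_vertical) (simp_all add: Jacobi_eq)

lemma d_hor: "z \<in> U \<Longrightarrow> d_endo (hor_proj S) \<theta> z [X, Y] =
    D t z (fst X, - N z (fst X)) \<bullet> fst Y - D t z (fst Y, - N z (fst Y)) \<bullet> fst X"
  by (subst t.d_endo_horizontal) (simp_all add: hor_proj_eq)

lemma dyn_deriv_d_J:
  assumes z: "z \<in> U"
  shows "dyn_deriv S (d_endo tangent_structure \<theta>) z [X, Y] =
    cov_deriv t z (fst X) (fst Y) - cov_deriv t z (fst Y) (fst X)"
proof -
  let ?b = "\<lambda>z X Y. D t z (0, fst X) \<bullet> fst Y - D t z (0, fst Y) \<bullet> fst X"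
  note l = linear_vertical_part[OF t.linear_Dt[OF z]]
  have lb: "linear (\<lambda>X. ?b z X Y)" "linear (\<lambda>X. ?b z Y X)" for Y
    by (auto intro!: linearI simp: linear_add[OF l] linear_cmul[OF l] inner_add_left inner_add_right
        right_diff_distrib)
  have d: "((\<lambda>z. D t z v) has_derivative D (\<lambda>z. D t z v) z) (at z)" for v
    by (rule smooth_on_has_derivative[OF smooth_on_D[OF t.smooth_t] z])
  have "D (\<lambda>z. ?b z X Y) z = (\<lambda>v. D (\<lambda>z. D t z (0, fst X)) z v \<bullet> fst Y
      - D (\<lambda>z. D t z (0, fst Y)) z v \<bullet> fst X)"
    by (rule D_eqI, intro has_derivative_diff has_derivative_inner_left d)
  then have "D (\<lambda>z. ?b z X Y) z (S z) = S_D t z (0, fst X) \<bullet> fst Y - S_D t z (0, fst Y) \<bullet> fst X"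
    by (simp add: S_D_def)
  then show ?thesis
    by (subst dyn_deriv_2[where b = ?b, OF z t.d_J lb]) (simp_all add: cov_deriv_def linear_neg[OF l])
qed

text \<open>Differentiating \<open>N\<close> inside the vertical arguments produces
  \<open>S_N\<close> terms, which cancel those of \<open>dyn_deriv_2\<close>. This reflects that the
  dynamical covariant derivative of the vertical projector is zero, so that only the matrix of fibre
  derivatives is differentiated.\<close>

lemma dyn_deriv_d_ver:
  assumes z: "z \<in> U"
  shows "dyn_deriv S (d_endo (ver_proj S) \<theta>) z [X, Y] =
    cov_deriv t z (snd X + N z (fst X)) (fst Y) - cov_deriv t z (snd Y + N z (fst Y)) (fst X)"
proof -
  let ?b = "\<lambda>z X Y. D t z (0, snd X + N z (fst X)) \<bullet> fst Y - D t z (0, snd Y + N z (fst Y)) \<bullet> fst X"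
  note l = linear_vertical_part[OF t.linear_Dt[OF z]] and n = linear_N[OF z]
  note ladd = linear_add[OF l] linear_neg[OF l] linear_diff[OF l] linear_add[OF n]
    linear_neg[OF n] linear_diff[OF n]
  have lb: "linear (\<lambda>X. ?b z X Y)" "linear (\<lambda>X. ?b z Y X)" for Y
    by (auto intro!: linearI simp: ladd linear_cmul[OF l] linear_cmul[OF n]
        inner_add_left inner_add_right right_diff_distrib distrib_left)
  have d: "((\<lambda>z. D t z (0, snd X + N z (fst X))) has_derivative
      (\<lambda>v. D (\<lambda>x. D t x (0, snd X + N z (fst X))) z v + D t z (0, D (\<lambda>x. N x (fst X)) z v))) (at z)" for X
  proof (rule D_field_has_derivative[OF open_U t.smooth_t _ z])
    have "((\<lambda>z. snd X + N z (fst X)) has_derivative (\<lambda>v. 0 + D (\<lambda>x. N x (fst X)) z v)) (at z)"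
      by (intro has_derivative_add has_derivative_const smooth_on_has_derivative[OF smooth_N z])
    then show "((\<lambda>z. (0, snd X + N z (fst X))) has_derivative (\<lambda>v. (0, D (\<lambda>x. N x (fst X)) z v))) (at z)"
      by (intro has_derivative_Pair has_derivative_const) simp
  qed
  have "D (\<lambda>z. ?b z X Y) z = (\<lambda>v. (D (\<lambda>x. D t x (0, snd X + N z (fst X))) z v
        + D t z (0, D (\<lambda>x. N x (fst X)) z v)) \<bullet> fst Y
      - (D (\<lambda>x. D t x (0, snd Y + N z (fst Y))) z v + D t z (0, D (\<lambda>x. N x (fst Y)) z v)) \<bullet> fst X)"
    by (rule D_eqI, intro has_derivative_diff has_derivative_inner_left d)
  then have "D (\<lambda>z. ?b z X Y) z (S z) =
      (S_D t z (0, snd X + N z (fst X)) + D t z (0, S_N z (fst X))) \<bullet> fst Y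
      - (S_D t z (0, snd Y + N z (fst Y)) + D t z (0, S_N z (fst Y))) \<bullet> fst X"
    by (simp add: S_D_def S_N_def)
  then show ?thesis
    by (subst dyn_deriv_2[where b = ?b, OF z d_ver lb])
      (simp_all add: cov_deriv_def ladd inner_add_left inner_diff_left inner_add_right)
qed

lemma GH1_iff:
  assumes "z \<in> U"
  shows "(\<forall>X Y. d_endo tangent_structure \<theta> z [X, Y] = 0) \<longleftrightarrow> Helmholtz_1 t z"
  using assms unfolding Helmholtz_1_def by (auto simp: t.d_J dest: spec[of _ "(_, 0)"])

end

context
  fixes t q :: "'e \<times> 'e \<Rightarrow> 'e" and \<theta> \<sigma> :: "('e \<times> 'e) form"
  assumes \<theta>: "semibasic_in_chart U t \<theta>" and \<sigma>: "semibasic_in_chart U q \<sigma>"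
begin

interpretation t: semibasic_in_chart U t \<theta> by (rule \<theta>)
interpretation q: semibasic_in_chart U q \<sigma> by (rule \<sigma>)

lemma GH2_iff:
  assumes "z \<in> U"
  shows "(\<forall>X Y. d_endo (Jacobi_endo S) \<theta> z [X, Y] =
      1/2 * dyn_deriv S (d_endo tangent_structure \<sigma>) z [X, Y] - d_endo (hor_proj S) \<sigma> z [X, Y])
    \<longleftrightarrow> Helmholtz_2 t q z"
  unfolding Helmholtz_2_def d_Jacobi[OF \<theta> assms] dyn_deriv_d_J[OF \<sigma> assms] d_hor[OF \<sigma> assms]
  by (metis fst_conv)

lemma ins_complex_d_J:
  assumes "z \<in> U"
  shows "ins (\<lambda>z w. complex_structure S z w + tangent_structure z w) (d_endo tangent_structure \<sigma>) z [X, Y] =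
    D q z (0, snd X + N z (fst X)) \<bullet> fst Y - D q z (0, fst Y) \<bullet> (snd X + N z (fst X)) +
    (D q z (0, fst X) \<bullet> (snd Y + N z (fst Y)) - D q z (0, snd Y + N z (fst Y)) \<bullet> fst X)"
  by (simp add: ins_def sum_lessThan_2 q.d_J[OF assms] complex_plus_J_eq[OF assms] del: sum.lessThan_Suc)

text \<open>Both sides are antisymmetrised, yet nothing is lost: the slots of \<open>?P\<close>
  receive the vertical part of one vector and the horizontal part of the other, which are
  independent. With \<open>X\<close> vertical and \<open>Y = (f, 0)\<close> the second term is
  \<open>?P\<close> with second argument 0 and vanishes.\<close>

lemma GH3_iff:
  assumes z: "z \<in> U"
  shows "(\<forall>X Y. dyn_deriv S (d_endo (ver_proj S) \<theta>) z [X, Y] =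
      d_endo (ver_proj S) \<sigma> z [X, Y]
      - 1/2 * ins (\<lambda>z w. complex_structure S z w + tangent_structure z w)
          (d_endo tangent_structure \<sigma>) z [X, Y]) \<longleftrightarrow> Helmholtz_3 t q z"
    (is "(\<forall>X Y. ?l X Y) \<longleftrightarrow> _")
proof -
  let ?P = "\<lambda>e f. cov_deriv t z e f - (1/2) * (D q z (0, e) \<bullet> f + D q z (0, f) \<bullet> e)"
  have l: "?l X Y \<longleftrightarrow> ?P (snd X + N z (fst X)) (fst Y) = ?P (snd Y + N z (fst Y)) (fst X)" for X Y
    unfolding dyn_deriv_d_ver[OF \<theta> z] d_ver[OF \<sigma> z] ins_complex_d_J[OF z]
    by (auto simp: algebra_simps)
  have "linear (\<lambda>e. S_D t z (0, e))" "linear (\<lambda>e. D t z (0, e))" "linear (\<lambda>e. D q z (0, e))"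
    by (intro linear_vertical_part linear_S_D[OF t.smooth_t z] t.linear_Dt[OF z] q.linear_Dt[OF z])+
  from this[THEN linear_0] have P0: "?P e 0 = 0" for e
    by (simp add: cov_deriv_def linear_0[OF linear_N[OF z]])
  show ?thesis
  proof
    assume *: "\<forall>X Y. ?l X Y"
    have "?P e f = 0" for e f
      using *[rule_format, of "(0, e)" "(f, 0)"] unfolding l
      by (simp only: fst_conv snd_conv P0 linear_0[OF linear_N[OF z]] add_0_right)
    then show "Helmholtz_3 t q z" by (simp add: Helmholtz_3_def)
  next
    assume "Helmholtz_3 t q z"
    then have P: "?P e f = 0" for e f by (simp add: Helmholtz_3_def)
    show "\<forall>X Y. ?l X Y" unfolding l P by blast
  qed
qed

end

end

section \<open>The Euler-Lagrange one-form, its exterior derivative and the defect\<close>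

context spray_chart
begin

text \<open>The bracket of \<open>S\<close> with a constant field has horizontal part
  \<open>- snd X\<close>; the term it contributes cancels the vertical part of \<open>dL\<close>, so
  the result is semi-basic.\<close>

lemma Lagrange_diff_eq:
  assumes L: "smooth_on U L" and z: "z \<in> U"
  shows "Lagrange_diff S L z [X] = D (\<lambda>x. D L x (0, fst X)) z (S z) - D L z (fst X, 0)"
proof -
  have *: "d_endo tangent_structure (\<lambda>z _. L z) x [w] = D L x (0, fst w)" for x w
    by (simp add: d_endo_def ins_def ext_d_def tangent_structure_def)
  have "D L z X = D L z (fst X, 0) + D L z (0, snd X)"
    using linear_split[OF smooth_on_D_linear[OF L z], of "fst X" "snd X"] by simp
  then show ?thesis
    using linear_neg[OF smooth_on_D_linear[OF L z], of "(0, snd X)"]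
    by (simp add: Lagrange_diff_def lie_form_def * lie_bracket_const[OF z])
      (simp add: ext_d_def)
qed

context
  fixes t q :: "'e \<times> 'e \<Rightarrow> 'e"
  assumes smooth_t: "smooth_on U t" and smooth_q: "smooth_on U q"
begin

text \<open>The one-form \<open>L\<^sub>S\<theta> - \<sigma>\<close>, whose primitives are the Lagrangians \<open>L\<close> with
  \<open>d\<^sub>J L = \<theta>\<close> and \<open>\<delta>\<^sub>S L = \<sigma>\<close>.\<close>

definition EL :: "'e \<times> 'e \<Rightarrow> 'e \<times> 'e \<Rightarrow> real" where
  "EL z X = D t z (S z) \<bullet> fst X + t z \<bullet> snd X - q z \<bullet> fst X"

definition dEL :: "'e \<times> 'e \<Rightarrow> 'e \<times> 'e \<Rightarrow> 'e \<times> 'e \<Rightarrow> real" where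
  "dEL z X Y = D (\<lambda>z. EL z Y) z X - D (\<lambda>z. EL z X) z Y"

text \<open>The components of the two-form \<open>d\<^sub>h\<theta> - \<onehalf> d\<^sub>J\<sigma>\<close>.\<close>

definition defect :: "'e \<times> 'e \<Rightarrow> 'e \<Rightarrow> 'e \<Rightarrow> real" where
  "defect z e f = (D t z (e, 0) - D t z (0, N z e)) \<bullet> f - (D t z (f, 0) - D t z (0, N z f)) \<bullet> e
     - (1/2) * (D q z (0, e) \<bullet> f - D q z (0, f) \<bullet> e)"

text \<open>The Lie derivative of \<open>defect\<close> along \<open>S\<close>.\<close>

definition Lie_defect :: "'e \<times> 'e \<Rightarrow> 'e \<times> 'e \<Rightarrow> 'e \<times> 'e \<Rightarrow> real" where
  "Lie_defect z X Y = D (\<lambda>z. defect z (fst X) (fst Y)) z (S z)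
     + defect z (snd X) (fst Y) + defect z (fst X) (snd Y)"

lemma linear_EL: "linear (EL z)"
  by (auto intro!: linearI simp: EL_def algebra_simps inner_add_right)

lemma smooth_EL: "smooth_on U (\<lambda>z. EL z X)"
  unfolding EL_def
  by (intro smooth_on_diff smooth_on_add smooth_on_inner smooth_on_D_field smooth_on_const
      smooth_t smooth_q smooth_S open_U)

lemma smooth_defect: "smooth_on U (\<lambda>z. defect z e f)"
  unfolding defect_def
  by (intro smooth_on_diff smooth_on_inner smooth_on_mult smooth_on_D_field[OF open_U smooth_t]
      smooth_on_D smooth_on_const smooth_on_Pair smooth_N smooth_t smooth_q open_U)

lemma defect_alt: "defect z e f = - defect z f e"
  by (simp add: defect_def right_diff_distrib)

lemma linear_defect:
  assumes z: "z \<in> U"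
  shows "linear (defect z e)"
proof -
  note l = linear_horizontal_part[OF smooth_on_D_linear[OF smooth_t z]]
    linear_vertical_part[OF smooth_on_D_linear[OF smooth_t z]]
    linear_vertical_part[OF smooth_on_D_linear[OF smooth_q z]] linear_N[OF z]
  note l[THEN linear_add] l[THEN linear_cmul]
  then show ?thesis
    unfolding defect_def
    by (intro linearI) (simp_all add: inner_add_right inner_add_left inner_diff_left algebra_simps
        add_divide_distrib)
qed

text \<open>Differentiating \<open>D t z (S z)\<close> along \<open>X\<close> gives a second
  derivative along \<open>S z\<close> and \<open>X\<close>; symmetry turns it into
  \<open>S_D t z X\<close>.\<close>

lemma D_EL:
  assumes z: "z \<in> U"
  shows "D (\<lambda>z. EL z Y) z X =
    (S_D t z X + D t z (snd X, D s z X)) \<bullet> fst Y + D t z X \<bullet> snd Y - D q z X \<bullet> fst Y"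
proof -
  have d: "((\<lambda>z. D t z (S z)) has_derivative (\<lambda>v. D (\<lambda>x. D t x (S z)) z v + D t z (D S z v))) (at z)"
    by (rule D_field_has_derivative[OF open_U smooth_t smooth_on_has_derivative[OF smooth_S z] z])
  have "((\<lambda>z. EL z Y) has_derivative (\<lambda>X.
      (D (\<lambda>x. D t x (S z)) z X + D t z (D S z X)) \<bullet> fst Y + D t z X \<bullet> snd Y - D q z X \<bullet> fst Y)) (at z)"
    unfolding EL_def
    by (intro has_derivative_diff has_derivative_add has_derivative_inner_left d
        smooth_on_has_derivative[OF smooth_t z] smooth_on_has_derivative[OF smooth_q z])
  from D_eqI[OF this] show ?thesis
    by (simp add: D_S[OF z] S_D_def symmetric_second_derivative[OF open_U z smooth_t, of "S z"])
qed

lemma D_defect: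
  assumes z: "z \<in> U"
  shows "D (\<lambda>z. defect z e f) z (S z) =
    (S_D t z (e, 0) - S_D t z (0, N z e) - D t z (0, S_N z e)) \<bullet> f
    - (S_D t z (f, 0) - S_D t z (0, N z f) - D t z (0, S_N z f)) \<bullet> e
    - (1/2) * (S_D q z (0, e) \<bullet> f - S_D q z (0, f) \<bullet> e)"
proof -
  have d: "((\<lambda>z. D t z (0, N z e)) has_derivative
      (\<lambda>v. D (\<lambda>x. D t x (0, N z e)) z v + D t z (0, D (\<lambda>x. N x e) z v))) (at z)" for e
    by (intro D_field_has_derivative[OF open_U smooth_t _ z] has_derivative_Pair has_derivative_const
        smooth_on_has_derivative[OF smooth_N z])
  have "((\<lambda>z. defect z e f) has_derivative (\<lambda>v.
     (D (\<lambda>z. D t z (e, 0)) z v - (D (\<lambda>x. D t x (0, N z e)) z v + D t z (0, D (\<lambda>x. N x e) z v))) \<bullet> f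
   - (D (\<lambda>z. D t z (f, 0)) z v - (D (\<lambda>x. D t x (0, N z f)) z v + D t z (0, D (\<lambda>x. N x f) z v))) \<bullet> e
   - (1/2) * (D (\<lambda>z. D q z (0, e)) z v \<bullet> f - D (\<lambda>z. D q z (0, f)) z v \<bullet> e))) (at z)"
    unfolding defect_def
    by (intro has_derivative_diff has_derivative_inner_left has_derivative_mult_right d
        smooth_on_has_derivative[OF smooth_on_D[OF smooth_t] z]
        smooth_on_has_derivative[OF smooth_on_D[OF smooth_q] z])
  from D_eqI[OF this] show ?thesis by (simp add: S_D_def S_N_def flip: diff_diff_eq)
qed

text \<open>The right-hand side is the residual of \<open>Helmholtz_2\<close>. Under the other two
  conditions \<open>Helmholtz_2\<close> thus amounts to \<open>dEL = Lie_defect\<close>, which both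
  directions of the theorem use. The identity is \<open>Helmholtz_pointwise\<close> after splitting
  all derivatives into horizontal and vertical parts.\<close>

lemma dEL_minus_Lie_defect:
  assumes z: "z \<in> U" and "Helmholtz_1 t z" "Helmholtz_3 t q z"
  shows "dEL z X Y - Lie_defect z X Y =
    (1/2) * (cov_deriv q z (fst X) (fst Y) - cov_deriv q z (fst Y) (fst X))
    - (D q z (fst X, - N z (fst X)) \<bullet> fst Y - D q z (fst Y, - N z (fst Y)) \<bullet> fst X)
    - (D t z (0, R z (fst X)) \<bullet> fst Y - D t z (0, R z (fst Y)) \<bullet> fst X)"
proof -
  note lt = smooth_on_D_linear[OF smooth_t z] and lq = smooth_on_D_linear[OF smooth_q z]
    and lTS = linear_S_D[OF smooth_t z]
  have t: "D t z (x, y) = D t z (x, 0) + D t z (0, y)" for x y by (rule linear_split[OF lt])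
  have q: "D q z (x, y) = D q z (x, 0) + D q z (0, y)" for x y by (rule linear_split[OF lq])
  have T: "S_D t z (x, y) = S_D t z (x, 0) + S_D t z (0, y)" for x y by (rule linear_split[OF lTS])
  have sx: "D s z (x, y) = D s z (x, 0) - 2 *\<^sub>R N z y" for x y
    using linear_split[OF linear_Ds[OF z], of x y] by (simp add: Ds_vert)
  have h1: "D t z (0, e) \<bullet> f = D t z (0, f) \<bullet> e" for e f
    using assms(2) by (simp add: Helmholtz_1_def)
  have h3: "S_D t z (0, e) \<bullet> f - D t z (0, N z e) \<bullet> f - D t z (0, e) \<bullet> N z f =
      (1/2) * (D q z (0, e) \<bullet> f + D q z (0, f) \<bullet> e)" for e f
    using assms(3) by (simp add: Helmholtz_3_def cov_deriv_def)
  note key0 = Helmholtz_pointwise[where Tx = "\<lambda>e. D t z (e, 0)" and Ty = "\<lambda>e. D t z (0, e)"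
      and T2x = "\<lambda>e. S_D t z (e, 0)" and T2y = "\<lambda>e. S_D t z (0, e)"
      and Qx = "\<lambda>e. D q z (e, 0)" and Qy = "\<lambda>e. D q z (0, e)" and n = "N z" and m = "S_N z"
      and sx = "\<lambda>e. D s z (e, 0)" and Q2y = "\<lambda>e. S_D q z (0, e)" and ?X1.0 = "fst X" and ?X2.0 = "snd X"
      and ?Y1.0 = "fst Y" and ?Y2.0 = "snd Y",
      OF linear_horizontal_part[OF lt] linear_vertical_part[OF lt] linear_horizontal_part[OF lTS]
      linear_vertical_part[OF lTS] linear_horizontal_part[OF lq] linear_vertical_part[OF lq]
      linear_N[OF z] h1 h3]
  have key: "(S_D t z (fst X, 0) + S_D t z (0, snd X)) \<bullet> fst Y
      + (D t z (snd X, 0) + D t z (0, D s z (fst X, 0) - 2 *\<^sub>R N z (snd X))) \<bullet> fst Y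
      + (D t z (fst X, 0) + D t z (0, snd X)) \<bullet> snd Y - (D q z (fst X, 0) + D q z (0, snd X)) \<bullet> fst Y
      - ((S_D t z (fst Y, 0) + S_D t z (0, snd Y)) \<bullet> fst X
      + (D t z (snd Y, 0) + D t z (0, D s z (fst Y, 0) - 2 *\<^sub>R N z (snd Y))) \<bullet> fst X
      + (D t z (fst Y, 0) + D t z (0, snd Y)) \<bullet> snd X - (D q z (fst Y, 0) + D q z (0, snd Y)) \<bullet> fst X)
      - Lie_defect z X Y =
    (1/2) * (cov_deriv q z (fst X) (fst Y) - cov_deriv q z (fst Y) (fst X))
    - ((D q z (fst X, 0) - D q z (0, N z (fst X))) \<bullet> fst Y - (D q z (fst Y, 0) - D q z (0, N z (fst
        Y))) \<bullet> fst X)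
    - (D t z (0, R z (fst X)) \<bullet> fst Y - D t z (0, R z (fst Y)) \<bullet> fst X)"
    unfolding Lie_defect_def D_defect[OF z] unfolding cov_deriv_def R_def defect_def by (rule key0)
  have X: "D t z X = D t z (fst X, 0) + D t z (0, snd X)" "S_D t z X = S_D t z (fst X, 0) + S_D t z
      (0, snd X)"
    "D q z X = D q z (fst X, 0) + D q z (0, snd X)" "D s z X = D s z (fst X, 0) - 2 *\<^sub>R N z (snd X)" for X
    using t[of "fst X" "snd X"] T[of "fst X" "snd X"] q[of "fst X" "snd X"] sx[of "fst X" "snd X"]
    unfolding prod.collapse by -
  have q': "D q z (e, - N z e) = D q z (e, 0) - D q z (0, N z e)" for e
    using q[of e "- N z e"] linear_neg[OF linear_vertical_part[OF lq]] by simp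
  have t': "D t z (snd X, D s z X) = D t z (snd X, 0) + D t z (0, D s z (fst X, 0) - 2 *\<^sub>R N z (snd
      X))" for X
    using t[of "snd X" "D s z X"] X(4)[of X] by simp
  show ?thesis
    unfolding dEL_def D_EL[OF z] t' q' X(1-3)[of X] X(1-3)[of Y] using key
    unfolding inner_add_left by linarith
qed

text \<open>One vertical argument \<open>(0, a)\<close> against one horizontal argument
  \<open>(f, 0)\<close> carries all the information. Of the two equations obtained by exchanging
  \<open>a\<close> and \<open>f\<close>, the difference gives the defect and the sum gives
  \<open>Helmholtz_3\<close>.\<close>

lemma dEL_mixed:
  assumes z: "z \<in> U" and closed: "\<And>X Y. dEL z X Y = 0"
    and Helmholtz_1: "\<And>z. z \<in> U \<Longrightarrow> Helmholtz_1 t z"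
  shows "defect z e f = 0" "Helmholtz_3 t q z"
proof -
  note lt = smooth_on_D_linear[OF smooth_t z]
  have h: "D t z (0, e) \<bullet> f = D t z (0, f) \<bullet> e" for e f using Helmholtz_1[OF z] by (simp add:
      Helmholtz_1_def)
  \<comment> \<open>\<open>Helmholtz_1\<close> holds on a neighbourhood, so it may be differentiated
    along \<open>S\<close>.\<close>
  have S_D: "S_D t z (0, e) \<bullet> f = S_D t z (0, f) \<bullet> e" for e f
  proof -
    have i: "D (\<lambda>x. D t x v \<bullet> c) z w = D (\<lambda>x. D t x v) z w \<bullet> c" for v w c
      by (rule D_inner[OF smooth_on_differentiable[OF smooth_on_D[OF smooth_t] z]])
    have eq: "D (\<lambda>x. D t x (0, e) \<bullet> f) z = D (\<lambda>x. D t x (0, f) \<bullet> e) z"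
      by (rule D_cong_open[OF open_U z]) (use Helmholtz_1 in \<open>simp add: Helmholtz_1_def\<close>)
    show ?thesis by (simp only: S_D_def i[symmetric] eq)
  qed
  have Q: "D q z 0 = 0" "D t z 0 = 0"
    by (rule linear_0[OF smooth_on_D_linear[OF smooth_q z]], rule linear_0[OF lt])
  have *: "S_D t z (0, a) \<bullet> f + D t z (a, 0) \<bullet> f - 2 * (D t z (0, N z a) \<bullet> f)
      - D q z (0, a) \<bullet> f - D t z (f, 0) \<bullet> a = 0" for a f
    using closed[of "(0, a)" "(f, 0)"] linear_split[OF lt, of a "- (2 *\<^sub>R N z a)"]
      linear_neg[OF linear_vertical_part[OF lt], of "2 *\<^sub>R N z a"]
      linear_cmul[OF linear_vertical_part[OF lt], of 2 "N z a"]
    by (simp add: dEL_def D_EL[OF z] Ds_vert inner_add_left inner_diff_left)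
  show "defect z e f = 0"
    using *[of e f] *[of f e] S_D[of e f]
    by (simp add: defect_def inner_diff_left)
  have "cov_deriv t z e f = (1/2) * (D q z (0, e) \<bullet> f + D q z (0, f) \<bullet> e)" for e f
    using *[of e f] *[of f e] S_D[of e f] h[of "N z f" e]
    by (simp add: cov_deriv_def)
  then show "Helmholtz_3 t q z" by (simp add: Helmholtz_3_def)
qed

text \<open>A defect that vanishes on all of \<open>U\<close> has vanishing Lie derivative, so
  \<open>dEL_minus_Lie_defect\<close> leaves only the residual of
  \<open>Helmholtz_2\<close>.\<close>

lemma Helmholtz_2_of_closed:
  assumes z: "z \<in> U" and closed: "\<And>z X Y. z \<in> U \<Longrightarrow> dEL z X Y = 0"
    and Helmholtz_1: "\<And>z. z \<in> U \<Longrightarrow> Helmholtz_1 t z"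
  shows "Helmholtz_2 t q z"
proof -
  have b: "defect z e f = 0" if "z \<in> U" for z e f
    using dEL_mixed(1)[OF that closed[OF that] Helmholtz_1] by simp
  have "D (\<lambda>z. defect z e f) z = D (\<lambda>z. 0) z" for e f
    by (rule D_cong_open[OF open_U z]) (rule b)
  then have "Lie_defect z X Y = 0" for X Y by (simp add: Lie_defect_def b[OF z])
  with dEL_minus_Lie_defect[OF z Helmholtz_1[OF z] dEL_mixed(2)[OF z closed[OF z] Helmholtz_1], of
      "(e, 0)" "(f, 0)" for e f]
  show ?thesis by (simp add: Helmholtz_2_def closed[OF z])
qed

text \<open>\<open>Lie_defect\<close> is exact, so the Lie derivative of \<open>d defect\<close> vanishes. Its components with two
  and one vertical arguments show that \<open>defect\<close> depends on \<open>x\<close> only and is closed.\<close>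

lemma
  assumes Lie: "\<And>z X Y. z \<in> U \<Longrightarrow> dEL z X Y = Lie_defect z X Y"
  shows defect_basic: "\<And>z. z \<in> U \<Longrightarrow> D (\<lambda>z. defect z e f) z (0, a) = 0"
    and defect_closed: "\<And>z. z \<in> U \<Longrightarrow> D (\<lambda>z. defect z e f) z (a, 0) + D (\<lambda>z. defect z f a) z (e, 0)
      + D (\<lambda>z. defect z a e) z (f, 0) = 0"
proof -
  note alt = defect_alt
  \<comment> \<open>\<open>Lie_defect\<close> equals the exterior derivative of \<open>EL\<close>;
    this is its closedness on constant vector fields.\<close>
  have cyc: "D (\<lambda>z. Lie_defect z Y Z) z X + D (\<lambda>z. Lie_defect z Z X) z Y + D (\<lambda>z. Lie_defect z X Y) z Z = 0"
    if z: "z \<in> U" for z X Y Z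
  proof -
    have "D (\<lambda>z. Lie_defect z Y Z) z = D (\<lambda>z. dEL z Y Z) z" for Y Z
      by (rule D_cong_open[OF open_U z]) (simp add: Lie)
    moreover have "D (\<lambda>z. dEL z Y Z) z = (\<lambda>X. D (\<lambda>z. D (\<lambda>z. EL z Z) z Y) z X - D (\<lambda>z. D (\<lambda>z. EL z Y)
        z Z) z X)" for Y Z
      unfolding dEL_def
      by (rule D_eqI, intro has_derivative_diff smooth_on_has_derivative[OF smooth_on_D[OF smooth_EL] z])
    moreover note symmetric_second_derivative[OF open_U z smooth_EL]
    ultimately show ?thesis by simp
  qed
  have b0: "defect z e 0 = 0" "defect z 0 e = 0" if "z \<in> U" for z e
    using linear_0[OF linear_defect[OF that]] alt[of z 0 e] by simp_all
  have D0: "D (\<lambda>z. defect z e 0) z = (\<lambda>_. 0)" "D (\<lambda>z. defect z 0 e) z = (\<lambda>_. 0)" if "z \<in> U" for z e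
    using D_cong_open[OF open_U that, of "\<lambda>z. defect z e 0" "\<lambda>_. 0"]
      D_cong_open[OF open_U that, of "\<lambda>z. defect z 0 e" "\<lambda>_. 0"] b0 by simp_all
  have Dalt: "D (\<lambda>z. defect z e f) z v = - D (\<lambda>z. defect z f e) z v" if z: "z \<in> U" for z e f v
    by (subst alt, subst D_eqI[OF has_derivative_minus[OF smooth_on_has_derivative[OF smooth_defect
        z]]]) simp
  \<comment> \<open>Two vertical arguments and one horizontal: \<open>Lie_defect\<close> vanishes on
    a vertical pair, and on a mixed pair its derivative along \<open>S\<close> drops out and a
    single value of \<open>defect\<close> remains.\<close>
  have vv: "D (\<lambda>z. defect z e f) z (0, a) = D (\<lambda>z. defect z a f) z (0, e)" if z: "z \<in> U" for z a e f
  proof -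
    have "D (\<lambda>z. Lie_defect z (0, e) (f, 0)) z = D (\<lambda>z. defect z e f) z" for e
      by (rule D_cong_open[OF open_U z]) (simp add: Lie_defect_def D0 b0)
    moreover have "D (\<lambda>z. Lie_defect z (f, 0) (0, e)) z = D (\<lambda>z. defect z f e) z" for e
      by (rule D_cong_open[OF open_U z]) (simp add: Lie_defect_def D0 b0)
    moreover have "D (\<lambda>z. Lie_defect z (0, a) (0, e)) z = D (\<lambda>z. 0) z"
      by (rule D_cong_open[OF open_U z]) (simp add: Lie_defect_def D0 b0)
    ultimately show ?thesis
      using cyc[OF z, of "(0, e)" "(f, 0)" "(0, a)"] Dalt[OF z, of f a "(0, e)"] by simp
  qed
  \<comment> \<open>The derivative of \<open>defect z e f\<close> along \<open>(0, a)\<close> is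
    symmetric in \<open>a\<close> and \<open>e\<close> by \<open>vv\<close> and antisymmetric in
    \<open>e\<close> and \<open>f\<close>; both symmetries together force it to be zero.\<close>
  show basic: "D (\<lambda>z. defect z e f) z (0, a) = 0" if z: "z \<in> U" for z a e f
    using vv[OF z, of e f a] Dalt[OF z, of a f "(0, e)"] vv[OF z, of f a e] Dalt[OF z, of e a "(0, f)"]
      vv[OF z, of a e f] Dalt[OF z, of f e "(0, a)"] by simp
  show "D (\<lambda>z. defect z e f) z (a, 0) + D (\<lambda>z. defect z f a) z (e, 0) + D (\<lambda>z. defect z a e) z (f, 0) = 0"
    if z: "z \<in> U" for z
  proof -
    \<comment> \<open>The vertical derivative also hits \<open>S\<close>: since
      \<open>D S z (0, a)\<close> has horizontal part \<open>a\<close>, it yields the horizontal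
      derivative of \<open>defect\<close> along \<open>a\<close>, while the second-order term
      vanishes by \<open>basic\<close>.\<close>
    have "D (\<lambda>z. Lie_defect z (e, 0) (f, 0)) z (0, a) = D (\<lambda>z. D (\<lambda>z. defect z e f) z (S z)) z (0, a)"
      by (subst D_cong_open[OF open_U z]) (simp_all add: Lie_defect_def b0)
    also have "\<dots> = D (\<lambda>x. D (\<lambda>z. defect z e f) x (S z)) z (0, a) + D (\<lambda>z. defect z e f) z (D S z (0, a))"
      by (subst D_eqI[OF D_field_has_derivative[OF open_U smooth_defect
            smooth_on_has_derivative[OF smooth_S z] z]]) simp
    also have "D (\<lambda>x. D (\<lambda>z. defect z e f) x (S z)) z (0, a) = D (\<lambda>x. D (\<lambda>z. defect z e f) x (0, a))
        z (S z)"
      by (rule symmetric_second_derivative[OF open_U z smooth_defect])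
    also have "D (\<lambda>x. D (\<lambda>z. defect z e f) x (0, a)) z = D (\<lambda>x. 0) z"
      by (rule D_cong_open[OF open_U z]) (rule basic)
    also have "D (\<lambda>z. defect z e f) z (D S z (0, a)) = D (\<lambda>z. defect z e f) z (a, 0)"
      unfolding D_S[OF z] snd_conv
      by (subst linear_split[OF smooth_on_D_linear[OF smooth_defect z]]) (simp add: basic[OF z])
    finally have 1: "D (\<lambda>z. Lie_defect z (e, 0) (f, 0)) z (0, a) = D (\<lambda>z. defect z e f) z (a, 0)" by simp
    have "D (\<lambda>z. Lie_defect z (f, 0) (0, a)) z = D (\<lambda>z. defect z f a) z"
      "D (\<lambda>z. Lie_defect z (0, a) (e, 0)) z = D (\<lambda>z. defect z a e) z"
      by (rule D_cong_open[OF open_U z], simp add: Lie_defect_def D0 b0)+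
    with 1 cyc[OF z, of "(0, a)" "(e, 0)" "(f, 0)"] show ?thesis by simp
  qed
qed

end

end

section \<open>Both directions of the theorem in one chart\<close>

context spray_chart
begin

text \<open>If \<open>t\<close> is the fibre gradient of \<open>L\<close>, the equation for
  \<open>Lagrange_diff\<close> says that \<open>EL\<close> is \<open>dL\<close>, which is closed by
  symmetry of second derivatives.\<close>

lemma Helmholtz_of_Lagrangian:
  assumes L: "smooth_on U L" and t: "smooth_on U t" and q: "smooth_on U q"
    and tL: "\<And>z e. z \<in> U \<Longrightarrow> t z \<bullet> e = D L z (0, e)"
    and EL: "\<And>z X. z \<in> U \<Longrightarrow> Lagrange_diff S L z [X] = q z \<bullet> fst X"
    and z: "z \<in> U"
  shows "Helmholtz_1 t z" "Helmholtz_2 t q z" "Helmholtz_3 t q z"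
proof -
  have Dt: "D t z v \<bullet> e = D (\<lambda>x. D L x (0, e)) z v" if "z \<in> U" for z v e
  proof -
    have "D (\<lambda>x. t x \<bullet> e) z = D (\<lambda>x. D L x (0, e)) z" by (rule D_cong_open[OF open_U that tL])
    then show ?thesis by (simp flip: D_inner[OF smooth_on_differentiable[OF t that]])
  qed
  have EL_eq: "EL t q z X = D L z X" if "z \<in> U" for z X
    using EL[OF that, of X] linear_split[OF smooth_on_D_linear[OF L that], of "fst X" "snd X"]
    by (simp add: EL_def[OF t q] Dt[OF that] tL[OF that] Lagrange_diff_eq[OF L that])
  have closed: "dEL t q z X Y = 0" if "z \<in> U" for z X Y
  proof -
    have "D (\<lambda>z. EL t q z X) z = D (\<lambda>z. D L z X) z" for X
      by (rule D_cong_open[OF open_U that EL_eq])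
    then show ?thesis
      by (simp add: dEL_def[OF t q] symmetric_second_derivative[OF open_U that L, of X])
  qed
  have Helmholtz_1: "Helmholtz_1 t z" if "z \<in> U" for z
    unfolding Helmholtz_1_def Dt[OF that] using symmetric_second_derivative[OF open_U that L] by blast
  show "Helmholtz_1 t z" by (rule Helmholtz_1[OF z])
  show "Helmholtz_3 t q z" by (rule dEL_mixed(2)[OF t q z closed[OF z] Helmholtz_1])
  show "Helmholtz_2 t q z" by (rule Helmholtz_2_of_closed[OF t q z closed Helmholtz_1])
qed

lemma dEL_eq_Lie_defect:
  assumes t: "smooth_on U t" and q: "smooth_on U q" and z: "z \<in> U"
    and H: "Helmholtz_1 t z" "Helmholtz_2 t q z" "Helmholtz_3 t q z"
  shows "dEL t q z X Y = Lie_defect t q z X Y"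
  using dEL_minus_Lie_defect[OF t q z H(1,3), of X Y] H(2) unfolding Helmholtz_2_def by simp

text \<open>The last conclusion takes the place of \<open>d_J L = \<theta>\<close>, which may fail:
  \<open>L\<close> belongs to the corrected form, which has the same fibre derivatives. It is what
  transfers non-triviality from \<open>\<theta>\<close> to \<open>L\<close>.\<close>

lemma Lagrangian_of_Helmholtz:
  assumes t: "smooth_on U t" and q: "smooth_on U q"
    and H: "\<And>z. z \<in> U \<Longrightarrow> Helmholtz_1 t z" "\<And>z. z \<in> U \<Longrightarrow> Helmholtz_2 t q z" "\<And>z. z \<in> U \<Longrightarrow> Helmholtz_3 t q z"
    and U: "convex U" "z0 \<in> U"
  obtains L where "smooth_on U L"
    "\<And>z X. z \<in> U \<Longrightarrow> Lagrange_diff S L z [X] = q z \<bullet> fst X"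
    "\<And>z e a. z \<in> U \<Longrightarrow> D (\<lambda>x. D L x (0, e)) z (0, a) = D t z (0, a) \<bullet> e"
proof -
  interpret star: star_center U z0 by unfold_locales (fact open_U U)+
  note Lie = dEL_eq_Lie_defect[OF t q _ H]
  \<comment> \<open>The defect as a two-form on the total space, blind to vertical components, so
    that \<open>Poincare_2\<close> applies.\<close>
  define B where "B z v w = defect t q z (fst v) (fst w)" for z and v w :: "'e \<times> 'e"
  have DB: "D (\<lambda>z. B z v w) z u = D (\<lambda>z. defect t q z (fst v) (fst w)) z (fst u, 0)" if "z \<in> U" for z u v w
    using linear_split[OF smooth_on_D_linear[OF smooth_defect[OF t q] that], of "fst v" "fst w" "fst
        u" "snd u"]
      defect_basic[OF t q Lie that] by (simp add: B_def)
  have "linear (B z v)" if "z \<in> U" for z v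
    using linear_compose[OF linear_fst linear_defect[OF t q that, of "fst v"]]
    by (simp add: B_def[abs_def] o_def)
  moreover have "B z v w = - B z w v" for z v w unfolding B_def by (rule defect_alt[OF t q])
  moreover have "smooth_on U (\<lambda>z. B z v w)" for v w unfolding B_def by (rule smooth_defect[OF t q])
  moreover have "D (\<lambda>z. B z v w) z u + D (\<lambda>z. B z w u) z v + D (\<lambda>z. B z u v) z w = 0"
    if "z \<in> U" for z u v w
    unfolding DB[OF that] by (rule defect_closed[OF t q Lie that])
  ultimately obtain \<beta> where \<beta>: "\<And>v. smooth_on U (\<lambda>z. \<beta> z v)" "\<And>z. z \<in> U \<Longrightarrow> linear (\<beta> z)"
    "\<And>z v w. z \<in> U \<Longrightarrow> D (\<lambda>z. \<beta> z w) z v - D (\<lambda>z. \<beta> z v) z w = B z v w"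
    "\<And>z w. z \<in> U \<Longrightarrow> (\<And>z v. z \<in> U \<Longrightarrow> B z v w = 0) \<Longrightarrow> \<beta> z w = 0"
    by (rule star.Poincare_2[of B]) blast+
  have \<beta>0: "\<beta> z (0, a) = 0" if "z \<in> U" for z a
    by (rule \<beta>(4)[OF that]) (simp add: B_def linear_0[OF linear_defect[OF t q]])
  \<comment> \<open>Because \<open>\<beta>\<close> is zero on vertical vectors,
    \<open>d \<beta>\<close> on a vertical and a horizontal vector is just the fibre derivative of a
    component of \<open>\<beta>\<close>; there it equals \<open>B\<close>, which is zero.\<close>
  have \<beta>y: "D (\<lambda>z. \<beta> z (f, 0)) z (0, a) = 0" if z: "z \<in> U" for z f a
  proof -
    have "D (\<lambda>z. \<beta> z (0, a)) z = D (\<lambda>z. 0) z" by (rule D_cong_open[OF open_U z \<beta>0])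
    moreover have "B z (0, a) w = 0" for w
      using defect_alt[OF t q, of z 0 "fst w"] linear_0[OF linear_defect[OF t q z]] by (simp add: B_def)
    ultimately show ?thesis using \<beta>(3)[OF z, of "(f, 0)" "(0, a)"] by simp
  qed
  define r where "r z = (\<Sum>b\<in>Basis. \<beta> z (b, 0) *\<^sub>R b)" for z
  have r: "smooth_on U r"
    unfolding r_def by (intro smooth_on_sum smooth_on_scaleR smooth_on_const \<beta> open_U finite_Basis)
  have r_inner: "r z \<bullet> f = \<beta> z (f, 0)" if "z \<in> U" for z f
    using linear_functional_expansion[OF linear_horizontal_part[OF \<beta>(2)[OF that]], of f]
    by (simp add: r_def inner_sum_right inner_commute[of _ f] mult.commute)
  have Dr: "D r z v \<bullet> f = D (\<lambda>z. \<beta> z (f, 0)) z v" if "z \<in> U" for z v f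
  proof -
    have "D (\<lambda>x. r x \<bullet> f) z = D (\<lambda>z. \<beta> z (f, 0)) z" by (rule D_cong_open[OF open_U that r_inner])
    then show ?thesis by (simp flip: D_inner[OF smooth_on_differentiable[OF r that]])
  qed
  have ry: "D r z (0, a) = 0" if "z \<in> U" for z a
    using Dr[OF that, of "(0, a)" "D r z (0, a)"] \<beta>y[OF that] by simp
  define t' where "t' z = t z - r z" for z
  have t': "smooth_on U t'" unfolding t'_def by (intro smooth_on_diff open_U t r)
  have Dt': "D t' z v = D t z v - D r z v" if "z \<in> U" for z v
    unfolding t'_def
    by (subst D_eqI[OF has_derivative_diff[OF smooth_on_has_derivative[OF t that]
          smooth_on_has_derivative[OF r that]]]) simp
  have Dt'y: "D t' z (0, a) = D t z (0, a)" if "z \<in> U" for z a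
    using Dt'[OF that] ry[OF that] by simp
  have S_D: "S_D t' z (0, a) = S_D t z (0, a)" if "z \<in> U" for z a
    unfolding S_D_def by (subst D_cong_open[OF open_U that Dt'y]) simp_all
  have H': "Helmholtz_1 t' z" "Helmholtz_2 t' q z" "Helmholtz_3 t' q z" if "z \<in> U" for z
    using H[OF that] by (simp_all add: Helmholtz_1_def Helmholtz_2_def Helmholtz_3_def cov_deriv_def
        S_D Dt'y that)
  \<comment> \<open>As \<open>r\<close> is independent of the fibre coordinate, it contributes only
    \<open>d \<beta>\<close> to the defect, and that is the whole defect of
    \<open>t\<close>.\<close>
  have defect': "defect t' q z e f = 0" if "z \<in> U" for z e f
    using \<beta>(3)[OF that, of "(f, 0)" "(e, 0)"]
    by (simp add: defect_def[OF t' q] defect_def[OF t q] Dt'[OF that] Dr[OF that] B_def \<beta>y[OF that]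
        inner_add_left inner_diff_left field_simps)
  have closed: "dEL t' q z X Y = 0" if "z \<in> U" for z X Y
  proof -
    have "D (\<lambda>z. defect t' q z e f) z = D (\<lambda>z. 0) z" for e f
      by (rule D_cong_open[OF open_U that defect'])
    then show ?thesis
      by (simp add: dEL_eq_Lie_defect[OF t' q that H'[OF that]] Lie_defect_def[OF t' q] defect'[OF that])
  qed
  obtain L where L: "smooth_on U L" "\<And>z v. z \<in> U \<Longrightarrow> D L z v = EL t' q z v"
  proof (rule star.Poincare_1[of "EL t' q"])
    show "D (\<lambda>z. EL t' q z v) z w = D (\<lambda>z. EL t' q z w) z v" if "z \<in> U" for z v w
      using closed[OF that, of w v] by (simp add: dEL_def[OF t' q])
  qed (use linear_EL[OF t' q] smooth_EL[OF t' q] in auto)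
  have Ly: "D L z (0, e) = t' z \<bullet> e" if "z \<in> U" for z e
    using L(2)[OF that] by (simp add: EL_def[OF t' q])
  have DLy: "D (\<lambda>x. D L x (0, e)) z v = D t' z v \<bullet> e" if "z \<in> U" for z e v
    by (subst D_cong_open[OF open_U that Ly])
      (simp_all add: D_inner[OF smooth_on_differentiable[OF t' that]])
  show thesis
  proof
    show "smooth_on U L" by (fact L(1))
    show "Lagrange_diff S L z [X] = q z \<bullet> fst X" if "z \<in> U" for z X
      by (simp add: Lagrange_diff_eq[OF L(1) that] DLy[OF that] L(2)[OF that] EL_def[OF t' q])
    show "D (\<lambda>x. D L x (0, e)) z (0, a) = D t z (0, a) \<bullet> e" if "z \<in> U" for z e a
      by (simp add: DLy[OF that] Dt'y[OF that])
  qed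
qed

end

section \<open>Atlases and the tangent bundle\<close>

text \<open>Only properties of the charts are kept, so that the locale applies to \<open>A\<close>
  and equally to its tangent atlas, for which no topology is given.\<close>

locale smooth_atlas =
  fixes A :: "('p, 'e::euclidean_space) chart set"
  assumes inj_chart: "c \<in> A \<Longrightarrow> inj_on (snd c) (fst c)"
    and open_overlap: "c \<in> A \<Longrightarrow> c' \<in> A \<Longrightarrow> open (chart_image c (fst c'))"
    and smooth_transition: "c \<in> A \<Longrightarrow> c' \<in> A \<Longrightarrow> smooth_on (chart_image c (fst c')) (transition c c')"
begin

lemma chart_inv_chart: "c \<in> A \<Longrightarrow> p \<in> fst c \<Longrightarrow> chart_inv c (snd c p) = p"
  by (simp add: chart_inv_def inj_chart)

lemma chart_image_mono: "W \<subseteq> W' \<Longrightarrow> chart_image c W \<subseteq> chart_image c W'"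
  by (auto simp: chart_image_def)

lemma transition_chart: "c \<in> A \<Longrightarrow> p \<in> fst c \<Longrightarrow> transition c c' (snd c p) = snd c' p"
  by (simp add: transition_def chart_inv_chart)

lemma chart_in_overlap: "p \<in> fst c \<Longrightarrow> p \<in> fst c' \<Longrightarrow> snd c p \<in> chart_image c (fst c')"
  by (auto simp: chart_image_def)

lemma overlapE:
  assumes "z \<in> chart_image c W"
  obtains p where "p \<in> fst c" "p \<in> W" "z = snd c p"
  using assms by (auto simp: chart_image_def)

lemma transition_in: "c \<in> A \<Longrightarrow> z \<in> chart_image c (fst c') \<Longrightarrow> transition c c' z \<in> chart_image c' (fst c)"
  by (auto simp: transition_chart elim!: overlapE intro: chart_in_overlap)

lemma transition_has_derivative:
  "c \<in> A \<Longrightarrow> c' \<in> A \<Longrightarrow> p \<in> fst c \<Longrightarrow> p \<in> fst c' \<Longrightarrow>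
    (transition c c' has_derivative D (transition c c') (snd c p)) (at (snd c p))"
  by (intro smooth_on_has_derivative[OF smooth_transition] chart_in_overlap)

lemma open_image: "c \<in> A \<Longrightarrow> open (snd c ` fst c)"
  using open_overlap[of c c] by (simp add: chart_image_def)

text \<open>The cocycle property, from the chain rule; it makes the family of components in
  \<open>tvec_of\<close> consistent.\<close>

lemma D_transition_trans:
  assumes c: "c \<in> A" "c' \<in> A" "c'' \<in> A" and p: "p \<in> fst c" "p \<in> fst c'" "p \<in> fst c''"
  shows "D (transition c' c'') (snd c' p) (D (transition c c') (snd c p) w) = D (transition c c'')
      (snd c p) w"
proof -
  have "((\<lambda>x. transition c' c'' (transition c c' x)) has_derivative
      (\<lambda>w. D (transition c' c'') (snd c' p) (D (transition c c') (snd c p) w))) (at (snd c p))"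
    using has_derivative_compose[OF transition_has_derivative[OF c(1,2) p(1,2)], of "transition c' c''"]
      transition_has_derivative[OF c(2,3) p(2,3)] transition_chart[OF c(1) p(1), of c'] by simp
  moreover have "transition c' c'' (transition c c' x) = transition c c'' x"
    if "x \<in> chart_image c (fst c')" for x
    using that c by (auto simp: transition_chart elim: overlapE)
  ultimately have "(transition c c'' has_derivative
      (\<lambda>w. D (transition c' c'') (snd c' p) (D (transition c c') (snd c p) w))) (at (snd c p))"
    using has_derivative_transform_within_open[OF _ open_overlap[OF c(1,2)] chart_in_overlap[OF p(1,2)]]
    by blast
  from D_eqI[OF this] show ?thesis by simp
qed

lemma D_transition_refl:
  assumes c: "c \<in> A" and p: "p \<in> fst c"
  shows "D (transition c c) (snd c p) w = w"
proof -
  have "D (transition c c) (snd c p) = D (\<lambda>x. x) (snd c p)"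
    by (rule D_cong_open[OF open_overlap[OF c c] chart_in_overlap[OF p p]])
      (auto simp: transition_chart[OF c] elim: overlapE)
  then show ?thesis by simp
qed

lemma linear_D_transition:
  "c \<in> A \<Longrightarrow> c' \<in> A \<Longrightarrow> p \<in> fst c \<Longrightarrow> p \<in> fst c' \<Longrightarrow> linear (D (transition c c') (snd c p))"
  by (rule smooth_on_D_linear[OF smooth_transition chart_in_overlap])

lemma tangent_change:
  "v \<in> tangent_space A p \<Longrightarrow> c \<in> charts_at A p \<Longrightarrow> c' \<in> charts_at A p \<Longrightarrow>
    v c' = D (transition c c') (snd c p) (v c)"
  unfolding tangent_space_def by blast

lemma tangent_space_outside: "v \<in> tangent_space A p \<Longrightarrow> c \<notin> charts_at A p \<Longrightarrow> v c = 0"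
  unfolding tangent_space_def by blast

lemma tvec_of_in_tangent_space:
  assumes "c \<in> charts_at A p"
  shows "tvec_of A c p w \<in> tangent_space A p"
  unfolding tangent_space_def
proof (intro CollectI conjI ballI allI impI)
  fix c' c'' assume "c' \<in> charts_at A p" "c'' \<in> charts_at A p"
  with assms show "tvec_of A c p w c'' = D (transition c' c'') (snd c' p) (tvec_of A c p w c')"
    by (simp add: tvec_of_def charts_at_def D_transition_trans)
qed (simp add: tvec_of_def)

lemma tvec_of_component: "c \<in> charts_at A p \<Longrightarrow> tvec_of A c p w c = w"
  by (simp add: tvec_of_def charts_at_def D_transition_refl)

text \<open>The convention that components outside \<open>charts_at A p\<close> are zero makes this
  an equality of functions, not merely of components around \<open>p\<close>.\<close>

lemma tvec_of_tangent: "c \<in> charts_at A p \<Longrightarrow> v \<in> tangent_space A p \<Longrightarrow> tvec_of A c p (v c) = v"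
  by (rule ext) (auto simp: tvec_of_def tangent_change[symmetric] tangent_space_outside)

lemma tvec_of_change:
  "c \<in> charts_at A p \<Longrightarrow> c' \<in> charts_at A p \<Longrightarrow>
    tvec_of A c' p (D (transition c c') (snd c p) w) = tvec_of A c p w"
  using tvec_of_tangent[OF _ tvec_of_in_tangent_space, of c' p c w]
  by (simp only: fun_cong[OF tvec_of_def[of A c p w]] if_True)

lemma tvec_of_linear:
  assumes c: "c \<in> charts_at A p"
  shows "tvec_of A c p (a *\<^sub>R v + b *\<^sub>R w) = (\<lambda>c'. a *\<^sub>R tvec_of A c p v c' + b *\<^sub>R tvec_of A c p w c')"
proof (rule ext)
  fix c' show "tvec_of A c p (a *\<^sub>R v + b *\<^sub>R w) c' = a *\<^sub>R tvec_of A c p v c' + b *\<^sub>R tvec_of A c p w c'"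
    using linear_D_transition[of c c' p] c
    by (simp add: tvec_of_def charts_at_def linear_add linear_cmul)
qed

lemma atlas_open_pullback:
  assumes c: "c \<in> A" and V: "open V" "V \<subseteq> snd c ` fst c"
  shows "atlas_open A {p \<in> fst c. snd c p \<in> V}"
proof -
  have "open (chart_image c' {p \<in> fst c. snd c p \<in> V})" if c': "c' \<in> A" for c'
  proof -
    have "chart_image c' {p \<in> fst c. snd c p \<in> V} = chart_image c' (fst c) \<inter> transition c' c -` V"
      by (auto simp: chart_image_def transition_chart[OF c'])
    then show ?thesis
      using continuous_open_preimage[OF smooth_on_continuous[OF smooth_transition[OF c' c]]
          open_overlap[OF c' c] V(1)] by simp
  qed
  then show ?thesis using c by (auto simp: atlas_open_def)
qed

lemma chart_image_Un: "chart_image c (W \<union> W') = chart_image c W \<union> chart_image c W'"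
  by (auto simp: chart_image_def)

lemma chart_image_Int: "c \<in> A \<Longrightarrow> chart_image c (W \<inter> W') = chart_image c W \<inter> chart_image c W'"
  using inj_chart[of c] by (auto simp: chart_image_def inj_on_def)

lemma atlas_open_Un: "atlas_open A W \<Longrightarrow> atlas_open A W' \<Longrightarrow> atlas_open A (W \<union> W')"
  by (auto simp: atlas_open_def chart_image_Un)

lemma atlas_open_Int: "atlas_open A W \<Longrightarrow> atlas_open A W' \<Longrightarrow> atlas_open A (W \<inter> W')"
  by (auto simp: atlas_open_def chart_image_Int)

lemma fun_rep_change:
  "c \<in> A \<Longrightarrow> c' \<in> A \<Longrightarrow> z \<in> chart_image c (fst c') \<Longrightarrow> fun_rep c f z = fun_rep c' f (transition c c' z)"
  by (auto simp: fun_rep_def transition_chart chart_inv_chart elim!: overlapE)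

end

lemma open_chart_image_openin:
  assumes "smooth_manifold M A" "c \<in> A" "openin M W"
  shows "open (chart_image c W)"
proof -
  have c: "openin M (fst c)" "open (snd c ` fst c)"
    "homeomorphic_map (subtopology M (fst c)) (top_of_set (snd c ` fst c)) (snd c)"
    using assms by (auto simp: smooth_manifold_def is_chart_def)
  then have "openin (top_of_set (snd c ` fst c)) (snd c ` (W \<inter> fst c))"
    using homeomorphic_imp_open_map[OF c(3)] openin_subtopology_Int[OF assms(3)]
    unfolding open_map_def by blast
  then show ?thesis using c(2) openin_open_trans by (auto simp: chart_image_def)
qed

lemma smooth_manifold_atlas:
  assumes "smooth_manifold M A"
  shows "smooth_atlas A"
proof
  fix c c' assume c: "c \<in> A" "c' \<in> A"
  then show "smooth_on (chart_image c (fst c')) (transition c c')"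
    using assms by (auto simp: smooth_manifold_def)
  from c have "openin M (fst c')" using assms by (auto simp: smooth_manifold_def is_chart_def)
  with open_chart_image_openin[OF assms c(1)] show "open (chart_image c (fst c'))" .
next
  fix c assume "c \<in> A"
  then have "is_chart M c" using assms by (auto simp: smooth_manifold_def)
  then have c: "openin M (fst c)"
    and "homeomorphic_map (subtopology M (fst c)) (top_of_set (snd c ` fst c)) (snd c)"
    by (auto simp: is_chart_def)
  from homeomorphic_imp_injective_map[OF this(2)] have "inj_on (snd c) (topspace M \<inter> fst c)"
    by (simp add: topspace_subtopology)
  moreover have "topspace M \<inter> fst c = fst c" using openin_subset[OF c] by blast
  ultimately show "inj_on (snd c) (fst c)" by simp
qed

section \<open>Induced charts on the tangent bundle\<close>

context smooth_atlas
begin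

lemma fst_induced_chart: "fst (induced_chart A c) = (SIGMA p:fst c. tangent_space A p)"
  by (simp add: induced_chart_def)

lemma snd_induced_chart: "snd (induced_chart A c) u = (snd c (fst u), snd u c)"
  by (simp add: induced_chart_def split_beta)

text \<open>Every fibre coordinate is attained, namely by a vector \<open>tvec_of\<close>, so the
  image is a full cylinder.\<close>

lemma chart_image_induced:
  assumes c: "c \<in> A"
  shows "chart_image (induced_chart A c) (SIGMA p:W. tangent_space A p) = chart_image c W \<times> UNIV"
proof -
  have "(x, y) \<in> snd (induced_chart A c) ` ((SIGMA p:W. tangent_space A p) \<inter> fst (induced_chart A c))"
    if "x \<in> chart_image c W" for x y
  proof -
    from that obtain p where p: "p \<in> fst c" "p \<in> W" "x = snd c p" by (rule overlapE)
    then have cp: "c \<in> charts_at A p" using c by (simp add: charts_at_def)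
    show ?thesis
      using p tvec_of_in_tangent_space[OF cp, of y] tvec_of_component[OF cp, of y]
      by (intro image_eqI[of _ _ "(p, tvec_of A c p y)"]) (auto simp: fst_induced_chart snd_induced_chart)
  qed
  moreover have "chart_image (induced_chart A c) (SIGMA p:W. tangent_space A p) \<subseteq> chart_image c W \<times> UNIV"
    by (auto simp: chart_image_def fst_induced_chart snd_induced_chart)
  ultimately show ?thesis unfolding chart_image_def by auto
qed

lemma inj_induced_chart:
  assumes c: "c \<in> A"
  shows "inj_on (snd (induced_chart A c)) (fst (induced_chart A c))"
proof (rule inj_onI)
  fix u u' assume u: "u \<in> fst (induced_chart A c)" "u' \<in> fst (induced_chart A c)"
    and eq: "snd (induced_chart A c) u = snd (induced_chart A c) u'"
  then have p: "fst u = fst u'" and v: "snd u c = snd u' c"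
    using inj_chart[OF c] by (auto simp: fst_induced_chart snd_induced_chart inj_on_def)
  have "c \<in> charts_at A (fst u)" using u c by (auto simp: fst_induced_chart charts_at_def)
  from tvec_of_tangent[OF this] have "snd u = snd u'"
    using u p v by (auto simp: fst_induced_chart) (metis)
  with p show "u = u'" by (simp add: prod_eq_iff)
qed

lemma transition_induced:
  assumes c: "c \<in> A" "c' \<in> A" and z: "z \<in> chart_image c (fst c') \<times> UNIV"
  shows "transition (induced_chart A c) (induced_chart A c') z =
    (transition c c' (fst z), D (transition c c') (fst z) (snd z))"
proof -
  have "z \<in> chart_image (induced_chart A c) (SIGMA p:fst c'. tangent_space A p)"
    using z chart_image_induced[OF c(1)] by blast
  then obtain u where u: "u \<in> fst (induced_chart A c)" "fst u \<in> fst c'" "z = snd (induced_chart A c) u"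
    by (auto simp: chart_image_def)
  have t: "transition (induced_chart A c) (induced_chart A c') z = snd (induced_chart A c') u"
    using u inj_induced_chart[OF c(1)] by (simp add: transition_def chart_inv_def)
  have "snd u \<in> tangent_space A (fst u)" "fst u \<in> fst c" using u by (auto simp: fst_induced_chart)
  then have "snd u c' = D (transition c c') (snd c (fst u)) (snd u c)"
    using u c by (intro tangent_change) (auto simp: charts_at_def)
  then show ?thesis
    using t u(3) transition_chart[OF c(1) \<open>fst u \<in> fst c\<close>, of c'] by (simp add: snd_induced_chart)
qed

text \<open>With the base transition written as a function \<open>F\<close> of \<open>(x, y)\<close>
  that ignores \<open>y\<close>, the fibre part of the induced transition is the derivative of
  \<open>F\<close> along the field \<open>(snd z, 0)\<close>, so \<open>smooth_on_D_field\<close>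
  gives its smoothness.\<close>

lemma
  assumes c: "c \<in> A" "c' \<in> A"
  defines "F \<equiv> \<lambda>z::'e \<times> 'e. transition c c' (fst z)" and "\<Omega> \<equiv> chart_image c (fst c') \<times> UNIV"
  shows base_transition_smooth: "smooth_on \<Omega> F"
    and base_transition_D: "\<And>z w. z \<in> \<Omega> \<Longrightarrow> D F z w = D (transition c c') (fst z) (fst w)"
    and base_transition_induced: "\<And>z. z \<in> \<Omega> \<Longrightarrow>
      transition (induced_chart A c) (induced_chart A c') z = (F z, D F z (snd z, 0))"
    and base_transition_open: "open \<Omega>"
proof -
  show op: "open \<Omega>" unfolding \<Omega>_def by (intro open_Times open_overlap c open_UNIV)
  show "smooth_on \<Omega> F"
    unfolding F_def
    by (rule smooth_on_compose[OF op _ smooth_transition[OF c] smooth_on_fst[OF op smooth_on_id]])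
      (auto simp: \<Omega>_def)
  show *: "D F z w = D (transition c c') (fst z) (fst w)" if "z \<in> \<Omega>" for z w
    unfolding F_def
    by (subst D_eqI[OF has_derivative_compose[OF has_derivative_fst[OF has_derivative_ident]
            smooth_on_has_derivative[OF smooth_transition[OF c]]]])
      (use that in \<open>auto simp: \<Omega>_def\<close>)
  show "transition (induced_chart A c) (induced_chart A c') z = (F z, D F z (snd z, 0))" if "z \<in> \<Omega>" for z
    using transition_induced[OF c, of z] *[OF that] that by (simp add: F_def \<Omega>_def)
qed

lemma smooth_atlas_tangent: "smooth_atlas (tangent_atlas A)"
proof
  fix C C' assume "C \<in> tangent_atlas A" "C' \<in> tangent_atlas A"
  then obtain c c' where c: "c \<in> A" "c' \<in> A" and C: "C = induced_chart A c" "C' = induced_chart A c'"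
    by (auto simp: tangent_atlas_def)
  let ?\<Omega> = "chart_image c (fst c') \<times> (UNIV :: 'e set)"
  have im: "chart_image C (fst C') = ?\<Omega>"
    unfolding C fst_induced_chart[of c'] by (rule chart_image_induced[OF c(1)])
  note op = base_transition_open[OF c]
  show "open (chart_image C (fst C'))" unfolding im by (rule op)
  show "smooth_on (chart_image C (fst C')) (transition C C')"
    unfolding im
  proof (rule smooth_on_cong[OF op])
    let ?F = "\<lambda>z. transition c c' (fst z)"
    show "smooth_on ?\<Omega> (\<lambda>z. (?F z, D ?F z (snd z, 0)))"
      by (intro smooth_on_Pair smooth_on_D_field op base_transition_smooth[OF c] smooth_on_snd
          smooth_on_id smooth_on_const)
    show "(?F z, D ?F z (snd z, 0)) = transition C C' z" if "z \<in> ?\<Omega>" for z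
      unfolding C by (rule base_transition_induced[OF c that, symmetric])
  qed
next
  fix C assume "C \<in> tangent_atlas A"
  then show "inj_on (snd C) (fst C)" using inj_induced_chart by (auto simp: tangent_atlas_def)
qed

end

section \<open>Naturality of the Lagrange differential under changes of induced coordinates\<close>

locale tangent_transition =
  src: spray_chart \<Omega> S s + tgt: spray_chart \<Omega>' S' s'
  for \<Omega> :: "('e::euclidean_space \<times> 'e) set" and S s and \<Omega>' :: "('e \<times> 'e) set" and S' s' +
  fixes \<phi> :: "'e \<times> 'e \<Rightarrow> 'e \<times> 'e" and F :: "'e \<times> 'e \<Rightarrow> 'e"
  assumes smooth_F: "smooth_on \<Omega> F" and F_basic: "\<And>z a. z \<in> \<Omega> \<Longrightarrow> D F z (0, a) = 0"
    and \<phi>_eq: "\<And>z. z \<in> \<Omega> \<Longrightarrow> \<phi> z = (F z, D F z (snd z, 0))"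
    and \<phi>_in: "\<And>z. z \<in> \<Omega> \<Longrightarrow> \<phi> z \<in> \<Omega>'"
    and S_\<phi>: "\<And>z. z \<in> \<Omega> \<Longrightarrow> S' (\<phi> z) = D \<phi> z (S z)"
begin

lemma smooth_\<phi>: "smooth_on \<Omega> \<phi>"
proof (rule smooth_on_cong[OF src.open_U \<phi>_eq[symmetric]])
  show "smooth_on \<Omega> (\<lambda>z. (F z, D F z (snd z, 0)))"
    by (intro smooth_on_Pair smooth_on_D_field smooth_F smooth_on_snd smooth_on_id smooth_on_const
        src.open_U)
qed

lemma D_F: assumes "z \<in> \<Omega>" shows "D F z w = D F z (fst w, 0)"
  using linear_split[OF smooth_on_D_linear[OF smooth_F assms], of "fst w" "snd w"] F_basic[OF assms] by simp

lemma D_\<phi>: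
  assumes z: "z \<in> \<Omega>"
  shows "D \<phi> z w = (D F z w, D (\<lambda>x. D F x (snd z, 0)) z w + D F z (snd w, 0))"
proof -
  have "D \<phi> z = D (\<lambda>z. (F z, D F z (snd z, 0))) z" by (rule D_cong_open[OF src.open_U z \<phi>_eq])
  also have "\<dots> = (\<lambda>w. (D F z w, D (\<lambda>x. D F x (snd z, 0)) z w + D F z (snd w, 0)))"
    by (rule D_eqI, intro has_derivative_Pair smooth_on_has_derivative[OF smooth_F z]
        D_field_has_derivative[OF src.open_U smooth_F _ z] has_derivative_snd has_derivative_ident
        has_derivative_const)
  finally show ?thesis by simp
qed

text \<open>The second-derivative term drops because \<open>F\<close> is constant along the fibres.
  Vertical vectors thus transform by the Jacobian of the base map; that is, \<open>D \<phi>\<close>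
  commutes with the tangent structure.\<close>

lemma D_\<phi>_vertical:
  assumes z: "z \<in> \<Omega>"
  shows "D \<phi> z (0, e) = (0, D F z (e, 0))"
proof -
  have "D (\<lambda>x. D F x (0, e)) z = D (\<lambda>x. 0) z" by (rule D_cong_open[OF src.open_U z F_basic])
  then show ?thesis
    using symmetric_second_derivative[OF src.open_U z smooth_F, of "(snd z, 0)" "(0, e)"]
    by (simp add: D_\<phi>[OF z] F_basic[OF z])
qed

lemma smooth_pullback: "smooth_on \<Omega>' L \<Longrightarrow> smooth_on \<Omega> (\<lambda>z. L (\<phi> z))"
  by (rule smooth_on_compose[OF src.open_U \<phi>_in _ smooth_\<phi>])

lemma D_pullback:
  "smooth_on \<Omega>' L \<Longrightarrow> z \<in> \<Omega> \<Longrightarrow> D (\<lambda>z. L (\<phi> z)) z w = D L (\<phi> z) (D \<phi> z w)"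
  by (subst D_eqI[OF has_derivative_compose[OF smooth_on_has_derivative[OF smooth_\<phi>]
        smooth_on_has_derivative[OF _ \<phi>_in]]]) simp_all

text \<open>The derivative along \<open>S\<close> and the one along \<open>x\<close> both produce
  second derivatives of \<open>F\<close> paired with the fibre gradient of \<open>L\<close>. They
  agree because \<open>S\<close> has horizontal part \<open>snd z\<close>, so they cancel in the
  difference.\<close>

lemma Lagrange_diff_natural:
  assumes L: "smooth_on \<Omega>' L" and z: "z \<in> \<Omega>"
  shows "Lagrange_diff S (\<lambda>z. L (\<phi> z)) z [X] = Lagrange_diff S' L (\<phi> z) [D \<phi> z X]"
proof -
  let ?e = "D F z (fst X, 0)"
  have vert: "D (\<lambda>z. L (\<phi> z)) x (0, fst X) = D L (\<phi> x) (0, D F x (fst X, 0))" if "x \<in> \<Omega>" for x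
    by (simp add: D_pullback[OF L that] D_\<phi>_vertical[OF that])
  have "((\<lambda>x. D L (\<phi> x) (0, D F x (fst X, 0))) has_derivative
      (\<lambda>v. D (\<lambda>x. D L x (0, ?e)) (\<phi> z) (D \<phi> z v) + D L (\<phi> z) (0, D (\<lambda>x. D F x (fst X, 0)) z v))) (at z)"
    by (intro D_field_compose_has_derivative[OF tgt.open_U L src.open_U z \<phi>_in] has_derivative_Pair
        has_derivative_const smooth_on_has_derivative[OF smooth_\<phi> z]
        smooth_on_has_derivative[OF smooth_on_D[OF smooth_F] z])
  then have 1: "D (\<lambda>x. D (\<lambda>z. L (\<phi> z)) x (0, fst X)) z (S z) =
      D (\<lambda>x. D L x (0, ?e)) (\<phi> z) (S' (\<phi> z)) + D L (\<phi> z) (0, D (\<lambda>x. D F x (fst X, 0)) z (S z))"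
    by (subst D_cong_open[OF src.open_U z vert]) (simp_all add: D_eqI S_\<phi>[OF z])
  have 2: "D (\<lambda>x. D F x (fst X, 0)) z (S z) = D (\<lambda>x. D F x (snd z, 0)) z (fst X, 0)"
  proof -
    have "D (\<lambda>x. D F x (fst X, 0)) z (S z) = D (\<lambda>x. D F x (S z)) z (fst X, 0)"
      by (rule symmetric_second_derivative[OF src.open_U z smooth_F])
    also have "D (\<lambda>x. D F x (S z)) z = D (\<lambda>x. D F x (fst (S z), 0)) z"
      by (rule D_cong_open[OF src.open_U z D_F])
    finally show ?thesis by (simp add: src.S_eq[OF z])
  qed
  have 3: "D (\<lambda>z. L (\<phi> z)) z (fst X, 0) =
      D L (\<phi> z) (?e, 0) + D L (\<phi> z) (0, D (\<lambda>x. D F x (snd z, 0)) z (fst X, 0))"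
    using linear_split[OF smooth_on_D_linear[OF L \<phi>_in[OF z]], of ?e "D (\<lambda>x. D F x (snd z, 0)) z
        (fst X, 0)"]
      F_basic[OF z, of 0]
    by (simp add: D_pullback[OF L z] D_\<phi>[OF z])
  show ?thesis
    using 1 2 3 D_F[OF z, of X]
    by (simp add: src.Lagrange_diff_eq[OF smooth_pullback[OF L] z] tgt.Lagrange_diff_eq[OF L \<phi>_in[OF z]]
        D_\<phi>[OF z])
qed

end

section \<open>Semisprays with a force on the tangent bundle\<close>

locale forced_semispray =
  fixes A :: "('m, 'e::euclidean_space) chart set"
    and S :: "('m, 'e) tpoint \<Rightarrow> (('m, 'e) tpoint, 'e \<times> 'e) tvec"
    and \<sigma> :: "('m, 'e) tpoint \<Rightarrow> (('m, 'e) tpoint, 'e \<times> 'e) tvec \<Rightarrow> real"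
  assumes atlas: "smooth_atlas A"
    and spray: "semispray A S"
    and force: "semi_basic_form A (tangent_bundle A) \<sigma>"
begin

sublocale base: smooth_atlas A by (rule atlas)
sublocale total: smooth_atlas "tangent_atlas A" by (rule base.smooth_atlas_tangent)

abbreviation TA where "TA \<equiv> tangent_atlas A"

lemma chart_domain: "C \<in> TA \<Longrightarrow> fst C \<subseteq> tangent_bundle A"
  by (auto simp: tangent_atlas_def base.fst_induced_chart tangent_bundle_def)

lemma chart_image_bundle: "C \<in> TA \<Longrightarrow> chart_image C (tangent_bundle A) = snd C ` fst C"
  using chart_domain[of C] by (auto simp: chart_image_def)

lemma chart_image_subset: "chart_image C W \<subseteq> snd C ` fst C"
  by (auto simp: chart_image_def)

lemma atlas_open_subset: "atlas_open TA W \<Longrightarrow> W \<subseteq> tangent_bundle A"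
  unfolding atlas_open_def using chart_domain by blast

lemma open_chart_image: "atlas_open TA W \<Longrightarrow> C \<in> TA \<Longrightarrow> open (chart_image C W)"
  by (simp add: atlas_open_def)

lemma spray_chart:
  assumes C: "C \<in> TA" and U: "open U" "U \<subseteq> snd C ` fst C"
  shows "spray_chart U (field_rep C S) (\<lambda>z. snd (field_rep C S z))"
proof
  have *: "vector_field TA (tangent_bundle A) S"
    "\<And>z. z \<in> snd C ` fst C \<Longrightarrow> tangent_structure z (field_rep C S z) = Liouville z"
    using spray C chart_image_bundle[OF C] by (auto simp: semispray_def)
  then have "smooth_on (snd C ` fst C) (field_rep C S)"
    using C chart_image_bundle[OF C] by (auto simp: vector_field_def)
  then show "smooth_on U (\<lambda>z. snd (field_rep C S z))"
    by (intro smooth_on_snd U smooth_on_subset[OF U(2)])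
  show "field_rep C S z = (snd z, snd (field_rep C S z))" if "z \<in> U" for z
    using *(2)[of z] that U(2) by (auto simp: tangent_structure_def Liouville_def prod_eq_iff)
qed (rule U)

lemma tangent_transition:
  assumes C: "C \<in> TA" "C' \<in> TA" and \<Omega>: "open \<Omega>" "\<Omega> \<subseteq> chart_image C (fst C')"
    and \<Omega>': "open \<Omega>'" "\<Omega>' \<subseteq> snd C' ` fst C'" "\<And>z. z \<in> \<Omega> \<Longrightarrow> transition C C' z \<in> \<Omega>'"
  obtains F where "tangent_transition \<Omega> (field_rep C S) (\<lambda>z. snd (field_rep C S z))
    \<Omega>' (field_rep C' S) (\<lambda>z. snd (field_rep C' S z)) (transition C C') F"
proof -
  obtain c c' where c: "c \<in> A" "c' \<in> A" and CC: "C = induced_chart A c" "C' = induced_chart A c'"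
    using C by (auto simp: tangent_atlas_def)
  let ?F = "\<lambda>z::'e \<times> 'e. transition c c' (fst z)"
  have sub: "\<Omega> \<subseteq> chart_image c (fst c') \<times> UNIV"
    using \<Omega>(2) base.chart_image_induced[OF c(1), of "fst c'"] by (simp add: CC base.fst_induced_chart)
  interpret src: spray_chart \<Omega> "field_rep C S" "\<lambda>z. snd (field_rep C S z)"
    by (rule spray_chart[OF C(1) \<Omega>(1) subset_trans[OF \<Omega>(2) chart_image_subset]])
  interpret tgt: spray_chart \<Omega>' "field_rep C' S" "\<lambda>z. snd (field_rep C' S z)"
    by (rule spray_chart[OF C(2) \<Omega>'(1,2)])
  have "tangent_transition \<Omega> (field_rep C S) (\<lambda>z. snd (field_rep C S z))
    \<Omega>' (field_rep C' S) (\<lambda>z. snd (field_rep C' S z)) (transition C C') ?F"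
  proof
    show "smooth_on \<Omega> ?F" by (rule smooth_on_subset[OF sub base.base_transition_smooth[OF c]])
    fix z assume z: "z \<in> \<Omega>"
    then have z': "z \<in> chart_image c (fst c') \<times> UNIV" using sub by blast
    then have fz: "fst z \<in> chart_image c (fst c')" by auto
    show "D ?F z (0, a) = 0" for a
      using linear_0[OF smooth_on_D_linear[OF base.smooth_transition[OF c] fz]]
      by (simp add: base.base_transition_D[OF c z'])
    show "transition C C' z = (?F z, D ?F z (snd z, 0))"
      unfolding CC by (rule base.base_transition_induced[OF c z'])
    show "transition C C' z \<in> \<Omega>'" by (rule \<Omega>'(3)[OF z])
    obtain u where u: "u \<in> fst C" "u \<in> fst C'" "z = snd C u"
      using z \<Omega>(2) by (blast elim: total.overlapE)
    have "u \<in> tangent_bundle A" using u(1) chart_domain[OF C(1)] by blast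
    then have "S u \<in> tangent_space TA u" using spray by (auto simp: semispray_def vector_field_def)
    then have "S u C' = D (transition C C') (snd C u) (S u C)"
      by (rule total.tangent_change) (simp_all add: charts_at_def u C)
    then show "field_rep C' S (transition C C' z) = D (transition C C') z (field_rep C S z)"
      unfolding u(3) field_rep_def total.transition_chart[OF C(1) u(1)]
        total.chart_inv_chart[OF C(1) u(1)] total.chart_inv_chart[OF C(2) u(2)] .
  qed
  then show thesis by (rule that)
qed

text \<open>\<open>vertical\<close> tests all charts around the point; this allows it to be read off
  from the one chart that defines a vector \<open>tvec_of\<close>.\<close>

lemma transition_vertical:
  assumes C: "C \<in> TA" "C' \<in> TA" and u: "u \<in> fst C" "u \<in> fst C'"
  shows "fst (D (transition C C') (snd C u) (0, a)) = 0"
proof -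
  have "transition C C' z \<in> snd C' ` fst C'" if "z \<in> chart_image C (fst C')" for z
    using subsetD[OF chart_image_subset total.transition_in[OF C(1) that]] .
  then obtain F where "tangent_transition (chart_image C (fst C')) (field_rep C S) (\<lambda>z. snd
      (field_rep C S z))
    (snd C' ` fst C') (field_rep C' S) (\<lambda>z. snd (field_rep C' S z)) (transition C C') F"
    by (rule tangent_transition[OF C total.open_overlap[OF C] subset_refl total.open_image[OF C(2)]
        subset_refl])
  then interpret tangent_transition "chart_image C (fst C')" "field_rep C S" "\<lambda>z. snd (field_rep C S z)"
    "snd C' ` fst C'" "field_rep C' S" "\<lambda>z. snd (field_rep C' S z)" "transition C C'" F .
  show ?thesis using D_\<phi>_vertical[OF total.chart_in_overlap[OF u]] by simp
qed

lemma chart_point: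
  assumes "C \<in> TA" "z \<in> chart_image C W"
  shows "chart_inv C z \<in> W" "chart_inv C z \<in> fst C" "C \<in> charts_at TA (chart_inv C z)" "snd C
      (chart_inv C z) = z"
  using assms by (auto simp: total.chart_inv_chart charts_at_def elim!: total.overlapE)

lemma linear_covector_rep:
  assumes \<alpha>: "one_form TA W \<alpha>" and C: "C \<in> TA" and z: "z \<in> chart_image C W"
  shows "linear (covector_rep TA C \<alpha> z)"
proof -
  note p = chart_point[OF C z]
  have "covector_rep TA C \<alpha> z (a *\<^sub>R v + b *\<^sub>R w) = a * covector_rep TA C \<alpha> z v + b * covector_rep
      TA C \<alpha> z w"
    for a b v w
    using \<alpha> p total.tvec_of_in_tangent_space[OF p(3)]
    by (simp add: covector_rep_def total.tvec_of_linear[OF p(3)] one_form_def)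
  from this[of 1 _ 1] this[of _ _ 0 0] show ?thesis by (intro linearI) simp_all
qed

lemma covector_rep_vertical:
  assumes \<alpha>: "semi_basic_form A W \<alpha>" and C: "C \<in> TA" and z: "z \<in> chart_image C W"
  shows "covector_rep TA C \<alpha> z (0, a) = 0"
proof -
  note p = chart_point[OF C z]
  have "fst (tvec_of TA C (chart_inv C z) (0, a) C') = 0" if "C' \<in> charts_at TA (chart_inv C z)" for C'
    using transition_vertical[OF C _ p(2), of C' a] that by (simp add: tvec_of_def charts_at_def)
  then have "vertical A (chart_inv C z) (tvec_of TA C (chart_inv C z) (0, a))"
    unfolding vertical_def using total.tvec_of_in_tangent_space[OF p(3)] by blast
  with \<alpha> p show ?thesis by (simp add: semi_basic_form_def covector_rep_def)
qed

definition coeff :: "(('m, 'e) tpoint, 'e \<times> 'e) chart \<Rightarrow>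
    (('m, 'e) tpoint \<Rightarrow> (('m, 'e) tpoint, 'e \<times> 'e) tvec \<Rightarrow> real) \<Rightarrow> 'e \<times> 'e \<Rightarrow> 'e" where
  "coeff C \<alpha> z = (\<Sum>b\<in>Basis. covector_rep TA C \<alpha> z (b, 0) *\<^sub>R b)"

lemma coeff_inner:
  assumes \<alpha>: "semi_basic_form A W \<alpha>" and C: "C \<in> TA" and z: "z \<in> chart_image C W"
  shows "covector_rep TA C \<alpha> z w = coeff C \<alpha> z \<bullet> fst w"
proof -
  have lin: "linear (covector_rep TA C \<alpha> z)"
    using \<alpha> by (intro linear_covector_rep[OF _ C z]) (simp add: semi_basic_form_def)
  have "covector_rep TA C \<alpha> z w = covector_rep TA C \<alpha> z (fst w, 0)"
    using linear_split[OF lin, of "fst w" "snd w"] covector_rep_vertical[OF \<alpha> C z] by simp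
  also have "\<dots> = coeff C \<alpha> z \<bullet> fst w"
    using linear_functional_expansion[OF linear_horizontal_part[OF lin], of "fst w"]
    by (simp add: coeff_def inner_sum_right inner_commute[of _ "fst w"] mult.commute)
  finally show ?thesis .
qed

lemma semibasic_in_chart:
  assumes \<alpha>: "semi_basic_form A W \<alpha>" and C: "C \<in> TA" and U: "open U" "U \<subseteq> chart_image C W"
  shows "semibasic_in_chart U (coeff C \<alpha>) (form_rep TA C \<alpha>)"
proof
  have "smooth_on (chart_image C W) (\<lambda>z. covector_rep TA C \<alpha> z w)" for w
    using \<alpha> C unfolding semi_basic_form_def one_form_def by blast
  then show "smooth_on U (coeff C \<alpha>)"
    unfolding coeff_def
    by (intro smooth_on_sum smooth_on_scaleR smooth_on_const U finite_Basis smooth_on_subset[OF U(2)])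
  show "form_rep TA C \<alpha> z [w] = coeff C \<alpha> z \<bullet> fst w" if "z \<in> U" for z w
    using coeff_inner[OF \<alpha> C subsetD[OF U(2) that]] by (simp add: form_rep_def)
qed (rule U)

lemma force_in_chart:
  "C \<in> TA \<Longrightarrow> open U \<Longrightarrow> U \<subseteq> snd C ` fst C \<Longrightarrow> semibasic_in_chart U (coeff C \<sigma>) (form_rep TA C \<sigma>)"
  using semibasic_in_chart[OF force] by (simp add: chart_image_bundle)

lemma covector_rep_change:
  assumes C: "C \<in> TA" "C' \<in> TA" and z: "z \<in> chart_image C (fst C')"
  shows "covector_rep TA C' \<alpha> (transition C C' z) (D (transition C C') z w) = covector_rep TA C \<alpha> z w"
proof -
  obtain u where u: "u \<in> fst C" "u \<in> fst C'" "z = snd C u" using z by (blast elim: total.overlapE)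
  then show ?thesis
    using C total.tvec_of_change[of C u C' w]
    by (simp add: covector_rep_def charts_at_def total.transition_chart total.chart_inv_chart)
qed

text \<open>\<open>Lagrangian_type_near\<close> without non-triviality: a local solution around the
  given point may have zero Hessian, so the two requirements are tracked separately.\<close>

definition solves :: "('m, 'e) tpoint set \<Rightarrow> (('m, 'e) tpoint \<Rightarrow> real) \<Rightarrow> bool" where
  "solves W L \<longleftrightarrow> smooth_function TA W L \<and>
    (\<forall>C\<in>TA. \<forall>z\<in>chart_image C W. \<forall>X.
      Lagrange_diff (field_rep C S) (fun_rep C L) z [X] = form_rep TA C \<sigma> z [X])"

text \<open>\<open>Lagrange_diff\<close> is built from derivatives, so agreement on an open set is
  enough; needed for a function defined by cases.\<close>

lemma solves_cong:
  assumes W: "atlas_open TA W" and L: "solves W L" and eq: "\<And>u. u \<in> W \<Longrightarrow> L' u = L u"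
  shows "solves W L'"
  unfolding solves_def smooth_function_def
proof (intro conjI ballI allI)
  fix C assume C: "C \<in> TA"
  note op = open_chart_image[OF W C]
  have e: "fun_rep C L z = fun_rep C L' z" if "z \<in> chart_image C W" for z
    using eq chart_point(1)[OF C that] by (simp add: fun_rep_def)
  have sm: "smooth_on (chart_image C W) (fun_rep C L)"
    using L C by (simp add: solves_def smooth_function_def)
  show sm': "smooth_on (chart_image C W) (fun_rep C L')" by (rule smooth_on_cong[OF op e sm])
  fix z and X :: "'e \<times> 'e" assume z: "z \<in> chart_image C W"
  interpret spray_chart "chart_image C W" "field_rep C S" "\<lambda>z. snd (field_rep C S z)"
    by (rule spray_chart[OF C op chart_image_subset])
  have D1: "D (fun_rep C L) x v = D (fun_rep C L') x v" if "x \<in> chart_image C W" for x v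
    by (simp add: D_cong_open[OF op that e])
  have "D (\<lambda>x. D (fun_rep C L) x (0, fst X)) z = D (\<lambda>x. D (fun_rep C L') x (0, fst X)) z"
    by (rule D_cong_open[OF op z D1])
  then have "Lagrange_diff (field_rep C S) (fun_rep C L') z [X] = Lagrange_diff (field_rep C S)
      (fun_rep C L) z [X]"
    by (simp add: Lagrange_diff_eq[OF sm z] Lagrange_diff_eq[OF sm' z] D1[OF z])
  also have "\<dots> = form_rep TA C \<sigma> z [X]"
    using L C z unfolding solves_def by blast
  finally show "Lagrange_diff (field_rep C S) (fun_rep C L') z [X] = form_rep TA C \<sigma> z [X]" .
qed

lemma solves_Un:
  assumes W: "atlas_open TA W" "atlas_open TA W'" and L: "solves W L" "solves W' L"
  shows "solves (W \<union> W') L"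
  unfolding solves_def smooth_function_def
proof (intro conjI ballI allI)
  fix C assume C: "C \<in> TA"
  show "smooth_on (chart_image C (W \<union> W')) (fun_rep C L)"
    unfolding total.chart_image_Un
    using L C open_chart_image[OF W(1) C] open_chart_image[OF W(2) C]
    by (intro smooth_on_locally) (auto simp: solves_def smooth_function_def)
  show "Lagrange_diff (field_rep C S) (fun_rep C L) z [X] = form_rep TA C \<sigma> z [X]"
    if "z \<in> chart_image C (W \<union> W')" for z X
    using that L C unfolding total.chart_image_Un solves_def by blast
qed

text \<open>A solution in one chart solves the equation in all others: the left-hand side transforms
  by \<open>Lagrange_diff_natural\<close>, the force as a covector.\<close>

lemma solves_pullback:
  assumes C: "C \<in> TA" and V: "open V" "V \<subseteq> snd C ` fst C" and L: "smooth_on V L"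
    and EL: "\<And>z X. z \<in> V \<Longrightarrow> Lagrange_diff (field_rep C S) L z [X] = coeff C \<sigma> z \<bullet> fst X"
  shows "solves {u \<in> fst C. snd C u \<in> V} (\<lambda>u. L (snd C u))"
  unfolding solves_def smooth_function_def
proof (intro conjI ballI allI)
  let ?W = "{u \<in> fst C. snd C u \<in> V}"
  fix C' assume C': "C' \<in> TA"
  let ?\<Omega> = "chart_image C' ?W"
  have \<Omega>: "open ?\<Omega>" "?\<Omega> \<subseteq> chart_image C' (fst C)"
    using open_chart_image[OF total.atlas_open_pullback[OF C V] C'] by (auto simp: chart_image_def)
  have tr: "transition C' C z \<in> V" if "z \<in> ?\<Omega>" for z
    using that total.transition_chart[OF C', of _ C] by (auto simp: chart_image_def)
  obtain F where "tangent_transition ?\<Omega> (field_rep C' S) (\<lambda>z. snd (field_rep C' S z))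
    V (field_rep C S) (\<lambda>z. snd (field_rep C S z)) (transition C' C) F"
    using tangent_transition[OF C' C \<Omega> V tr] by blast
  then interpret tangent_transition ?\<Omega> "field_rep C' S" "\<lambda>z. snd (field_rep C' S z)"
    V "field_rep C S" "\<lambda>z. snd (field_rep C S z)" "transition C' C" F .
  have rep: "L (transition C' C z) = fun_rep C' (\<lambda>u. L (snd C u)) z" for z
    by (simp add: fun_rep_def transition_def)
  then have rep': "fun_rep C' (\<lambda>u. L (snd C u)) = (\<lambda>z. L (transition C' C z))" by auto
  show "smooth_on ?\<Omega> (fun_rep C' (\<lambda>u. L (snd C u)))"
    unfolding rep' by (rule smooth_pullback[OF L])
  fix z X assume z: "z \<in> ?\<Omega>"
  have "Lagrange_diff (field_rep C' S) (\<lambda>z. L (transition C' C z)) z [X] =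
      coeff C \<sigma> (transition C' C z) \<bullet> fst (D (transition C' C) z X)"
    unfolding Lagrange_diff_natural[OF L z] by (rule EL[OF tr[OF z]])
  also have "\<dots> = covector_rep TA C \<sigma> (transition C' C z) (D (transition C' C) z X)"
    using tr[OF z] V(2) by (intro coeff_inner[OF force C, symmetric]) (auto simp: chart_image_bundle[OF C])
  also have "\<dots> = covector_rep TA C' \<sigma> z X"
    using z \<Omega>(2) by (intro covector_rep_change C C') blast
  finally show "Lagrange_diff (field_rep C' S) (fun_rep C' (\<lambda>u. L (snd C u))) z [X] = form_rep TA C'
      \<sigma> z [X]"
    unfolding rep' by (simp add: form_rep_def)
qed

definition Helmholtz :: "('m, 'e) tpoint set \<Rightarrow>
    (('m, 'e) tpoint \<Rightarrow> (('m, 'e) tpoint, 'e \<times> 'e) tvec \<Rightarrow> real) \<Rightarrow> bool" where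
  "Helmholtz W \<theta> \<longleftrightarrow> semi_basic_form A W \<theta> \<and> GH1 A W \<theta> \<and> GH2 A S \<sigma> W \<theta> \<and> GH3 A S \<sigma> W \<theta>"

lemma Helmholtz_subset:
  assumes "W' \<subseteq> W" "Helmholtz W \<theta>"
  shows "Helmholtz W' \<theta>"
proof -
  have im: "chart_image C W' \<subseteq> chart_image C W" for C :: "(('m, 'e) tpoint, 'e \<times> 'e) chart"
    by (rule total.chart_image_mono[OF assms(1)])
  have form: "one_form TA W \<theta>" and vert: "\<forall>u\<in>W. \<forall>\<xi>. vertical A u \<xi> \<longrightarrow> \<theta> u \<xi> = 0"
    using assms(2) by (auto simp: Helmholtz_def semi_basic_form_def)
  have "one_form TA W' \<theta>"
    using form smooth_on_subset[OF im] assms(1) unfolding one_form_def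
    by (intro conjI; blast)
  moreover have "GH1 A W' \<theta>" "GH2 A S \<sigma> W' \<theta>" "GH3 A S \<sigma> W' \<theta>"
    using assms(2) im unfolding Helmholtz_def GH1_def GH2_def GH3_def by blast+
  ultimately show ?thesis
    using vert assms(1) unfolding Helmholtz_def semi_basic_form_def by blast
qed

text \<open>A ball in the chart supplies the convex set for the Poincare lemma. The Hessian is
  recorded at \<open>u\<close> in the chart \<open>C\<close> only, which suffices to carry one
  nonzero entry from \<open>\<theta>\<close> to \<open>L\<close>.\<close>

lemma local_Lagrangian:
  assumes W: "atlas_open TA W" and \<theta>: "Helmholtz W \<theta>" and C: "C \<in> TA" and u: "u \<in> W" "u \<in> fst C"
  obtains W' L where "atlas_open TA W'" "u \<in> W'" "W' \<subseteq> W" "solves W' L"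
    "\<And>e a. D (\<lambda>z. D (fun_rep C L) z (0, e)) (snd C u) (0, a) =
      D (\<lambda>z. covector_rep TA C \<theta> z (e, 0)) (snd C u) (0, a)"
proof -
  let ?U = "chart_image C W"
  have sb: "semi_basic_form A W \<theta>" using \<theta> by (simp add: Helmholtz_def)
  have zU: "snd C u \<in> ?U" using u by (auto simp: chart_image_def)
  obtain r where r: "r > 0" "ball (snd C u) r \<subseteq> ?U"
    using open_chart_image[OF W C] zU by (auto simp: open_contains_ball)
  let ?B = "ball (snd C u) r"
  have B: "open ?B" "?B \<subseteq> snd C ` fst C" "snd C u \<in> ?B"
    using r chart_image_subset[of C W] by auto
  interpret spray_chart ?B "field_rep C S" "\<lambda>z. snd (field_rep C S z)"
    by (rule spray_chart[OF C B(1,2)])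
  have t: "semibasic_in_chart ?B (coeff C \<theta>) (form_rep TA C \<theta>)"
    by (rule semibasic_in_chart[OF sb C B(1) r(2)])
  have q: "semibasic_in_chart ?B (coeff C \<sigma>) (form_rep TA C \<sigma>)"
    by (rule force_in_chart[OF C B(1,2)])
  have H: "Helmholtz_1 (coeff C \<theta>) z" "Helmholtz_2 (coeff C \<theta>) (coeff C \<sigma>) z" "Helmholtz_3 (coeff C
      \<theta>) (coeff C \<sigma>) z" if z: "z \<in> ?B" for z
    using \<theta> C z r(2)
    unfolding GH1_iff[OF t z, symmetric] GH2_iff[OF t q z, symmetric] GH3_iff[OF t q z, symmetric]
    by (auto simp: Helmholtz_def GH1_def GH2_def GH3_def Let_def)
  obtain L where L: "smooth_on ?B L"
    "\<And>z X. z \<in> ?B \<Longrightarrow> Lagrange_diff (field_rep C S) L z [X] = coeff C \<sigma> z \<bullet> fst X"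
    "\<And>z e a. z \<in> ?B \<Longrightarrow> D (\<lambda>x. D L x (0, e)) z (0, a) = D (coeff C \<theta>) z (0, a) \<bullet> e"
    using Lagrangian_of_Helmholtz[OF semibasic_in_chart.smooth_t[OF t] semibasic_in_chart.smooth_t[OF q] H
        convex_ball B(3)] by blast
  let ?W = "{u \<in> fst C. snd C u \<in> ?B}" and ?L = "\<lambda>u. L (snd C u)"
  show thesis
  proof
    show "atlas_open TA ?W" by (rule total.atlas_open_pullback[OF C B(1,2)])
    show "u \<in> ?W" using u B by simp
    show "?W \<subseteq> W"
    proof
      fix x assume x: "x \<in> ?W"
      then have "snd C x \<in> chart_image C W" using r(2) by blast
      from chart_point(1)[OF C this] show "x \<in> W" using x total.chart_inv_chart[OF C] by simp
    qed
    show "solves ?W ?L" by (rule solves_pullback[OF C B(1,2) L(1,2)])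
    fix e a
    have fr: "fun_rep C ?L z = L z" if "z \<in> ?B" for z
      using chart_point(4)[OF C, of z W] r(2) that by (auto simp: fun_rep_def)
    have "D (fun_rep C ?L) z (0, e) = D L z (0, e)" if "z \<in> ?B" for z
      by (rule fun_cong[OF D_cong_open[OF B(1) that fr]])
    then have "D (\<lambda>z. D (fun_rep C ?L) z (0, e)) (snd C u) = D (\<lambda>z. D L z (0, e)) (snd C u)"
      by (rule D_cong_open[OF B(1,3)])
    then have "D (\<lambda>z. D (fun_rep C ?L) z (0, e)) (snd C u) (0, a) = D (coeff C \<theta>) (snd C u) (0, a) \<bullet> e"
      by (simp add: L(3)[OF B(3)])
    also have "\<dots> = D (\<lambda>z. form_rep TA C \<theta> z [(e, 0)]) (snd C u) (0, a)"
      by (simp add: semibasic_in_chart.D_form[OF t B(3)])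
    finally show "D (\<lambda>z. D (fun_rep C ?L) z (0, e)) (snd C u) (0, a) =
      D (\<lambda>z. covector_rep TA C \<theta> z (e, 0)) (snd C u) (0, a)" by (simp add: form_rep_def)
  qed
qed

text \<open>This is \<open>d_J L\<close>. A form must be given on abstract tangent vectors, so some
  chart at \<open>u\<close> is chosen; \<open>vertical_differential_eq\<close> shows that the choice
  is immaterial where \<open>L\<close> is smooth.\<close>

definition vertical_differential ::
    "(('m, 'e) tpoint \<Rightarrow> real) \<Rightarrow> ('m, 'e) tpoint \<Rightarrow> (('m, 'e) tpoint, 'e \<times> 'e) tvec \<Rightarrow> real" where
  "vertical_differential L u \<xi> =
    (let C = (SOME C. C \<in> charts_at TA u) in D (fun_rep C L) (snd C u) (0, fst (\<xi> C)))"

text \<open>By \<open>D_\<phi>_vertical\<close> the fibre gradient of \<open>L\<close> picks up the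
  Jacobian of the base map under a change of charts, and the horizontal part of \<open>\<xi>\<close>
  transforms by the same Jacobian.\<close>

lemma vertical_differential_eq:
  assumes W: "atlas_open TA W" and L: "smooth_function TA W L" and u: "u \<in> W"
    and C: "C \<in> charts_at TA u" and \<xi>: "\<xi> \<in> tangent_space TA u"
  shows "vertical_differential L u \<xi> = D (fun_rep C L) (snd C u) (0, fst (\<xi> C))"
proof -
  have change: "D (fun_rep C L) (snd C u) (0, fst (\<xi> C)) = D (fun_rep C' L) (snd C' u) (0, fst (\<xi> C'))"
    if C: "C \<in> charts_at TA u" and C': "C' \<in> charts_at TA u" for C C'
  proof -
    have CA: "C \<in> TA" "C' \<in> TA" and uC: "u \<in> fst C" "u \<in> fst C'" using C C' by (auto simp: charts_at_def)
    let ?\<Omega> = "chart_image C (W \<inter> fst C')" and ?\<Omega>' = "chart_image C' W"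
    have \<Omega>: "open ?\<Omega>" "?\<Omega> \<subseteq> chart_image C (fst C')" "snd C u \<in> ?\<Omega>"
      using u uC CA W by (auto simp: atlas_open_def total.chart_image_Int intro: total.open_overlap)
        (auto simp: chart_image_def)
    have tr: "transition C C' z \<in> ?\<Omega>'" if "z \<in> ?\<Omega>" for z
      using that total.transition_chart[OF CA(1), of _ C'] by (auto simp: chart_image_def)
    obtain F where "tangent_transition ?\<Omega> (field_rep C S) (\<lambda>z. snd (field_rep C S z))
      ?\<Omega>' (field_rep C' S) (\<lambda>z. snd (field_rep C' S z)) (transition C C') F"
      using tangent_transition[OF CA \<Omega>(1,2) open_chart_image[OF W CA(2)] chart_image_subset tr] by blast
    then interpret tangent_transition ?\<Omega> "field_rep C S" "\<lambda>z. snd (field_rep C S z)"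
      ?\<Omega>' "field_rep C' S" "\<lambda>z. snd (field_rep C' S z)" "transition C C'" F .
    have sm: "smooth_on ?\<Omega>' (fun_rep C' L)" using L CA by (simp add: smooth_function_def)
    have "fun_rep C L z = fun_rep C' L (transition C C' z)" if "z \<in> ?\<Omega>" for z
      using total.fun_rep_change[OF CA] \<Omega>(2) that by blast
    from D_cong_open[OF \<Omega>(1,3) this]
    have "D (fun_rep C L) (snd C u) (0, fst (\<xi> C)) =
        D (fun_rep C' L) (snd C' u) (0, D F (snd C u) (fst (\<xi> C), 0))"
      by (simp add: D_pullback[OF sm \<Omega>(3)] D_\<phi>_vertical[OF \<Omega>(3)] total.transition_chart[OF CA(1) uC(1)])
    moreover have "\<xi> C' = D (transition C C') (snd C u) (\<xi> C)"
      by (rule total.tangent_change[OF \<xi> C C'])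
    then have "fst (\<xi> C') = D F (snd C u) (fst (\<xi> C), 0)"
      using D_F[OF \<Omega>(3), of "\<xi> C"] by (simp add: D_\<phi>[OF \<Omega>(3)])
    ultimately show ?thesis by simp
  qed
  have "(SOME C. C \<in> charts_at TA u) \<in> charts_at TA u" using C by (rule someI)
  from change[OF this C] show ?thesis by (simp add: vertical_differential_def Let_def)
qed

lemma covector_rep_vertical_differential:
  assumes W: "atlas_open TA W" and L: "smooth_function TA W L" and C: "C \<in> TA" and z: "z \<in> chart_image C W"
  shows "covector_rep TA C (vertical_differential L) z w = D (fun_rep C L) z (0, fst w)"
proof -
  note p = chart_point[OF C z]
  show ?thesis
    using vertical_differential_eq[OF W L p(1,3) total.tvec_of_in_tangent_space[OF p(3)]]
    by (simp add: covector_rep_def total.tvec_of_component[OF p(3)] p(4))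
qed

lemma semi_basic_vertical_differential:
  assumes W: "atlas_open TA W" and L: "smooth_function TA W L"
  shows "semi_basic_form A W (vertical_differential L)"
proof -
  have smL: "smooth_on (chart_image C W) (fun_rep C L)" if "C \<in> TA" for C
    using L that by (simp add: smooth_function_def)
  have chart: "\<exists>C\<in>charts_at TA u. True" if "u \<in> W" for u
    using W that unfolding atlas_open_def charts_at_def by blast
  have lin: "linear (\<lambda>e. D (fun_rep C L) (snd C u) (0, e))" if "u \<in> W" "C \<in> charts_at TA u" for u C
    using that by (intro linear_vertical_part smooth_on_D_linear[OF smL])
      (auto simp: charts_at_def chart_image_def)
  have "vertical_differential L u (\<lambda>c. a *\<^sub>R v c + b *\<^sub>R w c) =
      a * vertical_differential L u v + b * vertical_differential L u w"
    if u: "u \<in> W" and v: "v \<in> tangent_space TA u" and w: "w \<in> tangent_space TA u" for u v w a b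
  proof -
    obtain C where C: "C \<in> charts_at TA u" using chart[OF u] by blast
    have "tvec_of TA C u (a *\<^sub>R v C + b *\<^sub>R w C) = (\<lambda>c. a *\<^sub>R v c + b *\<^sub>R w c)"
      using total.tvec_of_linear[OF C, of a "v C" b "w C"]
      by (simp add: total.tvec_of_tangent[OF C v] total.tvec_of_tangent[OF C w])
    with total.tvec_of_in_tangent_space[OF C, of "a *\<^sub>R v C + b *\<^sub>R w C"]
    have "(\<lambda>c. a *\<^sub>R v c + b *\<^sub>R w c) \<in> tangent_space TA u" by simp
    from vertical_differential_eq[OF W L u C this] vertical_differential_eq[OF W L u C v]
      vertical_differential_eq[OF W L u C w]
    show ?thesis by (simp add: linear_add[OF lin[OF u C]] linear_cmul[OF lin[OF u C]])
  qed
  moreover have "smooth_on (chart_image C W) (\<lambda>z. covector_rep TA C (vertical_differential L) z w)"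
    if C: "C \<in> TA" for C w
    by (rule smooth_on_cong[OF open_chart_image[OF W C] covector_rep_vertical_differential[OF W L C,
        symmetric]
          smooth_on_D[OF smL[OF C]]])
  moreover have "vertical_differential L u \<xi> = 0" if u: "u \<in> W" and \<xi>: "vertical A u \<xi>" for u \<xi>
  proof -
    obtain C where C: "C \<in> charts_at TA u" using chart[OF u] by blast
    show ?thesis
      using vertical_differential_eq[OF W L u C, of \<xi>] \<xi> C linear_0[OF lin[OF u C]]
      by (simp add: vertical_def)
  qed
  ultimately show ?thesis unfolding semi_basic_form_def one_form_def by blast
qed

lemma Helmholtz_vertical_differential:
  assumes W: "atlas_open TA W" and L: "solves W L"
  shows "Helmholtz W (vertical_differential L)"
proof -
  let ?\<theta> = "vertical_differential L"
  have smL: "smooth_function TA W L" using L by (simp add: solves_def)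
  note sb = semi_basic_vertical_differential[OF W smL]
  have "(\<forall>X Y. d_endo tangent_structure (form_rep TA C ?\<theta>) z [X, Y] = 0) \<and>
    (\<forall>X Y. d_endo (Jacobi_endo (field_rep C S)) (form_rep TA C ?\<theta>) z [X, Y] =
         1/2 * dyn_deriv (field_rep C S) (d_endo tangent_structure (form_rep TA C \<sigma>)) z [X, Y]
           - d_endo (hor_proj (field_rep C S)) (form_rep TA C \<sigma>) z [X, Y]) \<and>
    (\<forall>X Y. dyn_deriv (field_rep C S) (d_endo (ver_proj (field_rep C S)) (form_rep TA C ?\<theta>)) z [X, Y] =
         d_endo (ver_proj (field_rep C S)) (form_rep TA C \<sigma>) z [X, Y]
           - 1/2 * ins (\<lambda>z w. complex_structure (field_rep C S) z w + tangent_structure z w)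
               (d_endo tangent_structure (form_rep TA C \<sigma>)) z [X, Y])"
    if C: "C \<in> TA" and z: "z \<in> chart_image C W" for C z
  proof -
    let ?U = "chart_image C W"
    note U = open_chart_image[OF W C]
    interpret spray_chart ?U "field_rep C S" "\<lambda>z. snd (field_rep C S z)"
      by (rule spray_chart[OF C U chart_image_subset])
    have t: "semibasic_in_chart ?U (coeff C ?\<theta>) (form_rep TA C ?\<theta>)"
      by (rule semibasic_in_chart[OF sb C U subset_refl])
    have q: "semibasic_in_chart ?U (coeff C \<sigma>) (form_rep TA C \<sigma>)"
      by (rule force_in_chart[OF C U chart_image_subset])
    have "coeff C ?\<theta> z \<bullet> e = D (fun_rep C L) z (0, e)" if "z \<in> ?U" for z e
      using coeff_inner[OF sb C that, of "(e, 0)"] covector_rep_vertical_differential[OF W smL C that]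
      by simp
    moreover have "Lagrange_diff (field_rep C S) (fun_rep C L) z [X] = coeff C \<sigma> z \<bullet> fst X" if "z \<in>
        ?U" for z X
      using L C that semibasic_in_chart.form_eq[OF q that] unfolding solves_def by metis
    moreover have "smooth_on ?U (fun_rep C L)" using smL C by (simp add: smooth_function_def)
    ultimately show ?thesis
      unfolding GH1_iff[OF t z] GH2_iff[OF t q z] GH3_iff[OF t q z]
      using Helmholtz_of_Lagrangian[of "fun_rep C L" "coeff C ?\<theta>" "coeff C \<sigma>" z]
        semibasic_in_chart.smooth_t[OF t] semibasic_in_chart.smooth_t[OF q] z by blast
  qed
  with sb show ?thesis unfolding Helmholtz_def GH1_def GH2_def GH3_def Let_def by blast
qed

end

text \<open>The Hausdorff property is available on the base. Over distinct base points, preimages of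
  base sets separate; two points of one fibre lie in a common induced chart and are separated in
  Euclidean space.\<close>

lemma tangent_bundle_separation:
  assumes M: "smooth_manifold M A" and u: "u \<in> tangent_bundle A" "u' \<in> tangent_bundle A" "u \<noteq> u'"
  obtains V V' where "atlas_open (tangent_atlas A) V" "atlas_open (tangent_atlas A) V'"
    "u \<in> V" "u' \<in> V'" "V \<inter> V' = {}"
proof -
  interpret base: smooth_atlas A by (rule smooth_manifold_atlas[OF M])
  interpret total: smooth_atlas "tangent_atlas A" by (rule base.smooth_atlas_tangent)
  have base_point: "fst w \<in> (\<Union>c\<in>A. fst c)" if "w \<in> tangent_bundle A" for w
    using that by (cases w) (simp add: tangent_bundle_def)
  show thesis
  proof (cases "fst u = fst u'")
    case False
    have "topspace M = (\<Union>c\<in>A. fst c)" using M by (simp add: smooth_manifold_def)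
    then have "fst u \<in> topspace M" "fst u' \<in> topspace M" using u base_point by simp_all
    moreover have "Hausdorff_space M" using M by (simp add: smooth_manifold_def)
    ultimately obtain O1 O2 where O: "openin M O1" "openin M O2" "fst u \<in> O1" "fst u' \<in> O2" "disjnt O1 O2"
      using False unfolding Hausdorff_space_def by blast
    let ?V = "\<lambda>O1. (SIGMA p:O1. tangent_space A p)"
    have "atlas_open (tangent_atlas A) (?V O1)" if "openin M O1" for O1
      unfolding atlas_open_def
    proof (intro conjI ballI)
      have "O1 \<subseteq> (\<Union>c\<in>A. fst c)"
        using openin_subset[OF that] \<open>topspace M = _\<close> by simp
      then show "?V O1 \<subseteq> (\<Union>C\<in>tangent_atlas A. fst C)"
        by (fastforce simp: tangent_atlas_def base.fst_induced_chart)
      fix C assume "C \<in> tangent_atlas A"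
      then obtain c where c: "c \<in> A" "C = induced_chart A c" by (auto simp: tangent_atlas_def)
      show "open (chart_image C (?V O1))"
        unfolding c(2) base.chart_image_induced[OF c(1)]
        by (intro open_Times open_chart_image_openin[OF M c(1) that] open_UNIV)
    qed
    moreover have "u \<in> ?V O1" "u' \<in> ?V O2" using u O by (auto simp: tangent_bundle_def)
    moreover have "?V O1 \<inter> ?V O2 = {}" using O(5) by (auto simp: disjnt_def)
    ultimately show thesis using O(1,2) by (intro that)
  next
    case True
    obtain c where c: "c \<in> A" "fst u \<in> fst c" using base_point[OF u(1)] by blast
    let ?C = "induced_chart A c"
    have C: "?C \<in> tangent_atlas A" using c by (simp add: tangent_atlas_def)
    have uC: "u \<in> fst ?C" "u' \<in> fst ?C"
      using u c True by (auto simp: base.fst_induced_chart tangent_bundle_def)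
    then have "snd ?C u \<noteq> snd ?C u'" using total.inj_chart[OF C] u(3) by (auto simp: inj_on_def)
    then obtain G G' where G: "open G" "open G'" "snd ?C u \<in> G" "snd ?C u' \<in> G'" "G \<inter> G' = {}"
      by (meson hausdorff)
    let ?V = "\<lambda>G. {u \<in> fst ?C. snd ?C u \<in> G \<inter> snd ?C ` fst ?C}"
    have "atlas_open (tangent_atlas A) (?V G)" if "open G" for G
      by (rule total.atlas_open_pullback[OF C open_Int[OF that total.open_image[OF C]] Int_lower2])
    moreover have "u \<in> ?V G" "u' \<in> ?V G'" "?V G \<inter> ?V G' = {}" using G uC by auto
    ultimately show thesis using G(1,2) by (intro that[of "?V G" "?V G'"])
  qed
qed

theorem theorem3p2:
  fixes M :: "'m topology"
    and A :: "('m, real^'n) chart set"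
    and S :: "('m, real^'n) tpoint \<Rightarrow> (('m, real^'n) tpoint, (real^'n) \<times> (real^'n)) tvec"
    and \<sigma> :: "('m, real^'n) tpoint \<Rightarrow> (('m, real^'n) tpoint, (real^'n) \<times> (real^'n)) tvec \<Rightarrow> real"
  assumes "smooth_manifold M A"
    and "semispray A S"
    and "semi_basic_form A (tangent_bundle A) \<sigma>"
  shows "\<forall>u \<in> tangent_bundle A.
    Lagrangian_type_near A S \<sigma> u \<longleftrightarrow>
    (\<exists>W \<theta>. atlas_open (tangent_atlas A) W \<and> u \<in> W \<and>
       semi_basic_form A W \<theta> \<and> nontrivial_form A W \<theta> \<and>
       GH1 A W \<theta> \<and> GH2 A S \<sigma> W \<theta> \<and> GH3 A S \<sigma> W \<theta>)"
proof (intro ballI iffI)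
  interpret forced_semispray A S \<sigma>
    by (rule forced_semispray.intro[OF smooth_manifold_atlas[OF assms(1)] assms(2,3)])
  fix u assume u: "u \<in> tangent_bundle A"
  {
    assume "Lagrangian_type_near A S \<sigma> u"
    then obtain W L where W: "atlas_open TA W" and uW: "u \<in> W" and L: "Lagrangian A W L"
      and EL: "\<forall>C\<in>TA. \<forall>z\<in>chart_image C W. \<forall>X.
        Lagrange_diff (field_rep C S) (fun_rep C L) z [X] = form_rep TA C \<sigma> z [X]"
      unfolding Lagrangian_type_near_def by blast
    have smL: "smooth_function TA W L" using L by (simp add: Lagrangian_def)
    have sol: "solves W L" unfolding solves_def using smL EL by blast
    let ?\<theta> = "vertical_differential L"
    \<comment> \<open>The matrix attached to \<open>d_J L\<close> is the Hessian of
      \<open>L\<close>.\<close>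
    have "nontrivial_form A W ?\<theta>"
    proof -
      obtain C z i j where C: "C \<in> TA" and z: "z \<in> chart_image C W" and
        ne: "D (\<lambda>z. D (fun_rep C L) z (0, axis i 1)) z (0, axis j 1) \<noteq> 0"
        using L unfolding Lagrangian_def by blast
      have rep: "covector_rep TA C ?\<theta> z (axis i 1, 0) = D (fun_rep C L) z (0, axis i 1)"
        if "z \<in> chart_image C W" for z
        using covector_rep_vertical_differential[OF W smL C that] by simp
      have "D (\<lambda>z. covector_rep TA C ?\<theta> z (axis i 1, 0)) z = D (\<lambda>z. D (fun_rep C L) z (0, axis i 1)) z"
        by (rule D_cong_open[OF open_chart_image[OF W C] z rep])
      with ne C z show ?thesis unfolding nontrivial_form_def by metis
    qed
    with Helmholtz_vertical_differential[OF W sol] W uW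
    show "\<exists>W \<theta>. atlas_open TA W \<and> u \<in> W \<and> semi_basic_form A W \<theta> \<and> nontrivial_form A W \<theta> \<and>
       GH1 A W \<theta> \<and> GH2 A S \<sigma> W \<theta> \<and> GH3 A S \<sigma> W \<theta>"
      unfolding Helmholtz_def by blast
  next
    assume "\<exists>W \<theta>. atlas_open TA W \<and> u \<in> W \<and> semi_basic_form A W \<theta> \<and> nontrivial_form A W \<theta> \<and>
       GH1 A W \<theta> \<and> GH2 A S \<sigma> W \<theta> \<and> GH3 A S \<sigma> W \<theta>"
    then obtain W \<theta> where W: "atlas_open TA W" and uW: "u \<in> W" and nt: "nontrivial_form A W \<theta>"
      and H: "Helmholtz W \<theta>"
      unfolding Helmholtz_def by blast
    obtain C z i j where C: "C \<in> TA" and z: "z \<in> chart_image C W" and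
      ne: "D (\<lambda>z. covector_rep TA C \<theta> z (axis i 1, 0)) z (0, axis j 1) \<noteq> 0"
      using nt unfolding nontrivial_form_def by blast
    \<comment> \<open>A point where the fibre derivative of \<open>\<theta>\<close> is nonzero, in
      general different from \<open>u\<close>.\<close>
    obtain u' where u': "u' \<in> W" "u' \<in> fst C" "z = snd C u'" using z by (blast elim: total.overlapE)
    have nontrivial: "Lagrangian A W' L"
      if L: "solves W' L" and W': "u' \<in> W'"
        and eq: "\<And>e a. D (\<lambda>z. D (fun_rep C L) z (0, e)) (snd C u') (0, a) =
          D (\<lambda>z. covector_rep TA C \<theta> z (e, 0)) (snd C u') (0, a)" for W' L
    proof -
      have "snd C u' \<in> chart_image C W'" using u' W' by (auto simp: chart_image_def)
      then show ?thesis
        using L ne C eq[of "axis i 1" "axis j 1"] unfolding Lagrangian_def solves_def u'(3) by metis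
    qed
    have goal: "Lagrangian_type_near A S \<sigma> u"
      if "atlas_open TA W'" "u \<in> W'" "solves W' L" "Lagrangian A W' L" for W' L
      unfolding Lagrangian_type_near_def using that unfolding solves_def by blast
    show "Lagrangian_type_near A S \<sigma> u"
    proof (cases "u = u'")
      case True
      from local_Lagrangian[OF W H C u'(1,2)] obtain W' L where
        *: "atlas_open TA W'" "u' \<in> W'" "solves W' L"
        "\<And>e a. D (\<lambda>z. D (fun_rep C L) z (0, e)) (snd C u') (0, a) =
          D (\<lambda>z. covector_rep TA C \<theta> z (e, 0)) (snd C u') (0, a)"
        by metis
      then show ?thesis using goal nontrivial True by blast
    next
      case False
      have "u' \<in> tangent_bundle A" using u'(1) atlas_open_subset[OF W] by blast
      \<comment> \<open>Disjoint neighbourhoods let the two local solutions be joined without having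
        to match anywhere.\<close>
      from tangent_bundle_separation[OF assms(1) u this False] obtain V V' where
        V: "atlas_open TA V" "atlas_open TA V'" "u \<in> V" "u' \<in> V'" "V \<inter> V' = {}" by metis
      obtain C0 where C0: "C0 \<in> TA" "u \<in> fst C0" using W uW unfolding atlas_open_def by blast
      from local_Lagrangian[OF total.atlas_open_Int[OF W V(1)] Helmholtz_subset[OF Int_lower1 H]
          C0(1) _ C0(2)]
        uW V(3)
      obtain W1 L1 where W1: "atlas_open TA W1" "u \<in> W1" "W1 \<subseteq> W \<inter> V" "solves W1 L1"
        by (metis IntI)
      from local_Lagrangian[OF total.atlas_open_Int[OF W V(2)] Helmholtz_subset[OF Int_lower1 H] C _ u'(2)]
        u'(1) V(4)
      obtain W2 L2 where W2: "atlas_open TA W2" "u' \<in> W2" "W2 \<subseteq> W \<inter> V'" "solves W2 L2"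
        and L2: "\<And>e a. D (\<lambda>z. D (fun_rep C L2) z (0, e)) (snd C u') (0, a) =
          D (\<lambda>z. covector_rep TA C \<theta> z (e, 0)) (snd C u') (0, a)"
        by (metis IntI)
      define L where "L w = (if w \<in> W1 then L1 w else L2 w)" for w
      have L2_eq: "L w = L2 w" if "w \<in> W2" for w
        using that W1(3) W2(3) V(5) by (auto simp: L_def)
      have "solves W1 L" by (rule solves_cong[OF W1(1,4)]) (simp add: L_def)
      moreover have "solves W2 L" by (rule solves_cong[OF W2(1,4) L2_eq])
      ultimately have sol: "solves (W1 \<union> W2) L" by (rule solves_Un[OF W1(1) W2(1)])
      \<comment> \<open>The Hessian at \<open>u'\<close> sees only \<open>W2\<close>, where
        \<open>L\<close> coincides with \<open>L2\<close>.\<close>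
      have op: "open (chart_image C W2)" "snd C u' \<in> chart_image C W2"
        using open_chart_image[OF W2(1) C] W2(2) u'(2) by (auto simp: chart_image_def)
      have "fun_rep C L z = fun_rep C L2 z" if "z \<in> chart_image C W2" for z
        using chart_point(1)[OF C that] by (simp add: fun_rep_def L2_eq)
      then have "D (fun_rep C L) z (0, e) = D (fun_rep C L2) z (0, e)" if "z \<in> chart_image C W2" for z e
        by (rule fun_cong[OF D_cong_open[OF op(1) that]])
      then have "D (\<lambda>z. D (fun_rep C L) z (0, e)) (snd C u') = D (\<lambda>z. D (fun_rep C L2) z (0, e))
          (snd C u')" for e
        by (rule D_cong_open[OF op])
      then have "Lagrangian A (W1 \<union> W2) L"
        using W2(2) by (intro nontrivial[OF sol]) (simp_all add: L2)
      then show ?thesis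
        using W1(2) by (intro goal[OF total.atlas_open_Un[OF W1(1) W2(1)] _ sol]) simp_all
    qed
  }
qed

end
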